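(* Let $W$ be a well-generated, irreducible finite complex reflection group of rank $n$, with Lyashko-Looijenga morphism $\mathrm{LL}:Y\to E_n$. For every partition $\lambda$ of $n$, the restriction $$\mathrm{LL}_\lambda: Y_\lambda^0=\mathrm{LL}^{-1}(E_\lambda^0)\twoheadrightarrow E_\lambda^0$$ is an unramified covering.
   Context: $W\subseteq\mathrm{GL}(V)$, $\dim_{\mathbb{C}}V=n$, is a finite irreducible group generated by reflections (finite order non-identity elements fixing a hyperplane pointwise), and well-generated, i.e. generated by $n$ reflections. $f_1,\dots,f_n$ are homogeneous generators of $\mathbb{C}[V]^W$ of degrees $d_1\le\dots\le d_n=h$, so $W\backslash V\simeq\mathbb{C}^n$ with coordinates $f_1,\dots,f_n$. The discriminant is $\Delta=\prod_{H}\alpha_H^{e_H}\in\mathbb{C}[f_1,\dots,f_n]$, the product over reflecting hyperplanes, where $\alpha_H$ is a linear form with kernel $H$ and $e_H$ is the order of the pointwise stabiliser of $H$. The $f_i$ are chosen such that (up to a scalar) $\Delta=f_n^n+a_2f_n^{n-2}+\dots+a_n$ with $a_i\in\mathbb{C}[f_1,\dots,f_{n-1}]$ (always possible for $W$ well-generated). Put $Y=\mathrm{Spec}\,\mathbb{C}[f_1,\dots,f_{n-1}]\simeq\mathbb{C}^{n-1}$. $E_n$ is the space of centered configurations of $n$ points with multiplicities: the quotient by $\mathfrak{S}_n$ of the hyperplane $\{\sum x_i=0\}$ of $\mathbb{C}^n$. The Lyashko-Looijenga morphism $\mathrm{LL}:Y\to E_n$ sends $y$ to the multiset of roots of $\Delta(y,f_n)=f_n^n+a_2(y)f_n^{n-2}+\dots+a_n(y)$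 as a polynomial in $f_n$. For a partition $\lambda\vdash n$, $E_\lambda^0\subseteq E_n$ is the set of configurations whose multiplicities form the partition $\lambda$. The topology is the classical (transcendental) one, and "covering" is in the broad sense: $Y_\lambda^0$ need not be path-connected, and the statement means that $\mathrm{LL}_\lambda$ is a (path-connected) topological covering on each path-connected component of $Y_\lambda^0$. *)

theory Defs
  imports
    "HOL-Analysis.Analysis"
    "HOL-Algebra.Generated_Groups"
    "HOL-Computational_Algebra.Computational_Algebra"
begin

section \<open>Complex reflection groups\<close>

definition GL :: "(complex^'n^'n) monoid" where
  "GL = \<lparr>carrier = {A. invertible A}, mult = (**), one = mat 1\<rparr>"

lemma GL_simps [simp]:
  "carrier GL = {A. invertible A}" "A \<otimes>\<^bsub>GL\<^esub> B = A ** B" "\<one>\<^bsub>GL\<^esub> = mat 1"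
  by (simp_all add: GL_def)

lemma group_GL: "group GL"
proof (rule groupI)
  fix A :: "complex^'n^'n" assume "A \<in> carrier GL"
  then show "\<exists>B\<in>carrier GL. B \<otimes>\<^bsub>GL\<^esub> A = \<one>\<^bsub>GL\<^esub>"
    by (auto simp: invertible_def)
qed (auto simp: invertible_mult matrix_mul_assoc invertible_def[of "mat 1"])

definition hyperplane :: "(complex^'n) set \<Rightarrow> bool" where
  "hyperplane H \<longleftrightarrow> vec.subspace H \<and> vec.dim H + 1 = CARD('n)"

definition linear_form :: "(complex^'n \<Rightarrow> complex) \<Rightarrow> bool" where
  "linear_form \<phi> \<longleftrightarrow> Vector_Spaces.linear (*s) (*) \<phi>"

definition reflection :: "complex^'n^'n \<Rightarrow> bool" where
  "reflection r \<longleftrightarrow> r \<in> carrier GL \<and> r \<noteq> \<one>\<^bsub>GL\<^esub>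
     \<and> (\<exists>k::nat. k > 0 \<and> r [^]\<^bsub>GL\<^esub> k = \<one>\<^bsub>GL\<^esub>)
     \<and> (\<exists>H. hyperplane H \<and> (\<forall>v\<in>H. r *v v = v))"

definition reflection_group :: "(complex^'n^'n) set \<Rightarrow> bool" where
  "reflection_group W \<longleftrightarrow> subgroup W GL \<and> generate GL {r \<in> W. reflection r} = W"

definition irreducible_group :: "(complex^'n^'n) set \<Rightarrow> bool" where
  "irreducible_group W \<longleftrightarrow>
     (\<forall>U. vec.subspace U \<and> (\<forall>w\<in>W. \<forall>u\<in>U. w *v u \<in> U) \<longrightarrow> U = {0} \<or> U = UNIV)"

definition well_generated :: "(complex^'n^'n) set \<Rightarrow> bool" where
  "well_generated W \<longleftrightarrow>
     (\<exists>R. R \<subseteq> W \<and> (\<forall>r\<in>R. reflection r) \<and> card R = CARD('n) \<and> generate GL R = W)"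

definition reflecting_hyperplanes :: "(complex^'n^'n) set \<Rightarrow> (complex^'n) set set" where
  "reflecting_hyperplanes W =
     {H. hyperplane H \<and> (\<exists>r\<in>W. reflection r \<and> (\<forall>v\<in>H. r *v v = v))}"

definition stabiliser_order :: "(complex^'n^'n) set \<Rightarrow> (complex^'n) set \<Rightarrow> nat" where
  "stabiliser_order W H = card {w \<in> W. \<forall>v\<in>H. w *v v = v}"

section \<open>Polynomial functions, invariants and the discriminant\<close>

text \<open>
  Since \<open>\<complex>\<close> is infinite, coordinate rings are represented by rings of polynomial functions.
  The following is the \<open>\<complex>\<close>-algebra \<open>\<complex>[G]\<close> generated by a set \<open>G\<close> of functions.
\<close>

inductive_set algebra_generated :: "('a \<Rightarrow> complex) set \<Rightarrow> ('a \<Rightarrow> complex) set"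
  for G :: "('a \<Rightarrow> complex) set" where
  generator: "g \<in> G \<Longrightarrow> g \<in> algebra_generated G"
| const: "(\<lambda>_. c) \<in> algebra_generated G"
| add: "p \<in> algebra_generated G \<Longrightarrow> q \<in> algebra_generated G \<Longrightarrow> (\<lambda>x. p x + q x) \<in> algebra_generated G"
| mult: "p \<in> algebra_generated G \<Longrightarrow> q \<in> algebra_generated G \<Longrightarrow> (\<lambda>x. p x * q x) \<in> algebra_generated G"

definition polynomial_functions :: "(complex^'n \<Rightarrow> complex) set" where
  "polynomial_functions = algebra_generated (range (\<lambda>i v. v $ i))"

text \<open>
  For polynomial functions over the infinite field \<open>\<complex>\<close>, the scaling law says that only monomials
  of degree \<open>d\<close> occur.
\<close>

definition homogeneous :: "nat \<Rightarrow> (complex^'n \<Rightarrow> complex) \<Rightarrow> bool" where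
  "homogeneous d p \<longleftrightarrow> p \<in> polynomial_functions \<and> (\<forall>c v. p (c *s v) = c ^ d * p v)"

definition invariants :: "(complex^'n^'n) set \<Rightarrow> (complex^'n \<Rightarrow> complex) set" where
  "invariants W = {p \<in> polynomial_functions. \<forall>w\<in>W. \<forall>v. p (w *v v) = p v}"

text \<open>\<open>\<alpha> H\<close> is the chosen linear form with kernel \<open>H\<close>.\<close>

definition discriminant ::
  "(complex^'n^'n) set \<Rightarrow> ((complex^'n) set \<Rightarrow> complex^'n \<Rightarrow> complex) \<Rightarrow> complex^'n \<Rightarrow> complex" where
  "discriminant W \<alpha> v = (\<Prod>H\<in>reflecting_hyperplanes W. \<alpha> H v ^ stabiliser_order W H)"

section \<open>The base \<open>Y\<close> and the polynomial \<open>\<Delta>(y, T)\<close>\<close>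

text \<open>
  \<open>Y = \<complex>\<^sup>n\<^sup>-\<^sup>1\<close> with coordinates indexed by \<open>1, \<dots>, n - 1\<close>, as a subspace of
  \<^typ>\<open>nat \<Rightarrow> complex\<close> with the product topology; outside the index set the elements of \<open>Y\<close>
  take the fixed value \<^term>\<open>undefined\<close>.
\<close>

definition Y_space :: "nat \<Rightarrow> (nat \<Rightarrow> complex) set" where
  "Y_space n = {1..<n} \<rightarrow>\<^sub>E UNIV"

definition Y_polynomials :: "nat \<Rightarrow> ((nat \<Rightarrow> complex) \<Rightarrow> complex) set" where
  "Y_polynomials n = algebra_generated ((\<lambda>i y. y i) ` {1..<n})"

definition disc_poly ::
  "nat \<Rightarrow> (nat \<Rightarrow> (nat \<Rightarrow> complex) \<Rightarrow> complex) \<Rightarrow> (nat \<Rightarrow> complex) \<Rightarrow> complex poly" where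
  "disc_poly n a y = monom 1 n + (\<Sum>i=2..n. monom (a i y) (n - i))"

section \<open>Centered configurations\<close>

text \<open>
  The \<open>\<SS>\<^sub>n\<close>-orbit of \<open>(x\<^sub>1, \<dots>, x\<^sub>n)\<close> is identified with the multiset of the \<open>x\<^sub>i\<close>.
  The rank \<open>n\<close> is the cardinality of the index type \<^typ>\<open>'n\<close>.
\<close>

typedef 'n config = "{M :: complex multiset. size M = CARD('n) \<and> \<Sum>\<^sub># M = 0}"
  morphisms points Config
proof
  show "replicate_mset (CARD('n)) 0 \<in> {M :: complex multiset. size M = CARD('n) \<and> \<Sum>\<^sub># M = 0}"
    by (auto intro!: sum_mset.neutral)
qed

definition centered :: "(complex^'n) set" where
  "centered = {x. (\<Sum>i\<in>UNIV. x $ i) = 0}"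

definition config_of :: "complex^'n \<Rightarrow> 'n config" where
  "config_of x = Config (image_mset (\<lambda>i. x $ i) (mset_set UNIV))"

text \<open>The topology is the quotient topology under \<^const>\<open>config_of\<close>.\<close>

instantiation config :: (finite) topological_space
begin

definition open_config :: "'a config set \<Rightarrow> bool" where
  "open_config U \<longleftrightarrow> openin (top_of_set centered) {x \<in> centered. config_of x \<in> U}"

instance
proof
  show "open (UNIV :: 'a config set)"
    by (simp add: open_config_def)
next
  fix S T :: "'a config set"
  assume "open S" "open T"
  then have "openin (top_of_set centered)
      ({x \<in> centered. config_of x \<in> S} \<inter> {x \<in> centered. config_of x \<in> T})"
    unfolding open_config_def by (rule openin_Int)
  moreover have "{x \<in> centered. config_of x \<in> S} \<inter> {x \<in> centered. config_of x \<in> T} =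
      {x \<in> centered. config_of x \<in> S \<inter> T}"
    by auto
  ultimately show "open (S \<inter> T)"
    by (simp add: open_config_def)
next
  fix K :: "'a config set set"
  assume "\<forall>S\<in>K. open S"
  then have "openin (top_of_set centered) (\<Union>S\<in>K. {x \<in> centered. config_of x \<in> S})"
    unfolding open_config_def by blast
  moreover have "(\<Union>S\<in>K. {x \<in> centered. config_of x \<in> S}) =
      {x \<in> centered. config_of x \<in> \<Union>K}"
    by auto
  ultimately show "open (\<Union>K)"
    by (simp add: open_config_def)
qed

end

lemma points_config_of:
  assumes "x \<in> centered"
  shows "points (config_of x) = image_mset (\<lambda>i. x $ i) (mset_set UNIV)"
  unfolding config_of_def
  by (rule Config_inverse) (use assms in \<open>auto simp: centered_def sum_unfold_sum_mset\<close>)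

lemma config_of_surj: "config_of ` centered = (UNIV :: 'n::finite config set)"
proof (rule subset_antisym[OF subset_UNIV subsetI])
  fix C :: "'n config"
  obtain xs where xs: "mset xs = points C"
    using ex_mset by blast
  have len: "length xs = CARD('n)"
    using points[of C] xs by (metis (mono_tags, lifting) mem_Collect_eq size_mset)
  obtain g where g: "bij_betw g (UNIV :: 'n set) {0..<CARD('n)}"
    using ex_bij_betw_finite_nat[OF finite] by blast
  define x :: "complex^'n" where "x = (\<chi> i. xs ! g i)"
  have "image_mset (\<lambda>i. x $ i) (mset_set UNIV) = image_mset ((!) xs) (image_mset g (mset_set UNIV))"
    by (simp add: x_def multiset.map_comp comp_def)
  also have "image_mset g (mset_set UNIV) = mset_set {0..<CARD('n)}"
    using g by (simp add: image_mset_mset_set bij_betw_def)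
  also have "image_mset ((!) xs) (mset_set {0..<CARD('n)}) = mset (map ((!) xs) [0..<length xs])"
    by (simp add: len mset_map)
  finally have M: "image_mset (\<lambda>i. x $ i) (mset_set UNIV) = points C"
    by (simp add: map_nth xs)
  moreover have "\<Sum>\<^sub># (points C) = 0"
    using points[of C] by simp
  ultimately have "x \<in> centered"
    by (simp add: centered_def sum_unfold_sum_mset)
  moreover have "config_of x = C"
    unfolding config_of_def M by (rule points_inverse)
  ultimately show "C \<in> config_of ` centered"
    by blast
qed

lemma quotient_map_config_of:
  "quotient_map (top_of_set centered) (euclidean :: 'n::finite config topology) config_of"
  by (simp add: quotient_map_def config_of_surj open_config_def)

definition multiplicities :: "'n config \<Rightarrow> nat multiset" where
  "multiplicities C = image_mset (count (points C)) (mset_set (set_mset (points C)))"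

definition is_partition :: "nat multiset \<Rightarrow> nat \<Rightarrow> bool" where
  "is_partition l n \<longleftrightarrow> 0 \<notin># l \<and> \<Sum>\<^sub># l = n"

definition E_stratum :: "nat multiset \<Rightarrow> 'n config set" where
  "E_stratum l = {C. multiplicities C = l}"

section \<open>The Lyashko--Looijenga morphism\<close>

text \<open>
  \<open>Config\<close> is only meaningful on centered multisets of size \<open>n\<close>; the lemma \<open>points_LL\<close> below
  shows that it is applied to such a multiset for every \<open>a\<close> and \<open>y\<close>.
\<close>

definition LL :: "(nat \<Rightarrow> (nat \<Rightarrow> complex) \<Rightarrow> complex) \<Rightarrow> (nat \<Rightarrow> complex) \<Rightarrow> 'n config" where
  "LL a y = Config (proots (disc_poly CARD('n) a y))"

definition Y_stratum ::
  "(nat \<Rightarrow> (nat \<Rightarrow> complex) \<Rightarrow> complex) \<Rightarrow> 'n itself \<Rightarrow> nat multiset \<Rightarrow> (nat \<Rightarrow> complex) set" where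
  "Y_stratum a _ l = {y \<in> Y_space CARD('n). (LL a y :: 'n config) \<in> E_stratum l}"

lemma coeff_prod_linear_factors:
  fixes A :: "complex multiset"
  shows "degree (\<Prod>x\<in>#A. [:-x, 1:]) = size A"
    and "coeff (\<Prod>x\<in>#A. [:-x, 1:]) (size A) = 1"
    and "A \<noteq> {#} \<Longrightarrow> coeff (\<Prod>x\<in>#A. [:-x, 1:]) (size A - 1) = - \<Sum>\<^sub># A"
proof -
  have deg: "degree (\<Prod>x\<in>#A. [:-x, 1:]) = size A \<and> coeff (\<Prod>x\<in>#A. [:-x, 1:]) (size A) = 1"
    for A :: "complex multiset"
  proof (induction A)
    case (add x A)
    then have "(\<Prod>x\<in>#A. [:-x, 1:]) \<noteq> 0"
      by auto
    with add show ?case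
      by (auto simp: degree_mult_eq coeff_eq_0 simp del: mult_pCons_left)
        (auto simp: coeff_eq_0)
  qed auto
  show "degree (\<Prod>x\<in>#A. [:-x, 1:]) = size A" "coeff (\<Prod>x\<in>#A. [:-x, 1:]) (size A) = 1"
    using deg by auto
  show "coeff (\<Prod>x\<in>#A. [:-x, 1:]) (size A - 1) = - \<Sum>\<^sub># A" if "A \<noteq> {#}"
    using that
  proof (induction A)
    case (add x A)
    show ?case
    proof (cases "A = {#}")
      case False
      then obtain k where k: "size A = Suc k"
        by (metis gr0_implies_Suc nonempty_has_size)
      show ?thesis
        using add.IH[OF False] deg[of A] k by simp
    qed auto
  qed auto
qed

lemma points_LL:
  "points (LL a y :: 'n::finite config) = proots (disc_poly CARD('n) a y)"
proof -
  define n where "n = CARD('n)"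
  define p where "p = disc_poly n a y"
  have n: "n > 0"
    by (simp add: n_def)
  have lt: "coeff (\<Sum>i=2..n. monom (a i y) (n - i)) k = 0" if "k \<ge> n - 1" for k
    using that n by (auto simp: coeff_sum intro!: sum.neutral)
  have c: "coeff p n = 1" "coeff p (n - 1) = 0" "\<And>k. k > n \<Longrightarrow> coeff p k = 0"
    using lt n by (auto simp: p_def disc_poly_def)
  then have deg: "degree p = n"
    by (intro antisym degree_le le_degree) auto
  have size: "size (proots p) = n"
    by (simp add: size_proots_complex deg)
  have "p = (\<Prod>x\<in>#proots p. [:-x, 1:])"
    using complex_poly_decompose_multiset[of p] c deg by simp
  then have "coeff p (size (proots p) - 1) = - \<Sum>\<^sub># (proots p)"
    using coeff_prod_linear_factors(3)[of "proots p"] size n by fastforce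
  then have "\<Sum>\<^sub># (proots p) = 0"
    using c size by simp
  then show ?thesis
    unfolding LL_def using size by (subst Config_inverse) (auto simp: p_def n_def)
qed

end

theory Submission
  imports Defs "HOL-Complex_Analysis.Complex_Analysis" "HOL-Combinatorics.Permutations"
begin

text \<open>
  The quotient map \<open>V \<rightarrow> W\V\<close> is a covering off the discriminant, because there the Jacobian of
  \<open>f\<^sub>1, \<dots>, f\<^sub>n\<close> does not vanish. If two points \<open>y1, y2\<close> of \<open>Y\<close> close to each other have the same
  configuration and no root has split, then the sheets over the two lines \<open>{y1} \<times> \<complex>\<close> and \<open>{y2} \<times> \<complex>\<close>
  can be matched \<open>W\<close>-equivariantly off the common roots. The invariants of the difference of matched
  points are single-valued and bounded near the roots, and since all \<open>d\<^sub>i \<ge> 2\<close> for \<open>i < n\<close> they vanish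
  at infinity; by Liouville they are zero and \<open>y1 = y2\<close>. So LL is injective near each point of a
  stratum, as a map on that stratum.

  At the origin this gives \<open>LL\<^sup>-\<^sup>1(0) = {0}\<close> and, by quasi-homogeneity, properness. By invariance
  of domain LL is open at points with \<open>n\<close> distinct roots, which are dense by invariance of dimension,
  and then open everywhere and surjective, since the configurations of distinct points near a given
  one are connected. A stratum of \<open>Y\<close> is the full preimage of its image, so LL restricts to an open
  and closed, locally injective map with finite fibres, that is, to a covering.
\<close>

text \<open>As a map on \<open>Y\<close>, LL can be ramified where roots coincide, so a Jacobian of
  LL gives no local injectivity on the smaller strata. This is why two whole lines over
  \<open>Y\<close> are compared instead. The difference of two matched points is itself multivalued
  in \<open>t\<close>: continuation around a root moves both points by the same element of
  \<open>W\<close>. Applying an invariant removes exactly this ambiguity. The decay at infinity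
  comes from quasi-homogeneity. With \<open>s\<close> a root of \<open>t\<close> of order the degree
  of the last invariant, rescaling by \<open>1/s\<close> brings the line over \<open>y\<close> at
  \<open>t\<close> within O(|s|^-2) of the point (0,...,0,1). There a local section of the quotient
  map is Lipschitz, and scaling back costs one factor |s|, so matched points differ by O(1/|s|). The
  exponent 2 is the lower bound on the other degrees: an invariant linear form would have a
  \<open>W\<close>-stable kernel, against irreducibility. That (0,...,0,1) is regular follows from
  the discriminant being monic in the last invariant.\<close>

no_notation fps_nth (infixl \<open>$\<close> 75)

section \<open>Covering spaces\<close>

lemma finite_separated:
  fixes A :: "'a::metric_space set"
  assumes "finite A"
  obtains e where "e > 0" "\<And>x y. x \<in> A \<Longrightarrow> y \<in> A \<Longrightarrow> x \<noteq> y \<Longrightarrow> e \<le> dist x y"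
proof -
  \<comment> \<open>The extra element 1 keeps the minimum defined when \<open>A\<close> has at most
    one point.\<close>
  define D where "D = insert 1 ((\<lambda>(x, y). dist x y) ` {(x, y). x \<in> A \<and> y \<in> A \<and> x \<noteq> y})"
  have "{(x, y). x \<in> A \<and> y \<in> A \<and> x \<noteq> y} \<subseteq> A \<times> A" by auto
  then have fin: "finite D"
    unfolding D_def using assms by (meson finite_SigmaI finite_imageI finite_insert finite_subset)
  have "D \<noteq> {}" "\<And>r. r \<in> D \<Longrightarrow> r > 0" by (auto simp: D_def)
  with fin have "Min D > 0"
    by simp
  moreover have "Min D \<le> dist x y" if "x \<in> A" "y \<in> A" "x \<noteq> y" for x y
    using that by (intro Min_le[OF fin]) (auto simp: D_def)
  ultimately show thesis using that by blast
qed

text \<open>Closedness of \<open>p\<close> stands in for properness: after disjoint neighbourhoods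
  of the points of a fibre are chosen, the image of the rest of \<open>X\<close> is closed and
  misses \<open>s\<close>, so it can be cut out of the base.\<close>

lemma covering_space_closed_open_map:
  fixes p :: "'a::metric_space \<Rightarrow> 'b::topological_space"
  assumes cont: "continuous_on X p" and surj: "p ` X = S"
    and op: "\<And>U. openin (top_of_set X) U \<Longrightarrow> openin (top_of_set S) (p ` U)"
    and cl: "\<And>K. closedin (top_of_set X) K \<Longrightarrow> closedin (top_of_set S) (p ` K)"
    and fin: "\<And>s. s \<in> S \<Longrightarrow> finite (X \<inter> p -` {s})"
    and inj: "\<And>x. x \<in> X \<Longrightarrow> \<exists>U. openin (top_of_set X) U \<and> x \<in> U \<and> inj_on p U"
  shows "covering_space X p S"
proof
  fix s assume s: "s \<in> S"
  define A where "A = X \<inter> p -` {s}"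
  have finA: "finite A" using fin[OF s] by (simp add: A_def)
  obtain e where e: "e > 0" "\<And>x y. x \<in> A \<Longrightarrow> y \<in> A \<Longrightarrow> x \<noteq> y \<Longrightarrow> e \<le> dist x y"
    using finite_separated[OF finA] by blast
  have "\<forall>x\<in>A. \<exists>U. openin (top_of_set X) U \<and> x \<in> U \<and> inj_on p U"
    using inj by (auto simp: A_def)
  then obtain U where U: "\<And>x. x \<in> A \<Longrightarrow> openin (top_of_set X) (U x) \<and> x \<in> U x \<and> inj_on p (U x)"
    by metis
  define B where "B = (\<lambda>x. U x \<inter> ball x (e / 2))"
  have B: "openin (top_of_set X) (B x)" "x \<in> B x" "inj_on p (B x)" "B x \<subseteq> X" if "x \<in> A" for x
  proof -
    show "openin (top_of_set X) (B x)"
      unfolding B_def using U[OF that] by (metis openin_Int_open open_ball)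
    then show "B x \<subseteq> X" using openin_imp_subset by blast
  qed (use U[OF that] e in \<open>auto simp: B_def inj_on_def\<close>)
  have Bdisj: "x = y" if "x \<in> A" "y \<in> A" "z \<in> B x" "z \<in> B y" for x y z
  proof (rule ccontr)
    assume "x \<noteq> y"
    then have "e \<le> dist x y" using e that by blast
    moreover have "dist x z < e / 2" "dist y z < e / 2" using that by (auto simp: B_def)
    ultimately show False using dist_triangle2[of x y z] by linarith
  qed
  define R where "R = X - (\<Union>x\<in>A. B x)"
  have "closedin (top_of_set X) R"
    unfolding R_def using B by (intro closedin_diff closedin_topspace[of "top_of_set X", simplified] openin_Union) auto
  then have clR: "closedin (top_of_set S) (p ` R)" by (rule cl)
  define T where "T = S \<inter> (\<Inter>x\<in>A. p ` B x) - p ` R"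
  have "openin (top_of_set S) (S \<inter> (\<Inter>x\<in>A'. p ` B x))" if "finite A'" "A' \<subseteq> A" for A'
    using that
  proof induction
    case (insert x A')
    then have "openin (top_of_set S) (p ` B x \<inter> (S \<inter> (\<Inter>x\<in>A'. p ` B x)))"
      using op B(1) by blast
    moreover have "p ` B x \<inter> (S \<inter> (\<Inter>x\<in>A'. p ` B x)) = S \<inter> (\<Inter>x\<in>insert x A'. p ` B x)"
      by auto
    ultimately show ?case by simp
  qed auto
  then have "openin (top_of_set S) (S \<inter> (\<Inter>x\<in>A. p ` B x))" using finA by blast
  then have opT: "openin (top_of_set S) T" unfolding T_def using clR by (intro openin_diff) auto
  have sT: "s \<in> T" using s B(2) by (fastforce simp: T_def R_def A_def)
  define u where "u = (\<lambda>x. B x \<inter> p -` T)"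
  have pu: "p ` u x = T" if x: "x \<in> A" for x
  proof
    show "T \<subseteq> p ` u x"
    proof
      fix t assume t: "t \<in> T"
      then obtain z where "z \<in> B x" "p z = t" using x by (auto simp: T_def)
      with t show "t \<in> p ` u x"
        by (auto simp: u_def)
    qed
  qed (auto simp: u_def)
  have opu: "openin (top_of_set X) (u x)" if "x \<in> A" for x
  proof -
    have "openin (top_of_set X) (X \<inter> p -` T)"
      using cont opT surj continuous_openin_preimage by blast
    then have "openin (top_of_set X) (B x \<inter> (X \<inter> p -` T))" using B(1)[OF that] by blast
    moreover have "B x \<inter> (X \<inter> p -` T) = u x" using B(4)[OF that] by (auto simp: u_def)
    ultimately show ?thesis by simp
  qed
  have homeo: "\<exists>q. homeomorphism (u x) T p q" if x: "x \<in> A" for x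
  proof -
    have ux: "u x \<subseteq> X" using B(4)[OF x] by (auto simp: u_def)
    have "inj_on p (u x)" using B(3)[OF x] by (auto simp: u_def intro: inj_on_subset)
    moreover have "openin (top_of_set T) (p ` V)" if "openin (top_of_set (u x)) V" for V
    proof -
      have "openin (top_of_set X) V" using that opu[OF x] openin_trans by blast
      then have "openin (top_of_set S) (p ` V)" by (rule op)
      moreover have "p ` V \<subseteq> T" using that pu[OF x] openin_imp_subset by blast
      ultimately show ?thesis using opT openin_imp_subset openin_subset_trans by metis
    qed
    ultimately obtain q where "homeomorphism (u x) T p q"
      using homeomorphism_injective_open_map[of "u x" p T] continuous_on_subset[OF cont ux] pu[OF x]
      by blast
    then show ?thesis by blast
  qed
  have "\<Union>(u ` A) = X \<inter> p -` T"
  proof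
    show "\<Union>(u ` A) \<subseteq> X \<inter> p -` T" using B(4) by (auto simp: u_def)
    show "X \<inter> p -` T \<subseteq> \<Union>(u ` A)"
    proof
      fix y assume y: "y \<in> X \<inter> p -` T"
      then have "p y \<notin> p ` R" by (auto simp: T_def)
      with y have "y \<notin> R"
        by blast
      with y show "y \<in> \<Union>(u ` A)"
        by (auto simp: R_def u_def)
    qed
  qed
  moreover have "pairwise disjnt (u ` A)" by (auto simp: pairwise_def disjnt_def u_def dest: Bdisj)
  ultimately show "\<exists>T. s \<in> T \<and> openin (top_of_set S) T \<and>
      (\<exists>v. \<Union>v = X \<inter> p -` T \<and> (\<forall>u\<in>v. openin (top_of_set X) u) \<and> pairwise disjnt v \<and>
        (\<forall>u\<in>v. \<exists>q. homeomorphism u T p q))"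
    using sT opT opu homeo by (intro exI[of _ T] conjI exI[of _ "u ` A"]) auto
qed (use cont surj in auto)

lemma covering_space_compose_homeomorphism:
  assumes "covering_space X p S" and hom: "homeomorphism X' X h k"
    and q: "\<And>x. x \<in> X' \<Longrightarrow> q x = p (h x)"
  shows "covering_space X' q S"
proof
  have h: "continuous_on X' h" "h ` X' = X" "\<And>x. x \<in> X' \<Longrightarrow> k (h x) = x" "\<And>x. x \<in> X \<Longrightarrow> h (k x) = x"
    "continuous_on X k" "k ` X = X'"
    using hom by (auto simp: homeomorphism_def)
  have "continuous_on X' (\<lambda>x. p (h x))"
    using h covering_space_imp_continuous[OF assms(1)] by (intro continuous_on_compose2[of X p X' h]) auto
  then show "continuous_on X' q" using q by (simp cong: continuous_on_cong)
  have "q ` X' = p ` h ` X'" using q by (simp add: image_image)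
  then show "q ` X' = S" using covering_space_imp_surjective[OF assms(1)] h(2) by simp
  fix s assume "s \<in> S"
  then obtain T v where T: "s \<in> T" "openin (top_of_set S) T" "\<Union>v = X \<inter> p -` T"
    "\<And>u. u \<in> v \<Longrightarrow> openin (top_of_set X) u" "pairwise disjnt v"
    "\<And>u. u \<in> v \<Longrightarrow> \<exists>g. homeomorphism u T p g"
    using assms(1) unfolding covering_space_def by meson
  have sub: "u \<subseteq> X" if "u \<in> v" for u using that T(4) openin_imp_subset by blast
  have "\<Union>((`) k ` v) = k ` \<Union>v" by blast
  also have "\<dots> = X' \<inter> q -` T" unfolding T(3)
  proof
    show "k ` (X \<inter> p -` T) \<subseteq> X' \<inter> q -` T" using h q by auto
    show "X' \<inter> q -` T \<subseteq> k ` (X \<inter> p -` T)"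
    proof
      fix x assume "x \<in> X' \<inter> q -` T"
      then have "k (h x) = x" "h x \<in> X \<inter> p -` T" using h q by auto
      then show "x \<in> k ` (X \<inter> p -` T)" by (metis imageI)
    qed
  qed
  finally have "\<Union>((`) k ` v) = X' \<inter> q -` T" .
  moreover have "openin (top_of_set X') (k ` u)" if "u \<in> v" for u
    using homeomorphism_imp_open_map[OF homeomorphism_symD[OF hom] T(4)[OF that]] .
  moreover have "pairwise disjnt ((`) k ` v)"
  proof (rule pairwiseI, clarsimp)
    fix u u' assume u: "u \<in> v" "u' \<in> v" "k ` u \<noteq> k ` u'"
    then have "disjnt u u'" using T(5) by (auto simp: pairwise_def)
    then show "disjnt (k ` u) (k ` u')"
      using sub[OF u(1)] sub[OF u(2)] h(4) unfolding disjnt_def disjoint_iff by (metis imageE subsetD)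
  qed
  moreover have "\<exists>g. homeomorphism (k ` u) T q g" if u: "u \<in> v" for u
  proof -
    obtain g where "homeomorphism u T p g" using T(6)[OF u] by blast
    moreover have "homeomorphism (k ` u) u h k"
      using homeomorphism_symD[OF homeomorphism_of_subsets[OF homeomorphism_symD[OF hom] sub[OF u]]] by blast
    ultimately have "homeomorphism (k ` u) T (p \<circ> h) (k \<circ> g)"
      using homeomorphism_compose by blast
    moreover have "k ` u \<subseteq> X'" using sub[OF u] h(6) by blast
    ultimately have "homeomorphism (k ` u) T q (k \<circ> g)" using q by (elim homeomorphism_cong) auto
    then show ?thesis by blast
  qed
  ultimately show "\<exists>T. s \<in> T \<and> openin (top_of_set S) T \<and>
      (\<exists>v. \<Union>v = X' \<inter> q -` T \<and> (\<forall>u\<in>v. openin (top_of_set X') u) \<and> pairwise disjnt v \<and>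
        (\<forall>u\<in>v. \<exists>g. homeomorphism u T q g))"
    using T(1,2) by (intro exI[of _ T] conjI exI[of _ "(`) k ` v"]) auto
qed

text \<open>Shrinking evenly covered sets to path connected ones makes the slices path connected, so
  a path component contains a slice or misses it. Its image is then open with open complement, and
  connectedness of \<open>S\<close> makes it everything.\<close>

lemma covering_space_path_component:
  fixes p :: "'a::topological_space \<Rightarrow> 'b::topological_space"
  assumes cov: "covering_space X p S" and conn: "connected S"
    and loc: "\<And>s T. openin (top_of_set S) T \<Longrightarrow> s \<in> T \<Longrightarrow>
        \<exists>U. openin (top_of_set S) U \<and> s \<in> U \<and> U \<subseteq> T \<and> path_connected U"
    and "y \<in> X"
  shows "covering_space (path_component_set X y) p S"
proof -
  define C where "C = path_component_set X y"
  have CX: "C \<subseteq> X" by (simp add: C_def path_component_subset)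
  have pX: "p ` X = S" and contp: "continuous_on X p" using cov by (auto simp: covering_space_def)
  define slices where "slices = (\<lambda>U v. openin (top_of_set S) U \<and> \<Union>v = X \<inter> p -` U \<and> pairwise disjnt v \<and>
      (\<forall>u\<in>v. openin (top_of_set X) u \<and> path_connected u \<and> (\<exists>q. homeomorphism u U p q)))"
  have ex_slices: "\<exists>U v. s \<in> U \<and> slices U v" if s: "s \<in> S" for s
  proof -
    obtain T v where T: "s \<in> T" "openin (top_of_set S) T" "\<Union>v = X \<inter> p -` T"
      "\<And>u. u \<in> v \<Longrightarrow> openin (top_of_set X) u" "pairwise disjnt v"
      "\<And>u. u \<in> v \<Longrightarrow> \<exists>q. homeomorphism u T p q"
      using cov s unfolding covering_space_def by meson
    obtain U where U: "openin (top_of_set S) U" "s \<in> U" "U \<subseteq> T" "path_connected U"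
      using loc[OF T(2,1)] by blast
    define v' where "v' = (\<lambda>u. u \<inter> p -` U) ` v"
    have "\<Union>v' = X \<inter> p -` U" using T(3) U(3) by (auto simp: v'_def)
    moreover have "pairwise disjnt v'" using T(5) by (auto simp: v'_def pairwise_def disjnt_def)
    moreover have "openin (top_of_set X) (u \<inter> p -` U) \<and> path_connected (u \<inter> p -` U)
        \<and> (\<exists>q. homeomorphism (u \<inter> p -` U) U p q)" if u: "u \<in> v" for u
    proof (intro conjI)
      have "openin (top_of_set X) (u \<inter> (X \<inter> p -` U))"
        using T(4)[OF u] contp U(1) pX continuous_openin_preimage by blast
      moreover have "u \<inter> (X \<inter> p -` U) = u \<inter> p -` U"
        using T(4)[OF u] openin_imp_subset by blast
      ultimately show "openin (top_of_set X) (u \<inter> p -` U)" by simp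
      obtain q where q: "homeomorphism u T p q" using T(6)[OF u] by blast
      have "p ` (u \<inter> p -` U) = U" using q U(3) unfolding homeomorphism_def by blast
      then have hom: "homeomorphism (u \<inter> p -` U) U p q"
        using homeomorphism_of_subsets[OF q, of "u \<inter> p -` U" U] U(3) by blast
      then show "\<exists>q. homeomorphism (u \<inter> p -` U) U p q" by blast
      have "path_connected (q ` U)"
        using U(4) hom by (intro path_connected_continuous_image) (auto simp: homeomorphism_def)
      then show "path_connected (u \<inter> p -` U)" using hom by (simp add: homeomorphism_def)
    qed
    ultimately show ?thesis
      unfolding slices_def using U(1,2) by (intro exI[of _ U] exI[of _ v']) (auto simp: v'_def)
  qed
  have absorb: "u \<subseteq> C" if "path_connected u" "u \<subseteq> X" "u \<inter> C \<noteq> {}" for u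
  proof
    fix z assume z: "z \<in> u"
    obtain z' where z': "z' \<in> u" "z' \<in> C" using \<open>u \<inter> C \<noteq> {}\<close> by blast
    then have "path_component X z' z"
      using that z path_component_of_subset path_connected_component by metis
    then show "z \<in> C" using z' unfolding C_def by (auto intro: path_component_trans)
  qed
  have lift: "s' \<in> p ` C" if v: "slices U v" and "x \<in> C" "p x \<in> U" "s' \<in> U" for v U x s'
  proof -
    have "x \<in> \<Union>v" using that CX by (auto simp: slices_def)
    then obtain u where u: "u \<in> v" "x \<in> u" by blast
    then have "u \<subseteq> C"
      using absorb[of u] v \<open>x \<in> C\<close> unfolding slices_def by blast
    moreover have "p ` u = U" using v u unfolding slices_def homeomorphism_def by blast
    ultimately show ?thesis using \<open>s' \<in> U\<close> by blast
  qed
  have "y \<in> C" using \<open>y \<in> X\<close> by (simp add: C_def path_component_refl)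
  have "p ` C = S"
  proof (rule ccontr)
    assume "p ` C \<noteq> S"
    then have ne: "S - p ` C \<noteq> {}" using CX pX by blast
    have "openin (top_of_set S) (p ` C)"
    proof (subst openin_subopen, clarify)
      fix x assume x: "x \<in> C"
      then have "p x \<in> S" using CX pX by blast
      from ex_slices[OF this] obtain U v where U: "p x \<in> U" "slices U v"
        by blast
      then have "U \<subseteq> p ` C" using lift x by blast
      moreover have "openin (top_of_set S) U" using U by (simp add: slices_def)
      ultimately show "\<exists>T. openin (top_of_set S) T \<and> p x \<in> T \<and> T \<subseteq> p ` C"
        using U(1) by (intro exI[of _ U]) simp
    qed
    moreover have "openin (top_of_set S) (S - p ` C)"
    proof (subst openin_subopen, clarify)
      fix s assume s: "s \<in> S" "s \<notin> p ` C"
      from ex_slices[OF s(1)] obtain U v where U: "s \<in> U" "slices U v"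
        by blast
      have "U \<inter> p ` C = {}" using lift[OF U(2) _ _ U(1)] s by blast
      moreover have "openin (top_of_set S) U" using U by (simp add: slices_def)
      moreover from this have "U \<subseteq> S"
        by (rule openin_imp_subset)
      ultimately show "\<exists>T. openin (top_of_set S) T \<and> s \<in> T \<and> T \<subseteq> S - p ` C"
        using U(1) by (intro exI[of _ U]) auto
    qed
    moreover have "p ` C \<noteq> {}" using \<open>y \<in> C\<close> by blast
    ultimately show False using conn ne unfolding connected_openin by blast
  qed
  moreover have "\<exists>T. s \<in> T \<and> openin (top_of_set S) T \<and>
      (\<exists>v. \<Union>v = C \<inter> p -` T \<and> (\<forall>u\<in>v. openin (top_of_set C) u) \<and> pairwise disjnt v \<and>
        (\<forall>u\<in>v. \<exists>q. homeomorphism u T p q))" if s: "s \<in> S" for s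
  proof -
    from ex_slices[OF s] obtain U v where "s \<in> U" "slices U v"
      by blast
    then have U: "s \<in> U" "openin (top_of_set S) U" "\<Union>v = X \<inter> p -` U" "pairwise disjnt v"
      "\<forall>u\<in>v. openin (top_of_set X) u \<and> path_connected u \<and> (\<exists>q. homeomorphism u U p q)"
      by (simp_all add: slices_def)
    define v' where "v' = {u \<in> v. u \<subseteq> C}"
    have "\<Union>v' = C \<inter> p -` U"
    proof
      show "\<Union>v' \<subseteq> C \<inter> p -` U" using U(3) by (auto simp: v'_def)
      show "C \<inter> p -` U \<subseteq> \<Union>v'"
      proof
        fix z assume z: "z \<in> C \<inter> p -` U"
        then have "z \<in> \<Union>v" using CX U(3) by blast
        then obtain u where "u \<in> v" "z \<in> u" by blast
        moreover from this z have "u \<subseteq> C"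
          using absorb[of u] U by blast
        ultimately show "z \<in> \<Union>v'" by (auto simp: v'_def)
      qed
    qed
    moreover have "openin (top_of_set C) u" if "u \<in> v'" for u
      using that U(5) CX by (auto simp: v'_def intro: openin_subset_trans)
    moreover have "pairwise disjnt v'" using U(4) by (auto simp: v'_def pairwise_def)
    ultimately show ?thesis using U by (intro exI[of _ U] conjI exI[of _ v']) (auto simp: v'_def)
  qed
  ultimately show ?thesis
    unfolding C_def[symmetric] by (intro covering_spaceI continuous_on_subset[OF contp CX])
qed

section \<open>Polynomial functions\<close>

lemma algebra_generated_sum:
  "(\<And>i. i \<in> I \<Longrightarrow> p i \<in> algebra_generated G) \<Longrightarrow> (\<lambda>x. \<Sum>i\<in>I. p i x) \<in> algebra_generated G"
  by (induction I rule: infinite_finite_induct) (auto intro: algebra_generated.intros)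

lemma algebra_generated_prod:
  "(\<And>i. i \<in> I \<Longrightarrow> p i \<in> algebra_generated G) \<Longrightarrow> (\<lambda>x. \<Prod>i\<in>I. p i x) \<in> algebra_generated G"
  by (induction I rule: infinite_finite_induct) (auto intro: algebra_generated.intros)

lemma algebra_generated_power:
  "p \<in> algebra_generated G \<Longrightarrow> (\<lambda>x. p x ^ k) \<in> algebra_generated G"
  by (induction k) (auto intro: algebra_generated.intros)

lemma algebra_generated_diff:
  assumes "p \<in> algebra_generated G" "q \<in> algebra_generated G"
  shows "(\<lambda>x. p x - q x) \<in> algebra_generated G"
  using algebra_generated.add[OF assms(1) algebra_generated.mult[OF algebra_generated.const[of "-1"] assms(2)]]
  by simp

lemmas algebra_generated_closure = algebra_generated.const algebra_generated.add algebra_generated.mult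
  algebra_generated_sum algebra_generated_prod algebra_generated_power algebra_generated_diff

lemma coordinate_in_polynomial_functions: "(\<lambda>v. v $ i) \<in> polynomial_functions"
  unfolding polynomial_functions_def by (rule algebra_generated.generator) auto

lemma polynomial_functions_compose:
  assumes "p \<in> polynomial_functions" "\<And>i. (\<lambda>x. g x $ i) \<in> algebra_generated G"
  shows "(\<lambda>x. p (g x)) \<in> algebra_generated G"
  using assms(1) unfolding polynomial_functions_def
  by induction (auto intro: algebra_generated.intros assms(2))

lemma polynomial_functions_matrix:
  assumes "p \<in> polynomial_functions"
  shows "(\<lambda>v. p (A *v v)) \<in> polynomial_functions"
proof -
  have "(\<lambda>v. (A *v v) $ i) \<in> polynomial_functions" for i
    using coordinate_in_polynomial_functions unfolding polynomial_functions_def matrix_vector_mult_def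
    by simp (rule algebra_generated_sum, rule algebra_generated.mult, rule algebra_generated.const, blast)
  then show ?thesis using assms polynomial_functions_compose unfolding polynomial_functions_def by blast
qed

lemma holomorphic_on_polynomial_functions:
  assumes "p \<in> polynomial_functions" "\<And>i. (\<lambda>t. g t $ i) holomorphic_on S"
  shows "(\<lambda>t. p (g t)) holomorphic_on S"
  using assms(1) unfolding polynomial_functions_def
  by induction (auto intro!: holomorphic_intros assms(2))

lemma polynomial_functions_on_line:
  assumes "p \<in> polynomial_functions"
  shows "\<exists>q. \<forall>t. p (u + t *s v) = poly q t"
  using assms unfolding polynomial_functions_def
proof induction
  case (generator g)
  then obtain i where "g = (\<lambda>v. v $ i)" by auto
  then show ?case by (intro exI[of _ "[:u $ i, v $ i:]"]) auto
next
  case (const c)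
  show ?case by (intro exI[of _ "[:c:]"]) auto
next
  case (add p q)
  then show ?case by (metis poly_add)
next
  case (mult p q)
  then show ?case by (metis poly_mult)
qed

section \<open>Derivatives of polynomial functions\<close>

definition partial :: "(complex^'n \<Rightarrow> complex) \<Rightarrow> 'n \<Rightarrow> complex^'n \<Rightarrow> complex" where
  "partial p i v = frechet_derivative p (at v) (axis i 1)"

text \<open>The Frechet derivative is a priori only real linear. Complex coefficients
  \<open>D\<close> are built along the generation of the polynomial, and the value of the derivative
  at \<open>axis i 1\<close> then recovers them, so \<open>partial\<close> is the complex partial
  derivative.\<close>

lemma polynomial_functions_derivative:
  fixes p :: "complex^'n \<Rightarrow> complex"
  assumes "p \<in> polynomial_functions"
  shows partial_in_polynomial_functions: "partial p i \<in> polynomial_functions"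
    and has_derivative_polynomial_functions:
      "(p has_derivative (\<lambda>h. \<Sum>i\<in>UNIV. partial p i v * h $ i)) (at v)"
proof -
  have "\<exists>D. (\<forall>i. D i \<in> polynomial_functions) \<and>
      (\<forall>v. (p has_derivative (\<lambda>h. \<Sum>i\<in>UNIV. D i v * h $ i)) (at v))"
    using assms unfolding polynomial_functions_def
  proof induction
    case (generator g)
    then obtain j where g: "g = (\<lambda>v. v $ j)" by auto
    have "(\<lambda>h. \<Sum>i\<in>UNIV. (if i = j then 1 else 0) * h $ i) = (\<lambda>h::complex^'n. h $ j)"
      by (simp add: if_distrib[of "\<lambda>x. x * _"] cong: if_cong)
    then show ?case unfolding g by (intro exI[of _ "\<lambda>i v. if i = j then 1 else 0"])
        (auto intro: algebra_generated.const bounded_linear.has_derivative[OF bounded_linear_vec_nth] has_derivative_ident)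
  next
    case (const c)
    show ?case by (intro exI[of _ "\<lambda>i v. 0"]) (auto intro: algebra_generated.const)
  next
    case (add p q)
    then obtain D E where DE: "\<And>i. D i \<in> algebra_generated (range (\<lambda>i v. v $ i))"
      "\<And>i. E i \<in> algebra_generated (range (\<lambda>i v. v $ i))"
      "\<And>v. (p has_derivative (\<lambda>h. \<Sum>i\<in>UNIV. D i v * h $ i)) (at v)"
      "\<And>v. (q has_derivative (\<lambda>h. \<Sum>i\<in>UNIV. E i v * h $ i)) (at v)"
      by blast
    show ?case
    proof (intro exI[of _ "\<lambda>i v. D i v + E i v"] conjI allI)
      show "((\<lambda>x. p x + q x) has_derivative (\<lambda>h. \<Sum>i\<in>UNIV. (D i v + E i v) * h $ i)) (at v)" for v
        using has_derivative_add[OF DE(3,4)] by (simp add: distrib_right sum.distrib)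
    qed (intro algebra_generated.add DE)
  next
    case (mult p q)
    then obtain D E where DE: "\<And>i. D i \<in> algebra_generated (range (\<lambda>i v. v $ i))"
      "\<And>i. E i \<in> algebra_generated (range (\<lambda>i v. v $ i))"
      "\<And>v. (p has_derivative (\<lambda>h. \<Sum>i\<in>UNIV. D i v * h $ i)) (at v)"
      "\<And>v. (q has_derivative (\<lambda>h. \<Sum>i\<in>UNIV. E i v * h $ i)) (at v)"
      by blast
    show ?case
    proof (intro exI[of _ "\<lambda>i v. p v * E i v + D i v * q v"] conjI allI)
      show "((\<lambda>x. p x * q x) has_derivative (\<lambda>h. \<Sum>i\<in>UNIV. (p v * E i v + D i v * q v) * h $ i)) (at v)" for v
      proof -
        have "(\<lambda>h. p v * (\<Sum>i\<in>UNIV. E i v * h $ i) + (\<Sum>i\<in>UNIV. D i v * h $ i) * q v)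
            = (\<lambda>h. \<Sum>i\<in>UNIV. (p v * E i v + D i v * q v) * h $ i)"
          by (simp add: sum_distrib_left sum_distrib_right algebra_simps flip: sum.distrib)
        then show ?thesis using has_derivative_mult[OF DE(3,4), of v] by simp
      qed
    qed (intro algebra_generated.add algebra_generated.mult DE mult.hyps)
  qed
  then obtain D where D: "\<And>i. D i \<in> polynomial_functions"
    "\<And>v. (p has_derivative (\<lambda>h. \<Sum>i\<in>UNIV. D i v * h $ i)) (at v)"
    by blast
  have "partial p i v = D i v" for i v unfolding partial_def frechet_derivative_at[OF D(2), symmetric]
    by (simp add: axis_def if_distrib[of "\<lambda>x. _ * x"] cong: if_cong)
  then have "partial p = D" by (intro ext)
  then show "partial p i \<in> polynomial_functions"
    "(p has_derivative (\<lambda>h. \<Sum>i\<in>UNIV. partial p i v * h $ i)) (at v)"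
    using D by auto
qed

lemma continuous_on_polynomial_functions:
  "p \<in> polynomial_functions \<Longrightarrow> continuous_on S p"
  by (rule has_derivative_continuous_on[OF has_derivative_at_withinI[OF has_derivative_polynomial_functions]])

lemma bounded_linear_matrix_vector_mult: "bounded_linear (\<lambda>x. A *v (x :: complex^'n))"
  by (intro linear_conv_bounded_linear[THEN iffD1]) (simp add: matrix_vector_mul_linear)

text \<open>One factor per point of \<open>A\<close>, in a coordinate where that point differs from
  \<open>u\<close>. Averaged over a finite group, such functions give invariants that separate
  orbits and detect tangent vectors.\<close>

lemma separating_polynomial_function:
  assumes "finite A" "u \<notin> A"
  shows "\<exists>q \<in> polynomial_functions. q u = 1 \<and> (\<forall>x\<in>A. q x = 0)"
proof -
  have "\<forall>x\<in>A. \<exists>i. x $ i \<noteq> u $ i" using assms(2) by (metis vec_eq_iff)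
  then obtain i where i: "\<And>x. x \<in> A \<Longrightarrow> x $ i x \<noteq> u $ i x" by metis
  define q where "q = (\<lambda>v. \<Prod>x\<in>A. (v $ i x - x $ i x) * inverse (u $ i x - x $ i x))"
  have "q \<in> polynomial_functions"
    unfolding q_def using coordinate_in_polynomial_functions unfolding polynomial_functions_def
    by (intro algebra_generated_closure) auto
  moreover have "(u $ i x - x $ i x) * inverse (u $ i x - x $ i x) = 1" if "x \<in> A" for x
    using i[OF that] by (intro right_inverse) auto
  then have "q u = 1" by (simp add: q_def)
  moreover have "q x = 0" if "x \<in> A" for x
    using that assms(1) by (auto simp: q_def intro!: prod_zero)
  ultimately show ?thesis by blast
qed

lemma has_derivative_vec_componentwise:
  fixes g :: "'a::euclidean_space \<Rightarrow> complex^'n"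
  assumes "\<And>k. ((\<lambda>v. g v $ k) has_derivative (\<lambda>h. D h $ k)) (at u)"
  shows "(g has_derivative D) (at u)"
  unfolding has_derivative_componentwise_within[of g D u UNIV]
proof
  fix i :: "complex^'n" assume "i \<in> Basis"
  then obtain k b where i: "i = axis k b" by (auto simp: Basis_vec_def)
  show "((\<lambda>x. g x \<bullet> i) has_derivative (\<lambda>x. D x \<bullet> i)) (at u)"
    unfolding i inner_axis by (rule has_derivative_inner_left[OF assms])
qed

lemma norm_vector_smult: "norm (c *s v) = norm c * norm v" for v :: "complex^'n"
  by (simp add: norm_vec_def norm_mult L2_set_right_distrib)

lemma closed_image_norm_proper:
  fixes F :: "'a::euclidean_space \<Rightarrow> 'b::real_normed_vector"
  assumes cont: "continuous_on UNIV F" and proper: "\<And>B. \<exists>C. \<forall>v. norm (F v) \<le> B \<longrightarrow> norm v \<le> C"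
    and "closed K"
  shows "closed (F ` K)"
  unfolding closed_sequential_limits
proof (intro allI impI, elim conjE)
  fix y l assume y: "\<forall>n. y n \<in> F ` K" "y \<longlonglongrightarrow> l"
  then have "\<forall>n. \<exists>x. x \<in> K \<and> y n = F x" by blast
  then obtain x where x: "\<And>n. x n \<in> K" "\<And>n. y n = F (x n)" by metis
  obtain B where "\<And>n. norm (y n) \<le> B"
    using convergent_imp_Bseq[OF convergentI[OF y(2)]] by (auto simp: Bseq_def)
  moreover obtain C where "\<And>v. norm (F v) \<le> B \<Longrightarrow> norm v \<le> C"
    using proper[of B] by blast
  ultimately have "\<And>n. x n \<in> K \<inter> cball 0 C" using x by auto
  moreover have "compact (K \<inter> cball 0 C)"
    using \<open>closed K\<close> by (simp add: closed_Int_compact)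
  ultimately obtain a r where a: "a \<in> K \<inter> cball 0 C" "strict_mono r" "(x \<circ> r) \<longlonglongrightarrow> a"
    unfolding compact_def by metis
  have "isCont F a" using cont by (simp add: continuous_on_eq_continuous_at)
  then have "(\<lambda>n. F ((x \<circ> r) n)) \<longlonglongrightarrow> F a"
    using a(3) isCont_tendsto_compose by blast
  moreover have "(\<lambda>n. F ((x \<circ> r) n)) \<longlonglongrightarrow> l"
    using LIMSEQ_subseq_LIMSEQ[OF y(2) a(2)] by (simp add: x(2) comp_def)
  ultimately have "l = F a" using LIMSEQ_unique by blast
  then show "l \<in> F ` K" using a(1) by blast
qed

section \<open>The quotient map by a finite linear group with polynomial invariants\<close>

text \<open>The bijection \<open>idx\<close> links the numbered invariants to the coordinates of
  \<open>complex^'n\<close>, whose index type carries no order.\<close>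

locale invariant_coordinates =
  fixes W :: "(complex^'n^'n) set" and f :: "nat \<Rightarrow> complex^'n \<Rightarrow> complex"
    and d :: "nat \<Rightarrow> nat" and idx :: "'n \<Rightarrow> nat"
  assumes finite_W: "finite W" and subgroup_W: "subgroup W GL"
    and homogeneous_f: "\<And>i. i \<in> {1..CARD('n)} \<Longrightarrow> homogeneous (d i) (f i)"
    and generators: "algebra_generated (f ` {1..CARD('n)}) = invariants W"
    and bij_idx: "bij_betw idx UNIV {1..CARD('n)}"
begin

definition F :: "complex^'n \<Rightarrow> complex^'n" where
  "F v = (\<chi> k. f (idx k) v)"

definition DF :: "complex^'n \<Rightarrow> complex^'n^'n" where
  "DF v = (\<chi> k i. partial (f (idx k)) i v)"

lemma F_nth [simp]: "F v $ k = f (idx k) v"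
  by (simp add: F_def)

lemma idx_range: "idx k \<in> {1..CARD('n)}"
  using bij_idx by (auto simp: bij_betw_def)

lemma range_idx: "idx ` UNIV = {1..CARD('n)}"
  using bij_idx by (auto simp: bij_betw_def)

lemma f_polynomial: "f (idx k) \<in> polynomial_functions"
  and f_scale: "f (idx k) (c *s v) = c ^ d (idx k) * f (idx k) v"
  using homogeneous_f[OF idx_range] by (auto simp: homogeneous_def)

lemma one_in_W: "mat 1 \<in> W"
  using subgroup.one_closed[OF subgroup_W] by simp

lemma mult_in_W: "A \<in> W \<Longrightarrow> B \<in> W \<Longrightarrow> A ** B \<in> W"
  using subgroup.m_closed[OF subgroup_W] by simp

lemma inverse_in_W:
  assumes "A \<in> W"
  obtains B where "B \<in> W" "B ** A = mat 1" "A ** B = mat 1"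
proof
  have A: "A \<in> carrier GL" using assms subgroup.subset[OF subgroup_W] by blast
  show "inv\<^bsub>GL\<^esub> A \<in> W" using assms subgroup.m_inv_closed[OF subgroup_W] by blast
  show "inv\<^bsub>GL\<^esub> A ** A = mat 1" "A ** inv\<^bsub>GL\<^esub> A = mat 1"
    using group.l_inv[OF group_GL A] group.r_inv[OF group_GL A] by simp_all
qed

lemma F_invariant:
  assumes "w \<in> W"
  shows "F (w *v v) = F v"
proof -
  have "f (idx k) \<in> invariants W" for k
    using idx_range generators algebra_generated.generator by (metis imageI)
  then show ?thesis using assms by (simp add: vec_eq_iff invariants_def)
qed

lemma bij_mult_W:
  assumes "g \<in> W"
  shows "bij_betw (\<lambda>w. w ** g) W W"
proof -
  obtain h where h: "h \<in> W" "h ** g = mat 1" "g ** h = mat 1" using inverse_in_W[OF assms] .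
  show ?thesis by (rule bij_betwI[where g = "\<lambda>w. w ** h"])
      (use assms h in \<open>auto intro: mult_in_W simp: matrix_mul_assoc[symmetric]\<close>)
qed

lemma average_invariant:
  assumes "q \<in> polynomial_functions"
  shows "(\<lambda>v. \<Sum>w\<in>W. q (w *v v)) \<in> invariants W"
  unfolding invariants_def
proof (intro CollectI conjI ballI allI)
  show "(\<lambda>v. \<Sum>w\<in>W. q (w *v v)) \<in> polynomial_functions"
    using polynomial_functions_matrix[OF assms] unfolding polynomial_functions_def
    by (intro algebra_generated_sum) auto
next
  fix g v assume "g \<in> W"
  have "(\<Sum>w\<in>W. q (w *v (g *v v))) = (\<Sum>w\<in>W. q ((w ** g) *v v))"
    by (simp add: matrix_vector_mul_assoc)
  also have "\<dots> = (\<Sum>w\<in>W. q (w *v v))"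
    by (rule sum.reindex_bij_betw[OF bij_mult_W[OF \<open>g \<in> W\<close>]])
  finally show "(\<Sum>w\<in>W. q (w *v (g *v v))) = (\<Sum>w\<in>W. q (w *v v))" .
qed

lemma invariant_factors:
  assumes "p \<in> invariants W" "F v = F v'"
  shows "p v = p v'"
proof -
  have "f i v = f i v'" if "i \<in> {1..CARD('n)}" for i
    using that assms(2) range_idx by (metis F_nth imageE)
  note eq = this
  have "p \<in> algebra_generated (f ` {1..CARD('n)})" using assms(1) generators by simp
  then show ?thesis by induction (use eq in auto)
qed

text \<open>Suppose the orbits differ. A polynomial that is 1 at \<open>v'\<close> and 0 at all
  other points of both orbits has an average over \<open>W\<close> that vanishes at \<open>v\<close>
  and counts the stabiliser of \<open>v'\<close> at \<open>v'\<close>.\<close>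

lemma F_eq_imp_same_orbit:
  assumes "F v = F v'"
  shows "\<exists>w\<in>W. v' = w *v v"
proof (rule ccontr)
  assume "\<not> ?thesis"
  then have notin: "v' \<notin> (\<lambda>w. w *v v) ` W \<union> ((\<lambda>w. w *v v') ` W - {v'})"
    by auto
  have "finite ((\<lambda>w. w *v v) ` W \<union> ((\<lambda>w. w *v v') ` W - {v'}))"
    using finite_W by simp
  from separating_polynomial_function[OF this notin]
  obtain q where q: "q \<in> polynomial_functions" "q v' = 1" "\<And>w. w \<in> W \<Longrightarrow> q (w *v v) = 0"
    "\<And>w. w \<in> W \<Longrightarrow> w *v v' \<noteq> v' \<Longrightarrow> q (w *v v') = 0"
    by auto
  have "(\<Sum>w\<in>W. q (w *v v')) = (\<Sum>w\<in>W. q (w *v v))"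
    using invariant_factors[OF average_invariant[OF q(1)] assms] by simp
  also have "\<dots> = 0" using q(3) by simp
  finally have "(\<Sum>w\<in>W. q (w *v v')) = 0" .
  moreover have "(\<Sum>w\<in>W. q (w *v v')) = (\<Sum>w\<in>W. if w *v v' = v' then 1 else 0)"
    using q by (intro sum.cong) auto
  then have "(\<Sum>w\<in>W. q (w *v v')) = of_nat (card {w \<in> W. w *v v' = v'})"
    using finite_W by (simp flip: sum.inter_filter)
  moreover have "card {w \<in> W. w *v v' = v'} \<noteq> 0" using finite_W one_in_W by auto
  ultimately show False by simp
qed

lemma has_derivative_F: "(F has_derivative (\<lambda>h. DF v *v h)) (at v)"
proof -
  have "((\<lambda>v. F v $ k) has_derivative (\<lambda>h. (DF v *v h) $ k)) (at v)" for k
    using has_derivative_polynomial_functions[OF f_polynomial, of k v]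
    by (simp add: DF_def matrix_vector_mult_def)
  then show ?thesis by (rule has_derivative_vec_componentwise)
qed

lemma continuous_on_F: "continuous_on S F"
  by (rule has_derivative_continuous_on[OF has_derivative_at_withinI[OF has_derivative_F]])

text \<open>This is the chain rule, carried out along the generation of \<open>p\<close> from the
  \<open>f i\<close>.\<close>

lemma derivative_kernel_invariants:
  assumes "DF u *v h = 0" "p \<in> invariants W" "(p has_derivative D) (at u)"
  shows "D h = 0"
proof -
  have "\<exists>D. (p has_derivative D) (at u) \<and> D h = 0" if "p \<in> algebra_generated (f ` {1..CARD('n)})"
    using that
  proof induction
    case (generator g)
    then obtain k where "g = f (idx k)" using range_idx by (metis imageE)
    moreover have "(DF u *v h) $ k = 0" using assms(1) by simp
    ultimately show ?case using has_derivative_polynomial_functions[OF f_polynomial, of k u]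
      by (auto simp: DF_def matrix_vector_mult_def)
  next
    case (const c)
    show ?case by (intro exI[of _ "\<lambda>_. 0"]) auto
  next
    case (add p q)
    then show ?case using has_derivative_add[of p _ "at u" q] by fastforce
  next
    case (mult p q)
    then obtain D E where "(p has_derivative D) (at u)" "D h = 0" "(q has_derivative E) (at u)" "E h = 0"
      by blast
    then show ?case using has_derivative_mult[of p D u UNIV q E] by fastforce
  qed
  then obtain D' where "(p has_derivative D') (at u)" "D' h = 0" using assms(2) generators by blast
  then show ?thesis using has_derivative_unique assms(3) by blast
qed

text \<open>A vector in the kernel of \<open>DF u\<close> is killed by the differential of every
  invariant. At a point with trivial stabiliser, averaging yields for each \<open>i\<close> an
  invariant whose differential at \<open>u\<close> is the \<open>i\<close>-th coordinate.\<close>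

lemma det_DF_nonzero_if_free:
  assumes free: "\<And>w. w \<in> W \<Longrightarrow> w *v u = u \<Longrightarrow> w = mat 1"
  shows "det (DF u) \<noteq> 0"
proof -
  have "h = 0" if h: "DF u *v h = 0" for h
  proof -
    have "h $ i = 0" for i
    proof -
      have "u \<notin> (\<lambda>w. w *v u) ` (W - {mat 1})" "finite ((\<lambda>w. w *v u) ` (W - {mat 1}))"
        using free finite_W by auto
      from separating_polynomial_function[OF this(2,1)]
      obtain r where r: "r \<in> polynomial_functions" "r u = 1"
        "\<And>w. w \<in> W \<Longrightarrow> w \<noteq> mat 1 \<Longrightarrow> r (w *v u) = 0"
        by auto
      \<comment> \<open>The square makes \<open>q\<close> vanish to second order at the other points
        of the orbit. At \<open>u\<close> the linear factor removes the derivative of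
        \<open>r\<close>, so only the coordinate \<open>h $ i\<close> survives.\<close>
      define q where "q = (\<lambda>v. (v $ i - u $ i) * (r v * r v))"
      have q: "q \<in> polynomial_functions"
        unfolding q_def using coordinate_in_polynomial_functions r(1) unfolding polynomial_functions_def
        by (intro algebra_generated_closure) auto
      define R where "R = (\<lambda>v h. \<Sum>i\<in>UNIV. partial r i v * h $ i)"
      have R: "(r has_derivative R v) (at v)" for v
        unfolding R_def by (rule has_derivative_polynomial_functions[OF r(1)])
      have dcoord: "((\<lambda>v. v $ i - u $ i) has_derivative (\<lambda>h. h $ i)) (at v)" for v
        by (auto intro!: derivative_eq_intros bounded_linear.has_derivative[OF bounded_linear_vec_nth])
      have dq: "(q has_derivative (\<lambda>h. (v $ i - u $ i) * (r v * R v h + R v h * r v) + h $ i * (r v * r v))) (at v)" for v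
        unfolding q_def by (rule has_derivative_mult[OF dcoord has_derivative_mult[OF R R]])
      have lin: "((\<lambda>v. w *v v) has_derivative (\<lambda>h. w *v h)) (at v)" for w :: "complex^'n^'n" and v
        by (intro bounded_linear_imp_has_derivative bounded_linear_matrix_vector_mult)
      have "((\<lambda>v. q (w *v v)) has_derivative (\<lambda>h. if w = mat 1 then h $ i else 0)) (at u)" if "w \<in> W" for w
      proof (cases "w = mat 1")
        case True
        then show ?thesis using dq[of u] r(2) by simp
      next
        case False
        then show ?thesis using has_derivative_compose[OF lin dq, of w u] r(3)[OF that False] by simp
      qed
      then have "((\<lambda>v. \<Sum>w\<in>W. q (w *v v)) has_derivative (\<lambda>h. \<Sum>w\<in>W. if w = mat 1 then h $ i else 0)) (at u)"
        by (rule has_derivative_sum)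
      then have "(\<Sum>w\<in>W. if w = mat 1 then h $ i else 0) = 0"
        by (rule derivative_kernel_invariants[OF h average_invariant[OF q]])
      then show ?thesis using finite_W one_in_W by simp
    qed
    then show ?thesis by (simp add: vec_eq_iff)
  qed
  then show ?thesis
    using matrix_left_invertible_ker[of "DF u"] invertible_det_nz invertible_left_inverse by blast
qed

text \<open>Differentiating \<open>F (w *v x) = F x\<close> at the fixed point gives
  \<open>DF v ** w = DF v\<close>, and \<open>DF v\<close> cancels.\<close>

lemma stabiliser_trivial:
  assumes "det (DF v) \<noteq> 0" "w \<in> W" "w *v v = v"
  shows "w = mat 1"
proof -
  have lin: "((\<lambda>v. w *v v) has_derivative (\<lambda>h. w *v h)) (at v)"
    by (intro bounded_linear_imp_has_derivative bounded_linear_matrix_vector_mult)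
  have "((\<lambda>x. F (w *v x)) has_derivative (\<lambda>h. DF v *v (w *v h))) (at v)"
    using has_derivative_compose[OF lin has_derivative_F] assms(3) by simp
  then have "(F has_derivative (\<lambda>h. DF v *v (w *v h))) (at v)"
    using F_invariant[OF assms(2)] by simp
  then have eq: "(\<lambda>h. DF v *v (w *v h)) = (\<lambda>h. DF v *v h)"
    using has_derivative_F has_derivative_unique by blast
  obtain B where B: "B ** DF v = mat 1" using assms(1) invertible_det_nz invertible_left_inverse by blast
  have "w *v h = h" for h
    using fun_cong[OF eq, of h] B by (metis matrix_vector_mul_assoc matrix_vector_mul_lid)
  then show ?thesis by (simp add: matrix_eq)
qed

text \<open>Points escaping to infinity with bounded invariants, normalised to the unit sphere,
  accumulate at a unit vector with the same invariants as 0. It would lie in the orbit of 0.\<close>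

lemma F_proper: "\<exists>C. \<forall>v. norm (F v) \<le> B \<longrightarrow> norm v \<le> C"
proof (rule ccontr)
  assume "\<not> ?thesis"
  then have "\<forall>k::nat. \<exists>v. norm (F v) \<le> B \<and> norm v > real (Suc k)"
    by (simp add: not_le)
  then obtain v where v: "\<And>k. norm (F (v k)) \<le> B" "\<And>k. norm (v k) > real (Suc k)" by metis
  define t where "t = (\<lambda>k. complex_of_real (inverse (norm (v k))))"
  define u where "u = (\<lambda>k. t k *s v k)"
  have pos: "norm (v k) > 0" for k using v(2)[of k] by linarith
  have "u k \<in> sphere 0 1" for k
    using pos[of k] by (auto simp: u_def t_def norm_vector_smult norm_inverse)
  then obtain a r where a: "a \<in> sphere 0 1" "strict_mono r" "(u \<circ> r) \<longlonglongrightarrow> a"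
    using compact_sphere[of "0::complex^'n" 1] unfolding compact_def by metis
  have "f (idx k) a = f (idx k) 0" for k
  \<comment> \<open>Positivity of the degrees is derived later from surjectivity of
    \<open>F\<close>, which rests on this lemma. Here degree 0 simply means that the invariant is
    constant.\<close>
  proof (cases "d (idx k) = 0")
    case True
    then show ?thesis using f_scale[of k 0 a] by simp
  next
    case False
    have "(\<lambda>j. inverse (real (Suc j))) \<longlonglongrightarrow> 0"
      by (rule LIMSEQ_inverse_real_of_nat)
    then have lim0: "(\<lambda>j. inverse (real (Suc j)) * B) \<longlonglongrightarrow> 0"
      by (rule tendsto_mult_left_zero)
    have "norm (f (idx k) (u j)) \<le> inverse (real (Suc j)) * B" for j
    proof -
      have "norm (f (idx k) (v j)) \<le> B"
        using order_trans[OF Finite_Cartesian_Product.norm_nth_le[of "F (v j)" k] v(1)] by simp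
      moreover have "norm (t j) \<le> inverse (real (Suc j))"
        using v(2)[of j] by (auto simp: t_def norm_inverse intro!: le_imp_inverse_le)
      moreover have "inverse (real (Suc j)) \<le> 1" by (simp add: field_simps)
      moreover have "norm (t j) ^ d (idx k) \<le> norm (t j) ^ 1" if "norm (t j) \<le> 1"
        using False that by (intro power_decreasing) auto
      ultimately have "norm (t j) ^ d (idx k) \<le> inverse (real (Suc j))" by simp
      then show ?thesis
        using \<open>norm (f (idx k) (v j)) \<le> B\<close> unfolding u_def f_scale norm_mult norm_power
        by (intro mult_mono) auto
    qed
    then have "(\<lambda>j. f (idx k) (u j)) \<longlonglongrightarrow> 0"
      by (intro Lim_null_comparison[OF _ lim0]) auto
    then have "(\<lambda>j. f (idx k) ((u \<circ> r) j)) \<longlonglongrightarrow> 0"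
      using LIMSEQ_subseq_LIMSEQ[OF _ a(2)] by (fastforce simp: comp_def)
    moreover have "isCont (f (idx k)) a"
      using continuous_on_polynomial_functions[OF f_polynomial, of UNIV k]
      by (simp add: continuous_on_eq_continuous_at)
    then have "(\<lambda>j. f (idx k) ((u \<circ> r) j)) \<longlonglongrightarrow> f (idx k) a"
      using a(3) by (rule isCont_tendsto_compose)
    ultimately have "f (idx k) a = 0" using LIMSEQ_unique by metis
    moreover have "f (idx k) 0 = 0" using f_scale[of k 0 0] False by (simp add: power_0_left)
    ultimately show ?thesis by simp
  qed
  then have "F 0 = F a" by (simp add: vec_eq_iff)
  from F_eq_imp_same_orbit[OF this] have "a = 0"
    by auto
  then show False using a(1) by simp
qed

lemma closed_image_F: "closed K \<Longrightarrow> closed (F ` K)"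
  using closed_image_norm_proper[OF continuous_on_F F_proper] .

end

section \<open>Complements of hypersurfaces and of subspaces\<close>

lemma polynomial_zeros_on_line_finite:
  assumes "p \<in> polynomial_functions" "p (u + t0 *s v) \<noteq> 0"
  shows "finite {t. p (u + t *s v) = 0}"
proof -
  obtain q where q: "\<And>t. p (u + t *s v) = poly q t"
    using polynomial_functions_on_line[OF assms(1)] by blast
  then have "q \<noteq> 0" using assms(2) by auto
  then show ?thesis unfolding q by (rule poly_roots_finite)
qed

lemma continuous_on_vec_componentwise:
  assumes "\<And>i. continuous_on S (\<lambda>x. g x $ i)"
  shows "continuous_on S g"
  using continuous_on_vec_lambda[of S "\<lambda>i x. g x $ i"] assms by simp

lemma continuous_on_line: "continuous_on S (\<lambda>t::complex. u + t *s (v::complex^'n))"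
  by (rule continuous_on_vec_componentwise) (auto intro!: continuous_intros)

text \<open>The complex line through two of the points stays in \<open>L\<close>. Its parameters in
  \<open>S\<close> form an open convex subset of the plane, which remains connected after the
  finitely many zeros of \<open>p\<close> are removed.\<close>

lemma connected_hypersurface_complement:
  assumes p: "p \<in> polynomial_functions" and "open S" "convex S" and L: "vec.subspace L"
  shows "connected {z \<in> S \<inter> L. p z \<noteq> 0}"
  unfolding connected_iff_connected_component
proof (intro ballI)
  fix x y assume x: "x \<in> {z \<in> S \<inter> L. p z \<noteq> 0}" and y: "y \<in> {z \<in> S \<inter> L. p z \<noteq> 0}"
  define l where "l = (\<lambda>t::complex. x + t *s (y - x))"
  define D where "D = l -` S"
  have l: "l 0 = x" "l 1 = y" by (simp_all add: l_def)
  have contl: "continuous_on A l" for A unfolding l_def by (rule continuous_on_line)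
  have "open D" unfolding D_def using \<open>open S\<close> contl by (rule open_vimage)
  have "convex D" unfolding convex_alt
  proof (intro ballI allI impI)
    fix s t and r :: real assume st: "s \<in> D" "t \<in> D" "0 \<le> r \<and> r \<le> 1"
    have "l ((1 - r) *\<^sub>R s + r *\<^sub>R t) = (1 - r) *\<^sub>R l s + r *\<^sub>R l t"
      by (simp add: l_def vec_eq_iff scaleR_conv_of_real[where 'a = complex] algebra_simps)
    also have "\<dots> \<in> S" using st \<open>convex S\<close> unfolding D_def convex_alt by auto
    finally show "(1 - r) *\<^sub>R s + r *\<^sub>R t \<in> D" by (simp add: D_def)
  qed
  define Z where "Z = {t. p (l t) = 0}"
  have "finite Z"
    unfolding Z_def l_def using x by (intro polynomial_zeros_on_line_finite[OF p, of _ 0]) auto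
  then have "connected (D - Z)" using \<open>open D\<close> convex_connected[OF \<open>convex D\<close>]
    by (intro connected_open_diff_countable) (auto simp: countable_finite)
  then have "connected (l ` (D - Z))" using contl by (rule connected_continuous_image[rotated])
  moreover have "l t \<in> L" for t
    unfolding l_def using x y L by (intro vec.subspace_add vec.subspace_scale vec.subspace_diff) auto
  then have "l ` (D - Z) \<subseteq> {z \<in> S \<inter> L. p z \<noteq> 0}" by (auto simp: D_def Z_def)
  moreover have "x \<in> l ` (D - Z)" "y \<in> l ` (D - Z)"
    using x y l by (auto simp: D_def Z_def image_iff intro: exI[of _ 0] exI[of _ 1])
  ultimately show "connected_component {z \<in> S \<inter> L. p z \<noteq> 0} x y"
    unfolding connected_component_def by blast
qed

lemma real_subspace_of_complex_subspace:
  fixes U :: "(complex^'n) set"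
  assumes "vec.subspace U"
  shows "subspace U"
proof -
  have "r *\<^sub>R x \<in> U" if "x \<in> U" for r x
  proof -
    have "r *\<^sub>R x = complex_of_real r *s x"
      by (simp add: vec_eq_iff scaleR_conv_of_real[where 'a = complex])
    then show ?thesis using assms that by (simp add: vec.subspace_scale)
  qed
  then show ?thesis using assms vec.subspace_0 vec.subspace_add unfolding subspace_def by blast
qed

lemma negligible_real_subspace:
  fixes U :: "'a::euclidean_space set"
  assumes "subspace U" "U \<noteq> UNIV"
  shows "negligible U"
proof (rule negligible_lowdim)
  have "dim U \<noteq> DIM('a)" using assms dim_eq_full span_eq_iff by metis
  then show "dim U < DIM('a)" using dim_subset_UNIV[of U] by linarith
qed

lemma negligible_complex_subspace:
  fixes U :: "(complex^'n) set"
  assumes "vec.subspace U" "U \<noteq> UNIV"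
  shows "negligible U"
  using negligible_real_subspace real_subspace_of_complex_subspace assms by blast

lemma open_not_covered_by_negligible:
  fixes A :: "'a::euclidean_space set"
  assumes "open A" "A \<noteq> {}" "finite \<U>" "\<And>U. U \<in> \<U> \<Longrightarrow> negligible U"
  obtains x where "x \<in> A" "x \<notin> \<Union>\<U>"
proof -
  have "negligible (\<Union>\<U>)" using assms(3,4) by (rule negligible_Union)
  then have "\<not> A \<subseteq> \<Union>\<U>"
    using open_not_negligible[OF assms(1,2)] negligible_subset by blast
  then show thesis using that by blast
qed

section \<open>Fixed spaces and zeros of the Jacobian\<close>

context invariant_coordinates
begin

definition fixed_space :: "complex^'n^'n \<Rightarrow> (complex^'n) set" where
  "fixed_space w = {v. w *v v = v}"

lemma subspace_fixed_space: "vec.subspace (fixed_space w)"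
  unfolding fixed_space_def vec.subspace_def
  by (auto simp: matrix_vector_right_distrib vector_scalar_commute)

lemma fixed_space_proper:
  assumes "w \<noteq> mat 1"
  shows "fixed_space w \<noteq> UNIV"
proof
  assume "fixed_space w = UNIV"
  then have "w *v x = mat 1 *v x" for x by (auto simp: fixed_space_def)
  then show False using assms matrix_eq by blast
qed

lemma det_DF_polynomial: "(\<lambda>v. det (DF v)) \<in> polynomial_functions"
  using partial_in_polynomial_functions[OF f_polynomial] unfolding det_def DF_def polynomial_functions_def
  by (simp add: algebra_generated_sum algebra_generated.mult algebra_generated.const algebra_generated_prod)

lemma stabiliser_neighbourhood:
  obtains N where "open N" "v \<in> N" "\<And>w x. w \<in> W \<Longrightarrow> x \<in> N \<Longrightarrow> w *v x \<in> N \<Longrightarrow> w *v v = v"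
proof -
  have "finite ((\<lambda>w. w *v v) ` W)" using finite_W by simp
  then obtain e where e: "e > 0" "\<And>w. w \<in> W \<Longrightarrow> w *v v \<noteq> v \<Longrightarrow> e \<le> dist (w *v v) v"
    using finite_separated one_in_W by (metis (no_types, lifting) image_eqI matrix_vector_mul_lid)
  define N where "N = ball v (e / 2) \<inter> (\<Inter>w\<in>W. (\<lambda>x. w *v x) -` ball (w *v v) (e / 2))"
  have "open N" unfolding N_def using finite_W
    by (intro open_Int open_INT open_vimage ballI linear_continuous_on bounded_linear_matrix_vector_mult) auto
  moreover have "v \<in> N" using e(1) by (auto simp: N_def)
  moreover have "w *v v = v" if "w \<in> W" "x \<in> N" "w *v x \<in> N" for w x
  proof (rule ccontr)
    assume "w *v v \<noteq> v"
    then have "e \<le> dist (w *v v) v" using e(2) that(1) by blast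
    moreover have "dist (w *v v) (w *v x) < e / 2" "dist v (w *v x) < e / 2"
      using that by (auto simp: N_def)
    ultimately show False using dist_triangle2[of "w *v v" v "w *v x"] by linarith
  qed
  ultimately show thesis using that by blast
qed

text \<open>
  The Jacobian vanishes in codimension one, so a zero whose stabiliser contains no reflection
  persists, by Hurwitz' theorem, on nearby parallel lines. A general such line misses the fixed
  spaces, and on their complement the Jacobian has no zeros.
\<close>

lemma det_DF_nonzero:
  assumes codim: "\<And>w. w \<in> W \<Longrightarrow> w \<noteq> mat 1 \<Longrightarrow> w *v v = v \<Longrightarrow> vec.dim (fixed_space w) + 2 \<le> CARD('n)"
  shows "det (DF v) \<noteq> 0"
proof
  assume "det (DF v) = 0"
  define J where "J = (\<lambda>v. det (DF v))"
  have J: "J \<in> polynomial_functions" "J v = 0"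
    using det_DF_polynomial \<open>det (DF v) = 0\<close> by (simp_all add: J_def)
  obtain p where "p \<notin> \<Union>(fixed_space ` (W - {mat 1}))"
    by (rule open_not_covered_by_negligible[of UNIV "fixed_space ` (W - {mat 1})"])
      (use finite_W fixed_space_proper subspace_fixed_space in \<open>auto intro!: negligible_complex_subspace\<close>)
  then have Jp: "J p \<noteq> 0"
    unfolding J_def by (intro det_DF_nonzero_if_free) (auto simp: fixed_space_def)
  \<comment> \<open>Along this direction the Jacobian is not identically zero, because the line
    through \<open>v\<close> reaches \<open>p\<close> at parameter 1.\<close>
  define u where "u = p - v"
  \<comment> \<open>If \<open>w\<close> fixes \<open>v\<close> and \<open>v + s b + t u\<close> with
    \<open>s\<close> nonzero, then \<open>b\<close> lies in the span of \<open>u\<close> and the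
    fixed space of \<open>w\<close>. By \<open>codim\<close> these spans are proper, so a small
    \<open>b\<close> outside all of them exists.\<close>
  define X where "X = (\<lambda>w. vec.span (insert u (fixed_space w))) ` {w \<in> W. w \<noteq> mat 1 \<and> w *v v = v}"
  have "negligible Z" if "Z \<in> X" for Z
  proof -
    obtain w where w: "w \<in> W" "w \<noteq> mat 1" "w *v v = v" "Z = vec.span (insert u (fixed_space w))"
      using \<open>Z \<in> X\<close> by (auto simp: X_def)
    have "vec.dim Z \<le> vec.dim (fixed_space w) + 1"
      unfolding w(4) vec.dim_span by (simp add: vec.dim_insert)
    then have "Z \<noteq> UNIV"
      using codim[OF w(1-3)] vec_dim_card[where 'a = complex and 'n = 'n] by auto
    then show ?thesis unfolding w(4) by (intro negligible_complex_subspace) auto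
  qed
  note negl = this
  obtain N where N: "open N" "v \<in> N" "\<And>w x. w \<in> W \<Longrightarrow> x \<in> N \<Longrightarrow> w *v x \<in> N \<Longrightarrow> w *v v = v"
    by (rule stabiliser_neighbourhood[of v]) (rule that)
  then obtain r where r: "r > 0" "ball v r \<subseteq> N" using openE by blast
  have "finite X" using finite_W by (simp add: X_def)
  then obtain b where b: "b \<in> ball 0 (r / 2)" "b \<notin> \<Union>X"
    using open_not_covered_by_negligible[of "ball 0 (r / 2)" X] negl r(1) by (metis open_ball ball_eq_empty not_le half_gt_zero)
  \<comment> \<open>The parameter \<open>s\<close> shifts the line through \<open>v\<close> parallel
    to itself in the direction \<open>b\<close>; \<open>s = 0\<close> is the original line.\<close>
  define h where "h = (\<lambda>s t. J (v + complex_of_real s *s b + t *s u))"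
  \<comment> \<open>Together with \<open>norm b < r / 2\<close> this keeps
    \<open>v + s b + t u\<close> inside \<open>ball v r\<close> for \<open>s\<close> at most 1,
    where only stabilisers of \<open>v\<close> can fix a point.\<close>
  define \<rho> where "\<rho> = r / (2 * (norm u + 1))"
  have \<rho>: "\<rho> > 0" "\<rho> * norm u < r / 2"
    using r(1) by (auto simp: \<rho>_def field_simps add_pos_nonneg)
  have nz: "h s t \<noteq> 0" if s: "0 < s" "s \<le> 1" and t: "t \<in> ball 0 \<rho>" for s t
  proof -
    define x where "x = v + complex_of_real s *s b + t *s u"
    have "norm (complex_of_real s *s b) < r / 2"
    proof -
      have "norm (complex_of_real s *s b) \<le> 1 * norm b"
        unfolding norm_vector_smult using s by (intro mult_right_mono) auto
      then show ?thesis using b(1) by simp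
    qed
    moreover have "norm (t *s u) < r / 2"
    proof -
      have "norm (t *s u) \<le> \<rho> * norm u"
        unfolding norm_vector_smult using t by (intro mult_right_mono) auto
      then show ?thesis using \<rho>(2) by linarith
    qed
    ultimately have "norm (complex_of_real s *s b + t *s u) < r"
      using norm_triangle_ineq[of "complex_of_real s *s b" "t *s u"] by linarith
    moreover have "v - x = - (complex_of_real s *s b + t *s u)" by (simp add: x_def)
    ultimately have x: "x \<in> ball v r" unfolding mem_ball dist_norm by (simp only: norm_minus_cancel)
    have "w = mat 1" if "w \<in> W" "w *v x = x" for w
    proof (rule ccontr)
      assume "w \<noteq> mat 1"
      have wv: "w *v v = v" using N(3)[OF that(1), of x] that(2) x r(2) by auto
      define S where "S = vec.span (insert u (fixed_space w))"
      have S: "vec.subspace S" "u \<in> S" "fixed_space w \<subseteq> S"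
        using vec.span_superset[of "insert u (fixed_space w)"] by (auto simp: S_def)
      have "x \<in> S" "v \<in> S" using that(2) wv S(3) by (auto simp: fixed_space_def)
      then have "x - v - t *s u \<in> S" using S by (intro vec.subspace_diff vec.subspace_scale) auto
      then have "inverse (complex_of_real s) *s (x - v - t *s u) \<in> S"
        using S by (intro vec.subspace_scale)
      moreover have "inverse (complex_of_real s) *s (x - v - t *s u) = b"
        using s by (simp add: x_def vector_smult_assoc)
      ultimately have "b \<in> S" by simp
      moreover have "S \<in> X"
        using that(1) wv \<open>w \<noteq> mat 1\<close> by (auto simp: X_def S_def)
      ultimately show False using b(2) by blast
    qed
    then have "J x \<noteq> 0" unfolding J_def by (intro det_DF_nonzero_if_free)
    then show ?thesis by (simp add: h_def x_def)
  qed
  have holh: "h s holomorphic_on A" for s A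
    unfolding h_def by (rule holomorphic_on_polynomial_functions[OF J(1)]) (auto intro!: holomorphic_intros)
  have "h 0 0 \<noteq> 0"
  proof (rule Hurwitz_no_zeros[of "ball 0 \<rho>" "\<lambda>k. h (inverse (real (Suc k)))" "h 0"])
    show "uniform_limit K (\<lambda>k. h (inverse (real (Suc k)))) (h 0) sequentially"
      if K: "compact K" "K \<subseteq> ball 0 \<rho>" for K
    proof (rule uniform_limitI)
      fix \<epsilon> :: real assume "\<epsilon> > 0"
      have "continuous_on ({0..1} \<times> K) (\<lambda>(s, t). v + complex_of_real s *s b + t *s u)"
        unfolding case_prod_beta
        by (rule continuous_on_vec_componentwise) (auto intro!: continuous_intros)
      then have "continuous_on ({0..1} \<times> K) (\<lambda>(s, t). h s t)"
        unfolding h_def case_prod_beta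
        by (rule continuous_on_compose2[OF continuous_on_polynomial_functions[OF J(1), of UNIV]]) auto
      then have "uniformly_continuous_on ({0..1} \<times> K) (\<lambda>(s, t). h s t)"
        using K(1) by (intro compact_uniformly_continuous compact_Times) auto
      then obtain \<delta> where \<delta>: "\<delta> > 0"
        "\<And>z z'. z \<in> {0..1} \<times> K \<Longrightarrow> z' \<in> {0..1} \<times> K \<Longrightarrow> dist z' z < \<delta> \<Longrightarrow>
          dist (case z' of (s, t) \<Rightarrow> h s t) (case z of (s, t) \<Rightarrow> h s t) < \<epsilon>"
        using \<open>\<epsilon> > 0\<close> unfolding uniformly_continuous_on_def by metis
      have "\<forall>\<^sub>F k in sequentially. inverse (real (Suc k)) < \<delta>"
        using LIMSEQ_inverse_real_of_nat \<delta>(1) by (rule order_tendstoD)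
      then show "\<forall>\<^sub>F k in sequentially. \<forall>t\<in>K. dist (h (inverse (real (Suc k))) t) (h 0 t) < \<epsilon>"
      proof (rule eventually_mono, intro ballI)
        fix k t assume k: "inverse (real (Suc k)) < \<delta>" "t \<in> K"
        have "inverse (real (Suc k)) \<le> 1" by (simp add: field_simps)
        then show "dist (h (inverse (real (Suc k))) t) (h 0 t) < \<epsilon>"
          using \<delta>(2)[of "(0, t)" "(inverse (real (Suc k)), t)"] k by (simp add: dist_Pair_Pair)
      qed
    qed
    show "\<not> h 0 constant_on ball 0 \<rho>"
    proof
      assume "h 0 constant_on ball 0 \<rho>"
      then have "h 0 t = 0" if "t \<in> ball 0 \<rho>" for t
        using J(2) \<rho>(1) that unfolding constant_on_def h_def
        by (metis add.right_neutral centre_in_ball of_real_0 vector_smult_lzero)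
      then have "ball 0 \<rho> \<subseteq> {t. J (v + t *s u) = 0}" by (auto simp: h_def)
      moreover have "finite {t. J (v + t *s u) = 0}"
        using Jp by (intro polynomial_zeros_on_line_finite[OF J(1), of _ 1]) (simp add: u_def)
      ultimately have "finite (ball (0::complex) \<rho>)" using finite_subset by blast
      then show False using \<rho>(1) finite_imp_not_open[of "ball (0::complex) \<rho>"] by auto
    qed
    show "h (inverse (real (Suc k))) t \<noteq> 0" if "t \<in> ball 0 \<rho>" for k t
      using that by (intro nz) (auto simp: field_simps)
  qed (use \<rho> holh in auto)
  then show False using J(2) by (simp add: h_def)
qed

end

section \<open>The monic polynomial over a point of the base, and complex roots of numbers\<close>

lemma disc_poly_monic:
  assumes "n > 0"
  shows degree_disc_poly: "degree (disc_poly n a y) = n"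
    and lead_coeff_disc_poly: "coeff (disc_poly n a y) n = 1"
proof -
  have "coeff (\<Sum>i=2..n. monom (a i y) (n - i)) k = 0" if "k \<ge> n - 1" for k
    using that assms by (auto simp: coeff_sum intro!: sum.neutral)
  then have c: "coeff (disc_poly n a y) n = 1" "\<And>k. k > n \<Longrightarrow> coeff (disc_poly n a y) k = 0"
    using assms by (auto simp: disc_poly_def)
  then show "degree (disc_poly n a y) = n" "coeff (disc_poly n a y) n = 1"
    by (auto intro!: antisym[OF degree_le le_degree])
qed

lemma poly_disc_poly: "poly (disc_poly n a y) T = T ^ n + (\<Sum>i=2..n. a i y * T ^ (n - i))"
  by (simp add: disc_poly_def poly_monom poly_sum)

lemma norm_axis: "norm (axis k t :: complex^'n) = norm t"
  by (simp add: norm_vec_def L2_set_def axis_def if_distrib[of "\<lambda>x. norm x ^ 2"] cong: if_cong)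

lemma exists_complex_root:
  fixes z :: complex
  assumes "k > 0"
  obtains w where "w ^ k = z"
proof (cases "z = 0")
  case True
  then show thesis using that[of 0] assms by (simp add: power_0_left)
next
  case False
  have "exp (Ln z / of_nat k) ^ k = exp (Ln z)" using assms by (simp flip: exp_of_nat_mult)
  then show thesis using that False by simp
qed

section \<open>The discriminant of a reflection group\<close>

locale lyashko_looijenga = invariant_coordinates W f d idx
  for W :: "(complex^'n^'n) set" and f d and idx :: "'n \<Rightarrow> nat" +
  fixes \<alpha> :: "(complex^'n) set \<Rightarrow> complex^'n \<Rightarrow> complex"
    and a :: "nat \<Rightarrow> (nat \<Rightarrow> complex) \<Rightarrow> complex" and c :: complex
  assumes irreducible: "irreducible_group W" and nontrivial: "W \<noteq> {mat 1}"
    and linear_forms: "\<And>H. H \<in> reflecting_hyperplanes W \<Longrightarrow> linear_form (\<alpha> H) \<and> {v. \<alpha> H v = 0} = H"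
    and a_polynomial: "\<And>i. i \<in> {2..CARD('n)} \<Longrightarrow> a i \<in> Y_polynomials CARD('n)"
    and c_nonzero: "c \<noteq> 0"
    and discriminant_eq: "\<And>v. c * discriminant W \<alpha> v =
      poly (disc_poly CARD('n) a (restrict (\<lambda>i. f i v) {1..<CARD('n)})) (f CARD('n) v)"
begin

definition top_idx :: 'n where
  "top_idx = inv_into UNIV idx CARD('n)"

definition base :: "complex^'n \<Rightarrow> nat \<Rightarrow> complex" where
  "base z = restrict (\<lambda>i. z $ inv_into UNIV idx i) {1..<CARD('n)}"

text \<open>The discriminant, multiplied by \<open>c\<close>, as a function on the quotient: see
  \<open>P_F\<close>.\<close>

definition P :: "complex^'n \<Rightarrow> complex" where
  "P z = poly (disc_poly CARD('n) a (base z)) (z $ top_idx)"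

definition V_reg :: "(complex^'n) set" where
  "V_reg = {v. P (F v) \<noteq> 0}"

definition Q_reg :: "(complex^'n) set" where
  "Q_reg = {z. P z \<noteq> 0}"

lemma idx_inv: "i \<in> {1..CARD('n)} \<Longrightarrow> idx (inv_into UNIV idx i) = i"
  using bij_idx by (simp add: bij_betw_inv_into_right)

lemma inv_idx: "inv_into UNIV idx (idx k) = k"
  using bij_idx by (simp add: bij_betw_inv_into_left)

lemma idx_top: "idx top_idx = CARD('n)"
  unfolding top_idx_def by (rule idx_inv) auto

lemma idx_less: "k \<noteq> top_idx \<Longrightarrow> idx k \<in> {1..<CARD('n)}"
  using idx_range[of k] inv_idx[of k] by (auto simp: top_idx_def order_le_less)

lemma base_cong: "(\<And>k. k \<noteq> top_idx \<Longrightarrow> z $ k = z' $ k) \<Longrightarrow> base z = base z'"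
  unfolding base_def using idx_inv idx_top
  by (intro restrict_ext) (metis One_nat_def atLeastAtMost_iff atLeastLessThan_iff less_imp_le nat_neq_iff)

lemma P_F: "P (F v) = c * discriminant W \<alpha> v"
proof -
  have "base (F v) = restrict (\<lambda>i. f i v) {1..<CARD('n)}"
    unfolding base_def by (intro restrict_ext) (auto simp: idx_inv)
  then show ?thesis by (simp add: P_def discriminant_eq idx_top)
qed

lemma Y_polynomial_base:
  assumes "p \<in> Y_polynomials CARD('n)"
  shows "(\<lambda>z. p (base z)) \<in> polynomial_functions"
  using assms unfolding Y_polynomials_def polynomial_functions_def
proof induction
  case (generator g)
  then show ?case
    using coordinate_in_polynomial_functions by (auto simp: base_def polynomial_functions_def)
qed (auto intro: algebra_generated.const algebra_generated.add algebra_generated.mult)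

lemma P_polynomial: "P \<in> polynomial_functions"
proof -
  have "(\<lambda>z. z $ top_idx ^ CARD('n) + (\<Sum>i=2..CARD('n). a i (base z) * z $ top_idx ^ (CARD('n) - i)))
      \<in> polynomial_functions"
    using Y_polynomial_base[OF a_polynomial] coordinate_in_polynomial_functions[of top_idx]
    unfolding polynomial_functions_def
    by (intro algebra_generated.add algebra_generated_sum algebra_generated.mult algebra_generated_power)
  then show ?thesis by (simp add: P_def[abs_def] poly_disc_poly)
qed

lemma open_Q_reg: "open Q_reg"
proof -
  have "open (P -` (- {0}))"
    by (rule open_vimage[OF _ continuous_on_polynomial_functions[OF P_polynomial]]) auto
  then show ?thesis by (simp add: Q_reg_def vimage_def)
qed

lemma V_reg_eq: "V_reg = F -` Q_reg"
  by (auto simp: V_reg_def Q_reg_def)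

lemma open_V_reg: "open V_reg"
  unfolding V_reg_eq using open_Q_reg continuous_on_F by (rule open_vimage)

lemma connected_Q_reg: "connected Q_reg"
  using connected_hypersurface_complement[OF P_polynomial, of UNIV UNIV] by (simp add: Q_reg_def)

lemma base_add_axis [simp]: "base (z + axis top_idx t) = base z"
  by (rule base_cong) (simp add: axis_def)

lemma P_add_axis: "P (z + axis top_idx t) = poly (disc_poly CARD('n) a (base z)) (z $ top_idx + t)"
  by (simp add: P_def axis_nth)

lemma disc_poly_nonzero: "disc_poly CARD('n) a y \<noteq> 0"
  using lead_coeff_disc_poly[of "CARD('n)" a y] by auto

text \<open>\<open>P\<close> is monic in the last coordinate, so each line in that direction meets
  the discriminant in finitely many points only.\<close>

lemma closure_Q_reg: "closure Q_reg = UNIV"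
proof -
  have "z \<in> closure Q_reg" for z unfolding closure_approachable
  proof (intro allI impI)
    fix e :: real assume "e > 0"
    have "finite {t. poly (disc_poly CARD('n) a (base z)) (z $ top_idx + t) = 0}"
      by (rule finite_vimageI[of "{t. poly (disc_poly CARD('n) a (base z)) t = 0}" "\<lambda>t. z $ top_idx + t", unfolded vimage_def, simplified])
        (rule poly_roots_finite[OF disc_poly_nonzero])
    moreover have "infinite (ball (0::complex) e)"
      using \<open>e > 0\<close> finite_imp_not_open[of "ball (0::complex) e"] by auto
    ultimately have "\<not> ball 0 e \<subseteq> {t. poly (disc_poly CARD('n) a (base z)) (z $ top_idx + t) = 0}"
      using finite_subset by metis
    then obtain t where t: "t \<in> ball 0 e" "poly (disc_poly CARD('n) a (base z)) (z $ top_idx + t) \<noteq> 0"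
      by blast
    then have "z + axis top_idx t \<in> Q_reg" by (simp add: Q_reg_def P_add_axis)
    moreover have "dist (z + axis top_idx t) z < e" using t by (simp add: dist_norm norm_axis)
    ultimately show "\<exists>y\<in>Q_reg. dist y z < e" by blast
  qed
  then show ?thesis by blast
qed

section \<open>Reflecting hyperplanes and the regular locus\<close>

lemma reflection_if_fixes_hyperplane:
  assumes "w \<in> W" "w \<noteq> mat 1" "hyperplane H" "\<forall>v\<in>H. w *v v = v"
  shows "reflection w"
proof -
  interpret GL: group "GL :: (complex^'n^'n) monoid"
    by (rule group_GL)
  have w: "w \<in> carrier GL" using assms(1) subgroup.subset[OF subgroup_W] by blast
  have "w [^]\<^bsub>GL\<^esub> k \<in> W" for k :: nat
    by (induction k) (use assms(1) one_in_W mult_in_W in \<open>simp_all add: GL.nat_pow_Suc\<close>)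
  then have "\<not> inj (\<lambda>k::nat. w [^]\<^bsub>GL\<^esub> k)"
    using finite_W by (meson finite_subset image_subsetI infinite_UNIV_nat finite_imageD)
  then obtain i j :: nat where ij: "i < j" "w [^]\<^bsub>GL\<^esub> j = w [^]\<^bsub>GL\<^esub> i"
    unfolding inj_def by (metis nat_neq_iff)
  then have "w [^]\<^bsub>GL\<^esub> (j - i) = \<one>\<^bsub>GL\<^esub>"
    using GL.pow_eq_div2[OF w] by blast
  then show ?thesis unfolding reflection_def using w assms ij(1) by (metis GL_simps(3) zero_less_diff)
qed

lemma dim_fixed_space_less:
  assumes "w \<noteq> mat 1"
  shows "vec.dim (fixed_space w) < CARD('n)"
proof -
  have "vec.dim (fixed_space w) \<noteq> CARD('n)"
  proof
    assume "vec.dim (fixed_space w) = CARD('n)"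
    then have "fixed_space w = UNIV"
      using vec.subspace_dim_equal[OF subspace_fixed_space vec.subspace_UNIV, of w]
      by (simp add: vec_dim_card del: vec.dim_UNIV)
    then show False using fixed_space_proper[OF assms] by blast
  qed
  moreover have "vec.dim (fixed_space w) \<le> CARD('n)"
    using vec.dim_subset[OF subset_UNIV, of "fixed_space w"] by (simp add: vec_dim_card del: vec.dim_UNIV)
  ultimately show ?thesis by linarith
qed

lemma reflecting_hyperplane_eq_fixed_space:
  assumes "H \<in> reflecting_hyperplanes W"
  obtains w where "w \<in> W" "w \<noteq> mat 1" "H = fixed_space w"
proof -
  obtain w where w: "hyperplane H" "w \<in> W" "reflection w" "\<forall>v\<in>H. w *v v = v"
    using assms by (auto simp: reflecting_hyperplanes_def)
  have "w \<noteq> mat 1" using w(3) by (simp add: reflection_def)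
  then have "H = fixed_space w" using w(1,4) dim_fixed_space_less[of w] subspace_fixed_space
    by (intro vec.subspace_dim_equal) (auto simp: hyperplane_def fixed_space_def)
  then show thesis using that w(2) \<open>w \<noteq> mat 1\<close> by blast
qed

lemma finite_reflecting_hyperplanes: "finite (reflecting_hyperplanes W)"
proof (rule finite_subset)
  show "reflecting_hyperplanes W \<subseteq> fixed_space ` W"
    using reflecting_hyperplane_eq_fixed_space by blast
qed (use finite_W in auto)

lemma stabiliser_order_pos: "stabiliser_order W H > 0"
  unfolding stabiliser_order_def using finite_W one_in_W by (auto simp: card_gt_0_iff)

lemma V_reg_iff: "v \<in> V_reg \<longleftrightarrow> (\<forall>H\<in>reflecting_hyperplanes W. v \<notin> H)"
proof -
  have "\<alpha> H v ^ stabiliser_order W H = 0 \<longleftrightarrow> v \<in> H" if "H \<in> reflecting_hyperplanes W" for H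
    using linear_forms[OF that] stabiliser_order_pos[of H] by auto
  then show ?thesis
    using finite_reflecting_hyperplanes c_nonzero by (simp add: V_reg_def P_F discriminant_def del: power_eq_0_iff)
qed

lemma V_reg_nonempty: "V_reg \<noteq> {}"
proof -
  have "negligible H" if "H \<in> reflecting_hyperplanes W" for H
    using reflecting_hyperplane_eq_fixed_space[OF that]
    by (metis negligible_complex_subspace subspace_fixed_space fixed_space_proper)
  then obtain v where "v \<notin> \<Union>(reflecting_hyperplanes W)"
    using open_not_covered_by_negligible[OF open_UNIV UNIV_not_empty finite_reflecting_hyperplanes] by blast
  then show ?thesis using V_reg_iff by blast
qed

text \<open>A nontrivial element fixing a hyperplane is a reflection, so off the reflecting
  hyperplanes a nontrivial stabilising element has a fixed space of codimension at least 2. With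
  \<open>stabiliser_trivial\<close> this also gives Steinberg's theorem that \<open>W\<close> acts
  freely on \<open>V_reg\<close>.\<close>

lemma det_DF_V_reg:
  assumes "v \<in> V_reg"
  shows "det (DF v) \<noteq> 0"
proof (rule det_DF_nonzero)
  fix w assume w: "w \<in> W" "w \<noteq> mat 1" "w *v v = v"
  have "\<not> hyperplane (fixed_space w)"
  proof
    assume H: "hyperplane (fixed_space w)"
    then have "fixed_space w \<in> reflecting_hyperplanes W"
      using reflection_if_fixes_hyperplane[OF w(1,2) H] w(1)
      by (auto simp: reflecting_hyperplanes_def fixed_space_def)
    moreover have "v \<in> fixed_space w" using w(3) by (simp add: fixed_space_def)
    ultimately show False using assms V_reg_iff by blast
  qed
  then have "vec.dim (fixed_space w) + 1 \<noteq> CARD('n)"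
    using subspace_fixed_space by (auto simp: hyperplane_def)
  then show "vec.dim (fixed_space w) + 2 \<le> CARD('n)" using dim_fixed_space_less[OF w(2)] by linarith
qed

section \<open>The quotient map as a covering, and its local sections\<close>

lemma F_locally_injective:
  assumes "v \<in> V_reg"
  obtains U where "open U" "v \<in> U" "U \<subseteq> V_reg" "inj_on F U"
proof -
  obtain N where N: "open N" "v \<in> N" "\<And>w x. w \<in> W \<Longrightarrow> x \<in> N \<Longrightarrow> w *v x \<in> N \<Longrightarrow> w *v v = v"
    by (rule stabiliser_neighbourhood[of v]) (rule that)
  have "x = y" if xy: "x \<in> N" "y \<in> N" "F x = F y" for x y
  proof -
    obtain w where w: "w \<in> W" "y = w *v x" using F_eq_imp_same_orbit xy(3) by blast
    then have "w = mat 1" using N(3) xy stabiliser_trivial[OF det_DF_V_reg[OF assms]] by blast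
    then show ?thesis using w by simp
  qed
  then have "inj_on F (V_reg \<inter> N)" by (auto intro: inj_onI)
  then show thesis using that[of "V_reg \<inter> N"] N(1,2) open_V_reg assms by auto
qed

lemma open_image_F:
  assumes "open U" "U \<subseteq> V_reg"
  shows "open (F ` U)"
proof (subst open_subopen, clarify)
  fix v assume "v \<in> U"
  then obtain U' where U': "open U'" "v \<in> U'" "inj_on F U'"
    using assms F_locally_injective by (metis subsetD)
  have "open (F ` (U \<inter> U'))"
    using U' assms(1) by (intro invariance_of_domain continuous_on_F) (auto intro: inj_on_subset)
  then show "\<exists>T. open T \<and> F v \<in> T \<and> T \<subseteq> F ` U"
    using \<open>v \<in> U\<close> U'(2) by blast
qed

text \<open>Over the connected set \<open>Q_reg\<close> the image is open by invariance of domain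
  and closed by properness. Density of \<open>Q_reg\<close> and closedness of the image then give
  the whole space.\<close>

lemma F_surj: "surj F"
proof -
  have "Q_reg \<inter> range F = F ` V_reg" by (auto simp: V_reg_eq)
  have "openin (top_of_set Q_reg) (Q_reg \<inter> range F)"
    unfolding \<open>Q_reg \<inter> range F = F ` V_reg\<close>
    using open_image_F[OF open_V_reg] by (intro open_subset) (auto simp: V_reg_eq)
  moreover have "closedin (top_of_set Q_reg) (Q_reg \<inter> range F)"
    using closed_image_F[OF closed_UNIV] by (rule closedin_closed_Int)
  moreover have "Q_reg \<inter> range F \<noteq> {}"
    unfolding \<open>Q_reg \<inter> range F = F ` V_reg\<close> using V_reg_nonempty by blast
  ultimately have "Q_reg \<inter> range F = Q_reg"
    using connected_Q_reg unfolding connected_clopen by blast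
  then have "closure Q_reg \<subseteq> range F"
    using closed_image_F[OF closed_UNIV] by (intro closure_minimal) auto
  then show ?thesis using closure_Q_reg by auto
qed

lemma covering_F: "covering_space V_reg F Q_reg"
proof (rule covering_space_closed_open_map)
  show "F ` V_reg = Q_reg" using F_surj by (auto simp: V_reg_eq image_vimage_eq)
  show "openin (top_of_set Q_reg) (F ` U)" if "openin (top_of_set V_reg) U" for U
  proof -
    have "open U" "U \<subseteq> V_reg" using that open_V_reg openin_open_eq by blast+
    then show ?thesis using open_image_F[of U] open_Q_reg by (auto simp: openin_open_eq V_reg_eq)
  qed
  show "closedin (top_of_set Q_reg) (F ` K)" if K: "closedin (top_of_set V_reg) K" for K
  proof -
    obtain C where C: "closed C" "K = V_reg \<inter> C" using K by (auto simp: closedin_closed)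
    then have "F ` K = Q_reg \<inter> F ` C" by (auto simp: V_reg_eq)
    then show ?thesis using closedin_closed_Int[OF closed_image_F[OF C(1)]] by simp
  qed
  show "finite (V_reg \<inter> F -` {s})" if "s \<in> Q_reg" for s
  proof -
    obtain v where "s = F v" using F_surj by (metis surjD)
    then have "F -` {s} \<subseteq> (\<lambda>w. w *v v) ` W"
      using F_eq_imp_same_orbit by (metis (no_types, lifting) image_iff singletonD subsetI vimageE)
    then show ?thesis using finite_W by (meson finite_Int finite_imageI finite_subset)
  qed
  show "\<exists>U. openin (top_of_set V_reg) U \<and> x \<in> U \<and> inj_on F U" if "x \<in> V_reg" for x
    using F_locally_injective[OF that] open_V_reg by (metis openin_open_eq)
qed (rule continuous_on_F)

text \<open>The derivative of the section is recorded as a complex matrix: this makes lifts of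
  complex lines holomorphic and supplies the Lipschitz bound used near infinity.\<close>

lemma local_section:
  assumes "v \<in> V_reg"
  obtains O1 g B U where "open O1" "F v \<in> O1" "g (F v) = v" "continuous_on O1 g"
    "\<And>z. z \<in> O1 \<Longrightarrow> F (g z) = z"
    "(g has_derivative (\<lambda>h. B *v h)) (at (F v))"
    "open U" "v \<in> U" "\<And>x. x \<in> U \<Longrightarrow> F x \<in> O1 \<and> g (F x) = x"
proof -
  obtain U where U: "open U" "v \<in> U" "U \<subseteq> V_reg" "inj_on F U"
    using F_locally_injective[OF assms] .
  obtain g where g: "homeomorphism U (F ` U) F g"
    using invariance_of_domain_homeomorphism[OF U(1) continuous_on_F _ U(4)] by auto
  have op: "open (F ` U)" using open_image_F U by blast
  obtain B where B: "B ** DF v = mat 1"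
    using det_DF_V_reg[OF assms] invertible_det_nz invertible_left_inverse by blast
  have gF: "g (F x) = x" if "x \<in> U" for x using g that by (simp add: homeomorphism_def)
  have cont: "continuous_on (F ` U) g" using g by (simp add: homeomorphism_def)
  have "(g has_derivative (\<lambda>h. B *v h)) (at (F v))"
  proof (rule has_derivative_inverse_basic[where T = "F ` U"])
    show "(F has_derivative (\<lambda>h. DF v *v h)) (at (g (F v)))"
      using has_derivative_F[of v] gF[OF U(2)] by simp
    show "bounded_linear (\<lambda>h. B *v h)" by (rule bounded_linear_matrix_vector_mult)
    show "(\<lambda>h. B *v h) \<circ> (\<lambda>h. DF v *v h) = id"
      using B by (auto simp: fun_eq_iff matrix_vector_mul_assoc)
    show "continuous (at (F v)) g" using cont op U(2) by (simp add: continuous_on_eq_continuous_at)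
    show "F (g z) = z" if "z \<in> F ` U" for z using that gF by auto
  qed (use op U(2) in auto)
  moreover have "F (g z) = z" if "z \<in> F ` U" for z using that gF by auto
  ultimately show thesis using that[of "F ` U" g B U] op U gF cont by auto
qed

text \<open>By continuity the lift agrees near each \<open>t0\<close> with a local section along the
  line, and the derivative of that composition is multiplication by an entry of a complex
  matrix.\<close>

lemma holomorphic_lift:
  assumes "open S" "continuous_on S v" "\<And>t. t \<in> S \<Longrightarrow> v t \<in> V_reg"
    and "\<And>t. t \<in> S \<Longrightarrow> F (v t) = y + axis top_idx t"
  shows "(\<lambda>t. v t $ k) holomorphic_on S"
  unfolding holomorphic_on_open[OF assms(1)]
proof (intro ballI)
  fix t0 assume t0: "t0 \<in> S"
  obtain O1 g B U where g: "g (F (v t0)) = v t0"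
    "(g has_derivative (\<lambda>h. B *v h)) (at (F (v t0)))"
    "open U" "v t0 \<in> U" "\<And>x. x \<in> U \<Longrightarrow> F x \<in> O1 \<and> g (F x) = x"
    using local_section[OF assms(3)[OF t0]] by metis
  have "open (v -` U \<inter> S)" using continuous_on_open_vimage[OF assms(1)] assms(2) g(3) by blast
  then have "\<forall>\<^sub>F t in nhds t0. t \<in> v -` U \<inter> S"
    using g(4) t0 by (intro eventually_nhds_in_open) auto
  then have ev: "\<forall>\<^sub>F t in nhds t0. g (y + axis top_idx t) $ k = v t $ k"
    by (rule eventually_mono) (use g(5) assms(4) in force)
  have "bounded_linear (\<lambda>h::complex. axis top_idx h :: complex^'n)"
    by (intro linear_conv_bounded_linear[THEN iffD1] linearI) (auto simp: axis_def vec_eq_iff)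
  then have "((\<lambda>t. y + axis top_idx t) has_derivative (\<lambda>h. axis top_idx h)) (at t0)"
    using has_derivative_add[OF has_derivative_const bounded_linear_imp_has_derivative] by fastforce
  then have "((\<lambda>t. g (y + axis top_idx t)) has_derivative (\<lambda>h. B *v axis top_idx h)) (at t0)"
    by (rule has_derivative_compose) (use g(2) assms(4)[OF t0] in simp)
  then have "((\<lambda>t. g (y + axis top_idx t) $ k) has_derivative (\<lambda>h. (B *v axis top_idx h) $ k)) (at t0)"
    by (rule bounded_linear.has_derivative[OF bounded_linear_vec_nth])
  moreover have "(\<lambda>h. (B *v axis top_idx h) $ k) = (\<lambda>h. B $ k $ top_idx * h)"
    by (simp add: matrix_vector_mult_def axis_def if_distrib[of "\<lambda>x. _ * x"] cong: if_cong)
  ultimately have "((\<lambda>t. g (y + axis top_idx t) $ k) has_field_derivative B $ k $ top_idx) (at t0)"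
    by (simp add: has_field_derivative_def)
  then have "((\<lambda>t. v t $ k) has_field_derivative B $ k $ top_idx) (at t0)"
    by (rule DERIV_cong_ev[OF refl ev refl, THEN iffD1])
  then show "\<exists>f'. ((\<lambda>t. v t $ k) has_field_derivative f') (at t0)" by blast
qed

section \<open>The weighted action on the quotient and the degrees\<close>

definition scale :: "complex \<Rightarrow> complex^'n \<Rightarrow> complex^'n" where
  "scale s z = (\<chi> k. s ^ d (idx k) * z $ k)"

definition disc_degree :: nat where
  "disc_degree = (\<Sum>H\<in>reflecting_hyperplanes W. stabiliser_order W H)"

lemma F_smult: "F (s *s v) = scale s (F v)"
  by (simp add: vec_eq_iff scale_def f_scale)

text \<open>By \<open>F_smult\<close>, \<open>scale\<close> is scalar multiplication of
  \<open>V\<close> seen in the quotient. Homogeneity of the discriminant on \<open>V\<close>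
  therefore descends, and surjectivity of \<open>F\<close> makes it hold at every
  \<open>z\<close>.\<close>

lemma P_scale: "P (scale s z) = s ^ disc_degree * P z"
proof -
  obtain v where v: "z = F v" using F_surj by (metis surjD)
  have "\<alpha> H (s *s v) = s * \<alpha> H v" if "H \<in> reflecting_hyperplanes W" for H
  proof -
    have "Vector_Spaces.linear (*s) (*) (\<alpha> H)"
      using linear_forms[OF that] by (simp add: linear_form_def)
    then interpret L: Vector_Spaces.linear "(*s)" "(*)" "\<alpha> H" .
    show ?thesis by (rule L.scale)
  qed
  then have "discriminant W \<alpha> (s *s v) = s ^ disc_degree * discriminant W \<alpha> v"
    by (simp add: discriminant_def disc_degree_def power_mult_distrib prod.distrib power_sum)
  then show ?thesis unfolding v F_smult[symmetric] P_F by simp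
qed

lemma degree_pos: "d (idx k) > 0"
proof (rule ccontr)
  assume "\<not> d (idx k) > 0"
  then have "f (idx k) v = f (idx k) 0" for v using f_scale[of k 0 v] by simp
  moreover obtain v v' where "F v = 0" "F v' = axis k 1" using F_surj by (metis surjD)
  ultimately have "(0::complex^'n) $ k = axis k 1 $ k" by (metis F_nth)
  then show False by (simp add: axis_def)
qed

text \<open>An invariant of degree 1 is a linear form with \<open>W\<close>-stable kernel.
  Irreducibility makes the kernel zero, which is impossible with the two distinct coordinates
  \<open>k\<close> and \<open>top_idx\<close> present.\<close>

lemma degree_ge_2:
  assumes "k \<noteq> top_idx"
  shows "d (idx k) \<ge> 2"
proof (rule ccontr)
  assume "\<not> d (idx k) \<ge> 2"
  then have d: "d (idx k) = 1" using degree_pos[of k] by linarith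
  \<comment> \<open>A function homogeneous of degree 1 and differentiable at 0 equals its derivative
    there, hence is linear.\<close>
  define \<phi> where "\<phi> = (\<lambda>h. \<Sum>i\<in>UNIV. partial (f (idx k)) i 0 * h $ i)"
  have d\<phi>: "(f (idx k) has_derivative \<phi>) (at 0)"
    unfolding \<phi>_def by (rule has_derivative_polynomial_functions[OF f_polynomial])
  have f\<phi>: "f (idx k) v = \<phi> v" for v
  proof -
    have "((\<lambda>t::real. t *\<^sub>R v) has_derivative (\<lambda>t. t *\<^sub>R v)) (at 0)"
      by (auto intro!: derivative_eq_intros)
    then have "((\<lambda>t::real. f (idx k) (t *\<^sub>R v)) has_derivative (\<lambda>t. \<phi> (t *\<^sub>R v))) (at 0)"
      using has_derivative_compose[of "\<lambda>t::real. t *\<^sub>R v" _ 0 UNIV "f (idx k)" \<phi>] d\<phi> by simp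
    moreover have "f (idx k) (t *\<^sub>R v) = t *\<^sub>R f (idx k) v" for t
    proof -
      have "t *\<^sub>R v = complex_of_real t *s v"
        by (simp add: vec_eq_iff scaleR_conv_of_real[where 'a = complex])
      then show ?thesis using f_scale[of k "complex_of_real t" v] d by (simp add: scaleR_conv_of_real)
    qed
    ultimately have "((\<lambda>t::real. t *\<^sub>R f (idx k) v) has_derivative (\<lambda>t. \<phi> (t *\<^sub>R v))) (at 0)"
      by simp
    moreover have "((\<lambda>t::real. t *\<^sub>R f (idx k) v) has_derivative (\<lambda>t. t *\<^sub>R f (idx k) v)) (at 0)"
      by (auto intro!: derivative_eq_intros)
    ultimately have "(\<lambda>t. \<phi> (t *\<^sub>R v)) = (\<lambda>t. t *\<^sub>R f (idx k) v)"
      using has_derivative_unique by blast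
    from fun_cong[OF this, of 1] show ?thesis
      by simp
  qed
  have lin: "f (idx k) (s *s u + t *s u') = s * f (idx k) u + t * f (idx k) u'" for s t u u'
  proof -
    have "\<phi> (s *s u + t *s u') = s * \<phi> u + t * \<phi> u'"
      by (simp add: \<phi>_def distrib_left sum.distrib sum_distrib_left mult.left_commute)
    then show ?thesis by (simp only: f\<phi>)
  qed
  define U where "U = {v. f (idx k) v = 0}"
  have "vec.subspace U" unfolding vec.subspace_def U_def
  proof (intro conjI ballI allI)
    show "0 \<in> {v. f (idx k) v = 0}" using f_scale[of k 0 0] d by simp
    show "x + y \<in> {v. f (idx k) v = 0}" if "x \<in> {v. f (idx k) v = 0}" "y \<in> {v. f (idx k) v = 0}" for x y
      using lin[of 1 x 1 y] that by simp
    show "s *s x \<in> {v. f (idx k) v = 0}" if "x \<in> {v. f (idx k) v = 0}" for s x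
      using f_scale[of k s x] that by simp
  qed
  moreover have "\<forall>w\<in>W. \<forall>u\<in>U. w *v u \<in> U"
  proof (intro ballI)
    fix w u assume "w \<in> W" "u \<in> U"
    then have "F (w *v u) $ k = F u $ k" "f (idx k) u = 0"
      by (simp_all only: F_invariant) (simp add: U_def)
    then show "w *v u \<in> U" by (simp add: U_def)
  qed
  ultimately have "U = {0} \<or> U = UNIV" using irreducible unfolding irreducible_group_def by blast
  moreover obtain v where "F v = axis k 1" using F_surj by (metis surjD)
  then have "f (idx k) v = 1" by (metis F_nth axis_nth)
  then have "v \<notin> U" by (simp add: U_def)
  ultimately have "U = {0}" by blast
  define x y where "x = (axis k 1 :: complex^'n)" and "y = (axis top_idx 1 :: complex^'n)"
  \<comment> \<open>The usual kernel vector of a linear form on the plane spanned by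
    \<open>x\<close> and \<open>y\<close>.\<close>
  have "f (idx k) y *s x + (- f (idx k) x) *s y \<in> U" unfolding U_def mem_Collect_eq lin by simp
  then have zero: "f (idx k) y *s x + (- f (idx k) x) *s y = 0" using \<open>U = {0}\<close> by blast
  have "(f (idx k) y *s x + (- f (idx k) x) *s y) $ k = f (idx k) y"
    using assms by (simp add: x_def y_def axis_def)
  then have "f (idx k) y = 0" unfolding zero by simp
  then have "y \<in> U" by (simp add: U_def)
  then have "y = 0" using \<open>U = {0}\<close> by blast
  then have "y $ top_idx = 0" by simp
  then show False by (simp add: y_def axis_def)
qed

text \<open>By quasi-homogeneity a zero of \<open>P\<close> at this point would spread over the
  whole line above the origin of the base, but \<open>P\<close> restricts there to a monic
  polynomial.\<close>

lemma axis_top_in_Q_reg: "axis top_idx 1 \<in> Q_reg"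
proof (rule ccontr)
  assume "axis top_idx 1 \<notin> Q_reg"
  then have P0: "P (axis top_idx 1) = 0" by (simp add: Q_reg_def)
  have "poly (disc_poly CARD('n) a (base 0)) t = 0" for t
  proof -
    obtain s where s: "s ^ d (idx top_idx) = t" using exists_complex_root[OF degree_pos[of top_idx]] .
    have "scale s (axis top_idx 1) = 0 + axis top_idx t" by (auto simp: scale_def axis_def vec_eq_iff s)
    then have "P (0 + axis top_idx t) = 0" using P_scale[of s "axis top_idx 1"] P0 by simp
    then show ?thesis by (simp only: P_add_axis) simp
  qed
  then have "disc_poly CARD('n) a (base 0) = 0" by (metis poly_all_0_iff_0)
  then show False using disc_poly_nonzero by blast
qed

end

section \<open>Local injectivity of the Lyashko--Looijenga morphism on strata\<close>

text \<open>A Cauchy bound: once \<open>norm t > 1\<close>, all the lower powers are dominated by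
  \<open>norm t ^ (n - 1)\<close>.\<close>

lemma norm_root_le:
  fixes t :: complex
  assumes "poly (disc_poly n a y) t = 0" "n > 0"
  shows "norm t \<le> 1 + (\<Sum>i=2..n. norm (a i y))"
proof (rule ccontr)
  define S where "S = (\<Sum>i=2..n. norm (a i y))"
  assume "\<not> ?thesis"
  then have t: "norm t > 1 + S" by (simp add: S_def)
  have S0: "S \<ge> 0" by (simp add: S_def sum_nonneg)
  have "t ^ n = - (\<Sum>i=2..n. a i y * t ^ (n - i))"
    using assms(1) by (simp add: poly_disc_poly eq_neg_iff_add_eq_0)
  then have "norm t ^ n = norm (\<Sum>i=2..n. a i y * t ^ (n - i))"
    by (metis norm_minus_cancel norm_power)
  also have "\<dots> \<le> (\<Sum>i=2..n. norm (a i y * t ^ (n - i)))" by (rule norm_sum)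
  also have "\<dots> \<le> (\<Sum>i=2..n. norm (a i y) * norm t ^ (n - 1))"
  proof (rule sum_mono)
    fix i assume "i \<in> {2..n}"
    then have "norm t ^ (n - i) \<le> norm t ^ (n - 1)" using t S0 by (intro power_increasing) auto
    then show "norm (a i y * t ^ (n - i)) \<le> norm (a i y) * norm t ^ (n - 1)"
      by (simp add: norm_mult norm_power mult_left_mono)
  qed
  also have "\<dots> = S * norm t ^ (n - 1)" by (simp add: S_def sum_distrib_right)
  also have "\<dots> < norm t * norm t ^ (n - 1)"
    using t S0 by (intro mult_strict_right_mono zero_less_power) auto
  also have "\<dots> = norm t ^ n" using assms(2) by (metis power_minus_mult mult.commute)
  finally show False by simp
qed

text \<open>The value of a monic polynomial is the product of the differences from its roots. Read
  backwards, a small value at \<open>t\<close> forces a root near \<open>t\<close>.\<close>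

lemma prod_distances_le:
  fixes p :: "complex poly"
  assumes "lead_coeff p = 1" "e \<ge> 0" "\<And>x. poly p x = 0 \<Longrightarrow> e \<le> dist t x"
  shows "e ^ degree p \<le> norm (poly p t)"
proof -
  have p: "p = (\<Prod>x\<in>#proots p. [:-x, 1:])"
    using complex_poly_decompose_multiset[of p] assms(1) by simp
  have le: "e ^ size A \<le> norm (poly (\<Prod>x\<in>#A. [:-x, 1:]) t)" if "\<forall>x\<in>#A. e \<le> dist t x" for A
    using that
  proof (induction A)
    case (add x A)
    then have "e * e ^ size A \<le> dist t x * norm (poly (\<Prod>x\<in>#A. [:-x, 1:]) t)"
      using assms(2) by (intro mult_mono) auto
    then show ?case by (simp add: norm_mult dist_norm flip: left_diff_distrib)
  qed auto
  have "p \<noteq> 0" using assms(1) by auto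
  then have "\<forall>x\<in>#proots p. e \<le> dist t x" using assms(3) by auto
  from le[OF this] show ?thesis
    using p by (simp add: size_proots_complex)
qed

context lyashko_looijenga
begin

definition dp :: "complex^'n \<Rightarrow> complex poly" where
  "dp y = disc_poly CARD('n) a (base y)"

definition roots :: "complex^'n \<Rightarrow> complex set" where
  "roots y = {t. poly (dp y) t = 0}"

text \<open>The base \<open>Y\<close>, embedded in \<open>\<complex>\<^sup>n\<close> as the hyperplane on which the coordinate of \<open>f\<^sub>n\<close> vanishes.\<close>

definition Y0 :: "(complex^'n) set" where
  "Y0 = {y. y $ top_idx = 0}"

lemma degree_dp: "degree (dp y) = CARD('n)"
  and lead_coeff_dp: "lead_coeff (dp y) = 1"
  by (simp_all add: dp_def degree_disc_poly lead_coeff_disc_poly)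

lemma dp_nonzero: "dp y \<noteq> 0"
  by (simp add: dp_def disc_poly_nonzero)

lemma finite_roots: "finite (roots y)"
  unfolding roots_def by (rule poly_roots_finite[OF dp_nonzero])

lemma P_axis_eq: "y \<in> Y0 \<Longrightarrow> P (y + axis top_idx t) = poly (dp y) t"
  by (simp add: Y0_def dp_def P_add_axis)

lemma add_axis_in_Q_reg: "y \<in> Y0 \<Longrightarrow> y + axis top_idx t \<in> Q_reg \<longleftrightarrow> t \<notin> roots y"
  by (simp add: Q_reg_def roots_def P_axis_eq)

lemma Y0_convex_combination: "y \<in> Y0 \<Longrightarrow> y' \<in> Y0 \<Longrightarrow> (1 - r) *\<^sub>R y + r *\<^sub>R y' \<in> Y0"
  by (simp add: Y0_def)

lemma continuous_coefficients: "i \<in> {2..CARD('n)} \<Longrightarrow> isCont (\<lambda>y. a i (base y)) y0"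
  using continuous_on_polynomial_functions[OF Y_polynomial_base[OF a_polynomial], of i UNIV]
  by (simp add: continuous_on_eq_continuous_at)

text \<open>Both directions read \<open>prod_distances_le\<close> backwards: a root over
  \<open>y\<close> makes the polynomial over \<open>y0\<close> small, by closeness of the
  coefficients, and a root over \<open>y0\<close> makes the polynomial over \<open>y\<close>
  small.\<close>

lemma roots_continuity:
  assumes "e > 0"
  shows "\<forall>\<^sub>F y in nhds y0. (\<forall>t\<in>roots y. \<exists>x\<in>roots y0. dist t x < e) \<and> (\<forall>x\<in>roots y0. \<exists>t\<in>roots y. dist t x < e)"
proof (rule eventually_conj)
  let ?n = "CARD('n)"
  have tend: "((\<lambda>y. a i (base y)) \<longlongrightarrow> a i (base y0)) (nhds y0)" if "i \<in> {2..?n}" for i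
    using continuous_coefficients[OF that, of y0] by (simp add: continuous_at tendsto_nhds_iff)
  \<comment> \<open>A common bound for the roots over all \<open>y\<close> whose coefficients are
    within 1 of those over \<open>y0\<close>.\<close>
  define R where "R = 1 + (\<Sum>i=2..?n. norm (a i (base y0)) + 1)"
  define m where "m = (\<lambda>y. \<Sum>i=2..?n. norm (a i (base y0) - a i (base y)) * R ^ (?n - i))"
  have R: "R \<ge> 1" by (simp add: R_def sum_nonneg)
  have "(m \<longlongrightarrow> (\<Sum>i=2..?n. norm (a i (base y0) - a i (base y0)) * R ^ (?n - i))) (nhds y0)"
    unfolding m_def by (intro tendsto_intros tend)
  then have "(m \<longlongrightarrow> 0) (nhds y0)" by simp
  then have ev1: "\<forall>\<^sub>F y in nhds y0. m y < e ^ ?n"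
    using assms by (intro order_tendstoD) auto
  have ev2: "\<forall>\<^sub>F y in nhds y0. \<forall>i\<in>{2..?n}. norm (a i (base y)) < norm (a i (base y0)) + 1"
    by (intro eventually_ball_finite ballI order_tendstoD[OF tendsto_norm[OF tend]]) auto
  show "\<forall>\<^sub>F y in nhds y0. \<forall>t\<in>roots y. \<exists>x\<in>roots y0. dist t x < e"
    using ev1 ev2
  proof (eventually_elim, intro ballI)
    fix y t assume m: "m y < e ^ ?n" and c: "\<forall>i\<in>{2..?n}. norm (a i (base y)) < norm (a i (base y0)) + 1"
      and t: "t \<in> roots y"
    show "\<exists>x\<in>roots y0. dist t x < e"
    proof (rule ccontr)
      assume "\<not> ?thesis"
      then have "e ^ ?n \<le> norm (poly (dp y0) t)"
        using prod_distances_le[of "dp y0" e t] assms by (auto simp: lead_coeff_dp[unfolded degree_dp] degree_dp roots_def not_less)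
      have t0: "poly (dp y) t = 0" using t by (simp add: roots_def)
      have "norm t \<le> 1 + (\<Sum>i=2..?n. norm (a i (base y)))"
        using t0 by (intro norm_root_le) (auto simp: dp_def)
      also have "\<dots> \<le> R"
        unfolding R_def using c by (intro add_left_mono sum_mono) (auto intro: less_imp_le)
      finally have tR: "norm t \<le> R" .
      have "poly (dp y0) t = poly (dp y0) t - poly (dp y) t" using t0 by simp
      also have "\<dots> = (\<Sum>i=2..?n. (a i (base y0) - a i (base y)) * t ^ (?n - i))"
        by (simp add: dp_def poly_disc_poly sum_subtractf left_diff_distrib)
      also have "norm \<dots> \<le> m y" unfolding m_def using tR
        by (intro order_trans[OF norm_sum] sum_mono) (auto simp: norm_mult norm_power intro!: mult_left_mono power_mono)
      finally show False using m \<open>e ^ ?n \<le> norm (poly (dp y0) t)\<close> by linarith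
    qed
  qed
  have "\<forall>\<^sub>F y in nhds y0. \<exists>t\<in>roots y. dist t x < e" if "x \<in> roots y0" for x
  proof -
    have "((\<lambda>y. poly (dp y) x) \<longlongrightarrow> poly (dp y0) x) (nhds y0)"
      unfolding dp_def poly_disc_poly by (intro tendsto_intros tend)
    then have "((\<lambda>y. norm (poly (dp y) x)) \<longlongrightarrow> 0) (nhds y0)"
      using that by (intro tendsto_norm_zero) (simp add: roots_def)
    then have "\<forall>\<^sub>F y in nhds y0. norm (poly (dp y) x) < e ^ ?n"
      using assms by (intro order_tendstoD) auto
    then show ?thesis
    proof eventually_elim
      case (elim y)
      show ?case
      proof (rule ccontr)
        assume "\<not> ?thesis"
        then have "e ^ ?n \<le> norm (poly (dp y) x)" using prod_distances_le[of "dp y" e x] assms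
          by (auto simp: lead_coeff_dp[unfolded degree_dp] degree_dp roots_def not_less dist_commute)
        with elim show False
          by linarith
      qed
    qed
  qed
  then show "\<forall>\<^sub>F y in nhds y0. \<forall>x\<in>roots y0. \<exists>t\<in>roots y. dist t x < e"
    by (intro eventually_ball_finite finite_roots ballI)
qed

lemma F_zero: "F 0 = 0"
proof -
  have "f (idx k) 0 = 0" for k using f_scale[of k 0 0] degree_pos[of k] by (simp add: power_0_left)
  then show ?thesis by (simp add: vec_eq_iff)
qed

lemma F_eq_zero: "F v = 0 \<Longrightarrow> v = 0"
  using F_eq_imp_same_orbit[of 0 v] F_zero by auto

lemma scale_inverse: "s \<noteq> 0 \<Longrightarrow> scale s (scale (inverse s) z) = z"
  by (simp add: scale_def vec_eq_iff flip: power_mult_distrib)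

lemma scale_add: "scale s (x + y) = scale s x + scale s y"
  by (simp add: scale_def vec_eq_iff distrib_left)

lemma scale_axis: "scale s (axis top_idx t) = axis top_idx (s ^ d (idx top_idx) * t)"
  by (simp add: scale_def vec_eq_iff axis_def)

text \<open>On \<open>Y0\<close> the last coordinate vanishes, and all the other weights are at
  least 2.\<close>

lemma norm_scale_le:
  assumes "y \<in> Y0" "norm s \<le> 1"
  shows "norm (scale s y) \<le> norm s ^ 2 * norm y"
proof -
  have "norm (scale s y $ k) \<le> norm ((of_real (norm s ^ 2) *s y) $ k)" for k
  proof (cases "k = top_idx")
    case True
    then show ?thesis using assms(1) by (simp add: scale_def Y0_def)
  next
    case False
    then have "norm s ^ d (idx k) \<le> norm s ^ 2"
      using degree_ge_2 assms(2) by (intro power_decreasing) auto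
    then show ?thesis by (auto simp: scale_def norm_mult norm_power intro: mult_right_mono)
  qed
  then have "norm (scale s y) \<le> norm (complex_of_real (norm s ^ 2) *s y)"
    unfolding norm_vec_def by (intro L2_set_mono) auto
  then show ?thesis by (simp add: norm_vector_smult norm_power)
qed

lemma continuous_on_scale: "continuous_on S (scale s)"
  unfolding scale_def by (rule continuous_on_vec_componentwise) (auto intro!: continuous_intros)

text \<open>A relation and not a map, because the lift depends on the point chosen in the
  \<open>W\<close>-orbit over the start of the path.\<close>

definition lifted :: "(real \<Rightarrow> complex^'n) \<Rightarrow> complex^'n \<Rightarrow> complex^'n \<Rightarrow> bool" where
  "lifted \<gamma> v v' \<longleftrightarrow> (\<exists>g. continuous_on {0..1} g \<and> g ` {0..1} \<subseteq> V_reg \<and>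
     (\<forall>s\<in>{0..1}. F (g s) = \<gamma> s) \<and> g 0 = v \<and> g 1 = v')"

lemma liftedD:
  assumes "lifted \<gamma> v v'"
  shows "F v = \<gamma> 0" "F v' = \<gamma> 1"
  using assms by (auto simp: lifted_def)

text \<open>\<open>W\<close> acts on the lifts of a path. An element carrying the start of one lift
  to the start of the other carries the whole lift, by uniqueness of lifts in the covering
  \<open>F\<close>.\<close>

lemma lifted_unique:
  assumes "lifted \<gamma> v v'" "lifted \<gamma> u u'"
  shows "\<exists>w\<in>W. u = w *v v \<and> u' = w *v v'"
proof -
  obtain g where g: "continuous_on {0..1} g" "g ` {0..1} \<subseteq> V_reg" "\<And>s. s \<in> {0..1} \<Longrightarrow> F (g s) = \<gamma> s"
    "g 0 = v" "g 1 = v'"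
    using assms(1) unfolding lifted_def by blast
  obtain h where h: "continuous_on {0..1} h" "h ` {0..1} \<subseteq> V_reg" "\<And>s. s \<in> {0..1} \<Longrightarrow> F (h s) = \<gamma> s"
    "h 0 = u" "h 1 = u'"
    using assms(2) unfolding lifted_def by blast
  have "F v = F u" using liftedD assms by metis
  then obtain w where w: "w \<in> W" "u = w *v v" using F_eq_imp_same_orbit by blast
  have contw: "continuous_on A (\<lambda>x. w *v x)" for A
    by (intro linear_continuous_on bounded_linear_matrix_vector_mult)
  have "h 1 = w *v g 1"
  proof (rule covering_space_lift_unique[OF covering_F, of h "0::real" "\<lambda>s. w *v g s" "{0..1}" "\<lambda>s. F (h s)"])
    show "continuous_on {0..1} (\<lambda>s. F (h s))"
      using continuous_on_compose2[OF continuous_on_F h(1), of UNIV] by simp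
    show "(\<lambda>s. F (h s)) \<in> {0..1} \<rightarrow> Q_reg" using h(2) by (auto simp: V_reg_eq)
    show "continuous_on {0..1} (\<lambda>s. w *v g s)"
      using continuous_on_compose2[OF contw g(1), of UNIV] by simp
    show "(\<lambda>s. w *v g s) \<in> {0..1} \<rightarrow> V_reg"
      using g(2) F_invariant[OF w(1)] by (auto simp: V_reg_eq)
    show "F (h s) = F (w *v g s)" if "s \<in> {0..1}" for s
      using that g(3) h(3) F_invariant[OF w(1)] by simp
  qed (use g h w in auto)
  then show ?thesis using w g h by blast
qed

text \<open>
  Lifting the homotopy \<open>\<Gamma>\<close> matches the sheets over the line through \<open>y1\<close> with those over the line
  through \<open>y2\<close>. An invariant of the difference of matched points is a single-valued function of \<open>t\<close>;
  it is bounded near the common roots and tends to \<open>0\<close> at infinity, hence vanishes.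
\<close>

lemma eq_if_transport:
  fixes \<Gamma> :: "complex \<times> real \<Rightarrow> complex^'n"
  assumes Y: "y1 \<in> Y0" "y2 \<in> Y0" and X: "finite X"
    and cont: "continuous_on ((- X) \<times> {0..1}) \<Gamma>"
    and reg: "\<And>t s. t \<notin> X \<Longrightarrow> s \<in> {0..1} \<Longrightarrow> \<Gamma> (t, s) \<in> Q_reg"
    and ends: "\<And>t. t \<notin> X \<Longrightarrow> \<Gamma> (t, 0) = y1 + axis top_idx t" "\<And>t. t \<notin> X \<Longrightarrow> \<Gamma> (t, 1) = y2 + axis top_idx t"
    and infinity: "\<And>t s. R \<le> norm t \<Longrightarrow> s \<in> {0..1} \<Longrightarrow>
      \<Gamma> (t, s) = (1 - \<beta> s) *\<^sub>R y1 + \<beta> s *\<^sub>R y2 + axis top_idx t"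
    and \<beta>: "continuous_on {0..1} \<beta>" "\<And>s. s \<in> {0..1} \<Longrightarrow> \<beta> s \<in> {0..1}"
    and XR: "\<And>x. x \<in> X \<Longrightarrow> norm x < R"
  shows "y1 = y2"
proof -
  define lft where "lft = (\<lambda>t. lifted (\<lambda>s. \<Gamma> (t, s)))"
  \<comment> \<open>A ball times the unit interval is simply connected, so the homotopy lifts over
    it. The two ends of the lift are holomorphic branches of a matched pair.\<close>
  have local: "\<exists>v v'. (\<forall>t\<in>ball t0 r. lft t (v t) (v' t)) \<and>
      (\<forall>k. (\<lambda>t. v t $ k) holomorphic_on ball t0 r) \<and> (\<forall>k. (\<lambda>t. v' t $ k) holomorphic_on ball t0 r)"
    if ball: "ball t0 r \<subseteq> - X" "r > 0" for t0 r
  proof -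
    define U where "U = ball t0 r \<times> {0..1::real}"
    have "convex U" unfolding U_def by (intro convex_Times) auto
    have UX: "U \<subseteq> (- X) \<times> {0..1}" using ball by (auto simp: U_def)
    have "simply_connected U" "locally path_connected U"
      using \<open>convex U\<close> by (auto simp: convex_imp_simply_connected convex_imp_locally_path_connected)
    moreover have "continuous_on U \<Gamma>" using cont UX by (rule continuous_on_subset)
    moreover have "\<Gamma> \<in> U \<rightarrow> Q_reg" using UX reg by auto
    ultimately obtain L where L: "continuous_on U L" "L \<in> U \<rightarrow> V_reg" "\<And>z. z \<in> U \<Longrightarrow> F (L z) = \<Gamma> z"
      using covering_space_lift[OF covering_F] by metis
    have "lft t (L (t, 0)) (L (t, 1))" if t: "t \<in> ball t0 r" for t unfolding lft_def lifted_def
    proof (intro exI[of _ "\<lambda>s. L (t, s)"] conjI)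
      show "continuous_on {0..1} (\<lambda>s. L (t, s))"
        by (rule continuous_on_compose2[OF L(1)]) (use t in \<open>auto simp: U_def intro!: continuous_intros\<close>)
    qed (use t L in \<open>auto simp: U_def\<close>)
    moreover have "(\<lambda>t. L (t, e) $ k) holomorphic_on ball t0 r" if "e = 0 \<or> e = 1" for e k
    proof (rule holomorphic_lift[where y = "if e = 0 then y1 else y2"])
      show "continuous_on (ball t0 r) (\<lambda>t. L (t, e))"
        by (rule continuous_on_compose2[OF L(1)]) (use that in \<open>auto simp: U_def intro!: continuous_intros\<close>)
      show "L (t, e) \<in> V_reg" if "t \<in> ball t0 r" for t
        using L(2) that \<open>e = 0 \<or> e = 1\<close> by (auto simp: U_def)
      show "F (L (t, e)) = (if e = 0 then y1 else y2) + axis top_idx t" if "t \<in> ball t0 r" for t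
      proof -
        have "t \<notin> X" "(t, e) \<in> U"
          using that ball \<open>e = 0 \<or> e = 1\<close> by (auto simp: U_def)
        then show ?thesis using L(3) ends \<open>e = 0 \<or> e = 1\<close> by auto
      qed
    qed auto
    ultimately show ?thesis
      by (intro exI[of _ "\<lambda>t. L (t, 0)"] exI[of _ "\<lambda>t. L (t, 1)"]) auto
  qed
  have opX: "open (- X)" using X by (simp add: finite_imp_closed open_Compl)
  have ex: "\<exists>v v'. lft t v v'" if "t \<notin> X" for t
  proof -
    obtain r where "r > 0" "ball t r \<subseteq> - X"
      using opX \<open>t \<notin> X\<close> openE by blast
    from local[OF this(2,1)] this(1) show ?thesis
      by (meson centre_in_ball)
  qed
  \<comment> \<open>\<open>lifted_unique\<close> determines a matched pair up to a common element of
    \<open>W\<close>, so the described value is unique although the pair is not.\<close>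
  define G where "G = (\<lambda>k t. THE z. \<forall>v v'. lft t v v' \<longrightarrow> z = f (idx k) (v - v'))"
  have G: "G k t = f (idx k) (v - v')" if lf: "lft t v v'" for k t v v'
  proof -
    have unique: "f (idx k) (v - v') = f (idx k) (u - u')" if "lft t u u'" for u u'
    proof -
      obtain w where "w \<in> W" "u = w *v v" "u' = w *v v'"
        using lifted_unique lf \<open>lft t u u'\<close> unfolding lft_def by blast
      then have "F (u - u') = F (v - v')"
        using F_invariant by (simp flip: matrix_vector_mult_diff_distrib)
      then show ?thesis by (metis F_nth)
    qed
    show ?thesis unfolding G_def
    proof (rule the_equality)
      show "\<forall>u u'. lft t u u' \<longrightarrow> f (idx k) (v - v') = f (idx k) (u - u')"
        using unique by blast
    next
      fix z assume "\<forall>u u'. lft t u u' \<longrightarrow> z = f (idx k) (u - u')"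
      with lf show "z = f (idx k) (v - v')"
        by blast
    qed
  qed
  have holG: "G k holomorphic_on - X" for k unfolding holomorphic_on_open[OF opX]
  proof (intro ballI)
    fix t0 assume "t0 \<in> - X"
    then obtain r where r: "r > 0" "ball t0 r \<subseteq> - X" using opX openE by blast
    obtain v v' where v: "\<And>t. t \<in> ball t0 r \<Longrightarrow> lft t (v t) (v' t)"
      "\<And>k. (\<lambda>t. v t $ k) holomorphic_on ball t0 r" "\<And>k. (\<lambda>t. v' t $ k) holomorphic_on ball t0 r"
      using local[OF r(2,1)] by blast
    have "(\<lambda>t. f (idx k) (v t - v' t)) holomorphic_on ball t0 r"
      by (rule holomorphic_on_polynomial_functions[OF f_polynomial]) (auto intro!: holomorphic_intros v)
    then have "G k holomorphic_on ball t0 r" by (rule holomorphic_transform) (metis G v(1))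
    then show "\<exists>f'. (G k has_field_derivative f') (at t0)"
      using r(1) holomorphic_on_open[OF open_ball, of "G k" t0 r] by auto
  qed
  \<comment> \<open>Properness of \<open>F\<close> bounds all points over a bounded part of the two
    lines, uniformly up to the punctures.\<close>
  have bounded: "\<exists>C. \<forall>t. t \<notin> X \<and> norm t \<le> \<rho> \<longrightarrow> norm (G k t) \<le> C" for k \<rho>
  proof -
    obtain C1 where C1: "\<And>v. norm (F v) \<le> norm y1 + \<rho> \<Longrightarrow> norm v \<le> C1"
      using F_proper by blast
    obtain C2 where C2: "\<And>v. norm (F v) \<le> norm y2 + \<rho> \<Longrightarrow> norm v \<le> C2"
      using F_proper by blast
    have "compact (f (idx k) ` cball 0 (C1 + C2))"
      by (intro compact_continuous_image continuous_on_polynomial_functions f_polynomial compact_cball)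
    then have "bounded (f (idx k) ` cball 0 (C1 + C2))" by (rule compact_imp_bounded)
    then obtain C where "\<forall>z\<in>f (idx k) ` cball 0 (C1 + C2). norm z \<le> C"
      unfolding bounded_iff by (elim exE)
    then have C: "norm (f (idx k) x) \<le> C" if "norm x \<le> C1 + C2" for x using that by simp
    have "norm (G k t) \<le> C" if t: "t \<notin> X" "norm t \<le> \<rho>" for t
    proof -
      obtain v v' where lf: "lft t v v'" using ex t by blast
      then have "F v = y1 + axis top_idx t" "F v' = y2 + axis top_idx t"
        using liftedD[of "\<lambda>s. \<Gamma> (t, s)" v v'] ends[OF t(1)] unfolding lft_def by simp_all
      then have "norm (F v) \<le> norm y1 + \<rho>" "norm (F v') \<le> norm y2 + \<rho>"
        using t(2) norm_triangle_ineq[of y1 "axis top_idx t"] norm_triangle_ineq[of y2 "axis top_idx t"]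
        by (simp_all add: norm_axis)
      then have "norm (v - v') \<le> C1 + C2"
        using C1 C2 norm_triangle_ineq4[of v v'] by (meson add_mono order_trans)
      then show ?thesis using C[of "v - v'"] G[OF lf, of k] by simp
    qed
    then show ?thesis by blast
  qed
  \<comment> \<open>With \<open>s ^ d (idx top_idx) = t\<close>, the points \<open>z r\<close>
    obtained by scaling back lie within \<open>b / norm s ^ 2\<close> of \<open>q\<close>. The
    section \<open>g\<close> lifts them and multiplication by \<open>s\<close> gives a matched pair
    over \<open>t\<close>, whose difference is O(1/|s|).\<close>
  have lim: "(G k \<longlongrightarrow> 0) at_infinity" for k unfolding Lim_at_infinity
  proof (intro allI impI)
    fix \<epsilon> :: real assume "\<epsilon> > 0"
    obtain p where p: "F p = axis top_idx 1" using F_surj by (metis surjD)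
    then have "p \<in> V_reg" using axis_top_in_Q_reg by (simp add: V_reg_eq)
    obtain O1 g B where g: "open O1" "F p \<in> O1" "g (F p) = p" "continuous_on O1 g"
      "\<And>z. z \<in> O1 \<Longrightarrow> F (g z) = z" "(g has_derivative (\<lambda>h. B *v h)) (at (F p))"
      using local_section[OF \<open>p \<in> V_reg\<close>] by metis
    define q where "q = (axis top_idx 1 :: complex^'n)"
    obtain \<delta>1 where \<delta>1: "\<delta>1 > 0" "ball q \<delta>1 \<subseteq> O1"
      using g(1,2) p openE unfolding q_def by metis
    obtain \<delta>2 where \<delta>2: "\<delta>2 > 0" "\<And>z. norm (z - q) < \<delta>2 \<Longrightarrow> norm (g z - g q - B *v (z - q)) \<le> 1 * norm (z - q)"
      using g(6)[unfolded has_derivative_at_alt] p zero_less_one unfolding q_def by metis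
    obtain M where M: "\<And>h. norm (B *v h) \<le> M * norm h"
      using bounded_linear.bounded[OF bounded_linear_matrix_vector_mult[of B]]
      by (metis mult.commute)
    have lip: "norm (g z - g q) \<le> (M + 1) * norm (z - q)" if "norm (z - q) < \<delta>2" for z
      using \<delta>2(2)[OF that] M[of "z - q"] norm_triangle_ineq[of "g z - g q - B *v (z - q)" "B *v (z - q)"]
      by (simp add: algebra_simps)
    have "isCont (f (idx k)) 0"
      using continuous_on_polynomial_functions[OF f_polynomial, of UNIV k] by (simp add: continuous_on_eq_continuous_at)
    moreover have "f (idx k) 0 = 0" using F_zero by (metis F_nth zero_index)
    ultimately obtain \<eta> where \<eta>: "\<eta> > 0" "\<And>x. norm x < \<eta> \<Longrightarrow> norm (f (idx k) x) < \<epsilon>"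
      using \<open>\<epsilon> > 0\<close> unfolding continuous_at_eps_delta by (metis dist_0_norm dist_commute)
    define b where "b = norm y1 + norm y2"
    \<comment> \<open>One summand for each demand on \<open>norm s\<close>: being greater than 1,
      \<open>z r\<close> in the domain of \<open>g\<close>, \<open>z r\<close> in the range of the
      Lipschitz estimate, and the final difference below \<open>\<eta>\<close>.\<close>
    define S0 where "S0 = 1 + b / \<delta>1 + b / \<delta>2 + (\<bar>M\<bar> + 1) * (2 * b) / \<eta>"
    have b: "b \<ge> 0" by (simp add: b_def)
    have S0: "S0 \<ge> 1"
      unfolding S0_def using b \<delta>1(1) \<delta>2(1) \<eta>(1) by (simp add: add_nonneg_nonneg)
    show "\<exists>b. \<forall>t. b \<le> norm t \<longrightarrow> dist (G k t) 0 < \<epsilon>"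
    \<comment> \<open>The bound \<open>R\<close> puts \<open>t\<close> where the homotopy is
      explicit; the power translates \<open>norm s \<ge> S0 + 1\<close> into a condition on
      \<open>t\<close>.\<close>
    proof (intro exI[of _ "max R ((S0 + 1) ^ d (idx top_idx))"] allI impI)
      fix t :: complex assume t: "max R ((S0 + 1) ^ d (idx top_idx)) \<le> norm t"
      obtain s where s: "s ^ d (idx top_idx) = t" using exists_complex_root[OF degree_pos] .
      have "(S0 + 1) ^ d (idx top_idx) \<le> norm s ^ d (idx top_idx)"
        using t s by (simp flip: norm_power)
      then have sS: "S0 + 1 \<le> norm s"
        using power_strict_mono[of "norm s" "S0 + 1" "d (idx top_idx)"] degree_pos[of top_idx] by force
      then have s1: "norm s > 1" "s \<noteq> 0" using S0 by auto
      have tX: "t \<notin> X" using XR t by fastforce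
      define y where "y = (\<lambda>r. (1 - \<beta> r) *\<^sub>R y1 + \<beta> r *\<^sub>R y2)"
      have yY: "y r \<in> Y0" for r unfolding y_def using Y by (rule Y0_convex_combination)
      have ny: "norm (y r) \<le> b" if "r \<in> {0..1}" for r
      proof -
        have "0 \<le> \<beta> r" "\<beta> r \<le> 1" using \<beta>(2)[OF that] by auto
        then have "norm ((1 - \<beta> r) *\<^sub>R y1) \<le> 1 * norm y1" "norm (\<beta> r *\<^sub>R y2) \<le> 1 * norm y2"
          by (auto intro!: mult_left_le_one_le)
        then show ?thesis
          unfolding y_def b_def using norm_triangle_ineq[of "(1 - \<beta> r) *\<^sub>R y1" "\<beta> r *\<^sub>R y2"] by linarith
      qed
      define z where "z = (\<lambda>r. q + scale (inverse s) (y r))"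
      have zq: "norm (z r - q) \<le> b / norm s ^ 2" if "r \<in> {0..1}" for r
      proof -
        have "norm (z r - q) \<le> norm (inverse s) ^ 2 * norm (y r)"
          unfolding z_def using norm_scale_le[OF yY, of "inverse s"] s1 by (simp add: norm_inverse inverse_le_1_iff)
        also have "\<dots> \<le> norm (inverse s) ^ 2 * b"
          using ny[OF that] by (intro mult_left_mono) auto
        finally show ?thesis by (simp add: norm_inverse power_inverse divide_inverse mult.commute)
      qed
      have zs: "norm (z r - q) * norm s \<le> b / norm s" if "r \<in> {0..1}" for r
        using mult_right_mono[OF zq[OF that], of "norm s"] s1 by (simp add: power2_eq_square)
      have small: "b / norm s ^ 2 < \<delta>" if "\<delta> > 0" "b / \<delta> \<le> S0" for \<delta>
      proof -
        have "b \<le> S0 * \<delta>" using that by (simp add: field_simps)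
        also have "\<dots> < norm s * \<delta>" using sS that(1) by (intro mult_strict_right_mono) auto
        also have "\<dots> \<le> norm s ^ 2 * \<delta>"
          using s1 that(1) by (intro mult_right_mono) (auto simp: power2_eq_square)
        finally show ?thesis using s1 by (simp add: field_simps)
      qed
      have nonneg: "0 \<le> b / \<delta>1" "0 \<le> b / \<delta>2" "0 \<le> (\<bar>M\<bar> + 1) * (2 * b) / \<eta>"
        using b \<delta>1(1) \<delta>2(1) \<eta>(1) by simp_all
      have z1: "norm (z r - q) < \<delta>1" and z2: "norm (z r - q) < \<delta>2" if "r \<in> {0..1}" for r
        using zq[OF that] small[OF \<delta>1(1)] small[OF \<delta>2(1)] nonneg unfolding S0_def by linarith+
      have zO: "z r \<in> O1" if "r \<in> {0..1}" for r
        using z1[OF that] \<delta>1(2) by (auto simp: dist_norm norm_minus_commute)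
      have scz: "scale s (z r) = y r + axis top_idx t" for r
        unfolding z_def q_def scale_add scale_inverse[OF s1(2)] scale_axis by (simp add: s add.commute)
      have "lft t (s *s g (z 0)) (s *s g (z 1))" unfolding lft_def lifted_def
      proof (intro exI[of _ "\<lambda>r. s *s g (z r)"] conjI ballI)
        have conty: "continuous_on {0..1} y" unfolding y_def by (intro continuous_intros \<beta>(1))
        have "continuous_on {0..1} z" unfolding z_def
          by (intro continuous_on_add continuous_on_const continuous_on_compose2[OF continuous_on_scale[of UNIV] conty]) auto
        then have "continuous_on {0..1} (\<lambda>r. g (z r))"
          using zO by (intro continuous_on_compose2[OF g(4)]) auto
        then show "continuous_on {0..1} (\<lambda>r. s *s g (z r))"
          by (intro continuous_on_vec_componentwise) (auto intro!: continuous_intros)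
        show eq: "F (s *s g (z r)) = \<Gamma> (t, r)" if "r \<in> {0..1}" for r
          using infinity[of t r] t that unfolding F_smult g(5)[OF zO[OF that]] scz by (simp add: y_def)
        show "(\<lambda>r. s *s g (z r)) ` {0..1} \<subseteq> V_reg"
          using eq reg[OF tX] by (auto simp: V_reg_eq)
      qed auto
      then have Gt: "G k t = f (idx k) (s *s g (z 0) - s *s g (z 1))" by (rule G)
      have "norm (g (z 0) - g (z 1)) \<le> norm (g (z 0) - g q) + norm (g (z 1) - g q)"
        using norm_triangle_ineq4[of "g (z 0) - g q" "g (z 1) - g q"] by simp
      also have "\<dots> \<le> (M + 1) * norm (z 0 - q) + (M + 1) * norm (z 1 - q)"
        using lip z2 by (intro add_mono) auto
      also have "\<dots> \<le> (\<bar>M\<bar> + 1) * norm (z 0 - q) + (\<bar>M\<bar> + 1) * norm (z 1 - q)"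
        by (intro add_mono mult_right_mono) auto
      finally have "norm (g (z 0) - g (z 1)) * norm s \<le>
          ((\<bar>M\<bar> + 1) * norm (z 0 - q) + (\<bar>M\<bar> + 1) * norm (z 1 - q)) * norm s"
        by (rule mult_right_mono) auto
      also have "\<dots> = (\<bar>M\<bar> + 1) * (norm (z 0 - q) * norm s + norm (z 1 - q) * norm s)"
        by (simp add: algebra_simps)
      also have "\<dots> \<le> (\<bar>M\<bar> + 1) * (b / norm s + b / norm s)"
        by (intro mult_left_mono add_mono zs) auto
      also have "\<dots> = (\<bar>M\<bar> + 1) * (2 * b) / norm s"
        by (simp add: algebra_simps add_divide_distrib)
      also have "\<dots> < \<eta>"
      proof -
        have "(\<bar>M\<bar> + 1) * (2 * b) / \<eta> < norm s"
          using sS nonneg unfolding S0_def by linarith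
        then show ?thesis using \<eta>(1) s1 by (simp add: field_simps)
      qed
      finally have "norm (s *s g (z 0) - s *s g (z 1)) < \<eta>"
        by (simp add: norm_vector_smult mult.commute flip: vector_ssub_ldistrib)
      then show "dist (G k t) 0 < \<epsilon>" using \<eta>(2) by (simp add: Gt)
    qed
  qed
  have zero: "G k t = 0" if "t \<notin> X" for k t
  proof -
    \<comment> \<open>Boundedness makes the punctures removable; the extension is entire and tends
      to 0 at infinity, so Liouville applies.\<close>
    have "G k \<in> O[at x](\<lambda>_. 1)" if "x \<in> X" for x
    proof -
      obtain C where C: "\<And>t. t \<notin> X \<Longrightarrow> norm t \<le> norm x + 1 \<Longrightarrow> norm (G k t) \<le> C"
        using bounded[of "norm x + 1" k] by blast
      have "\<forall>\<^sub>F t in at x. t \<in> - (X - {x}) - {x}"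
        using X by (intro eventually_at_in_open open_Compl finite_imp_closed) auto
      moreover have "\<forall>\<^sub>F t in at x. t \<in> ball x 1 - {x}"
        by (rule eventually_at_in_open) auto
      ultimately have "\<forall>\<^sub>F t in at x. norm (G k t) \<le> C * norm (1 :: complex)"
      proof eventually_elim
        case (elim t)
        then have "norm t \<le> norm x + 1"
          using norm_triangle_ineq2[of t x] by (auto simp: dist_norm norm_minus_commute)
        then show ?case using C[of t] elim by auto
      qed
      then show ?thesis by (rule bigoI)
    qed
    then obtain g where g: "g holomorphic_on UNIV" "\<And>z. z \<notin> X \<Longrightarrow> g z = G k z"
      using removable_singularities[of X UNIV "G k"] X holG[of k] by (auto simp: Compl_eq_Diff_UNIV)
    have "\<forall>\<^sub>F z in at_infinity. G k z = g z"
      unfolding eventually_at_infinity using g(2) XR by (metis not_le)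
    then have "(g \<longlongrightarrow> 0) at_infinity" using lim[of k] tendsto_cong by blast
    then show ?thesis using Liouville_weak_0[OF g(1)] g(2)[OF that] by metis
  qed
  have "- X \<noteq> {}" using X finite_compl infinite_UNIV_char_0[where 'a = complex] by force
  then obtain t where t: "t \<notin> X" by blast
  obtain v v' where lf: "lft t v v'" using ex[OF t] by blast
  have "F (v - v') = 0" using zero[OF t] G[OF lf] by (simp add: vec_eq_iff)
  then have "v = v'" using F_eq_zero by fastforce
  moreover have "F v = y1 + axis top_idx t" "F v' = y2 + axis top_idx t"
    using liftedD[of "\<lambda>s. \<Gamma> (t, s)" v v'] lf ends[OF t] unfolding lft_def by simp_all
  ultimately show ?thesis by simp
qed

text \<open>On the segment from \<open>y1\<close> to \<open>y2\<close> the roots may move, but they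
  stay in small discs about the common roots. The homotopy therefore pushes \<open>t\<close>
  radially out of these discs, then moves the base point, then brings \<open>t\<close> back, without
  meeting a root.\<close>

lemma eq_if_same_roots_locally:
  assumes "y0 \<in> Y0"
  shows "\<exists>\<delta>>0. \<forall>y1\<in>Y0 \<inter> ball y0 \<delta>. \<forall>y2\<in>Y0 \<inter> ball y0 \<delta>.
    roots y1 = roots y2 \<and> card (roots y1) = card (roots y0) \<longrightarrow> y1 = y2"
proof -
  obtain e' where e': "e' > 0" "\<And>x y. x \<in> roots y0 \<Longrightarrow> y \<in> roots y0 \<Longrightarrow> x \<noteq> y \<Longrightarrow> e' \<le> dist x y"
    using finite_separated[OF finite_roots] by blast
  \<comment> \<open>An eighth of the separation over \<open>y0\<close>: roots displaced by less than
    \<open>e\<close> remain \<open>6 * e\<close> apart, so the discs of radius \<open>2 * e\<close>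
    about them are disjoint and contain every nearby root.\<close>
  define e where "e = e' / 8"
  have e: "e > 0" "\<And>x y. x \<in> roots y0 \<Longrightarrow> y \<in> roots y0 \<Longrightarrow> x \<noteq> y \<Longrightarrow> 8 * e \<le> dist x y"
    using e' by (auto simp: e_def)
  obtain \<delta> where \<delta>: "\<delta> > 0"
    "\<And>y t. y \<in> ball y0 \<delta> \<Longrightarrow> t \<in> roots y \<Longrightarrow> \<exists>x\<in>roots y0. dist t x < e"
    "\<And>y x. y \<in> ball y0 \<delta> \<Longrightarrow> x \<in> roots y0 \<Longrightarrow> \<exists>t\<in>roots y. dist t x < e"
    using roots_continuity[OF e(1), of y0] unfolding eventually_nhds_metric
    by (metis dist_commute mem_ball)
  have "y1 = y2" if y1: "y1 \<in> Y0" "y1 \<in> ball y0 \<delta>" and y2: "y2 \<in> Y0" "y2 \<in> ball y0 \<delta>"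
    and eq: "roots y1 = roots y2" "card (roots y1) = card (roots y0)" for y1 y2
  proof -
    define X where "X = roots y1"
    have X: "finite X" "X = roots y1" "X = roots y2" using eq by (simp_all add: X_def finite_roots)
    \<comment> \<open>Each root over \<open>y0\<close> has a root of \<open>X\<close> close to it.
      Equality of the cardinalities makes this a bijection, so no further points of \<open>X\<close>
      exist.\<close>
    obtain m where m: "\<And>x. x \<in> roots y0 \<Longrightarrow> m x \<in> X \<and> dist (m x) x < e"
      using \<delta>(3)[OF y1(2)] unfolding X_def by metis
    have far: "6 * e \<le> dist (m x) (m x')" if "x \<in> roots y0" "x' \<in> roots y0" "x \<noteq> x'" for x x'
    proof -
      have "dist x x' \<le> dist x (m x) + dist (m x) (m x') + dist (m x') x'"
        by (metis add.commute add_left_mono dist_triangle order_trans)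
      then show ?thesis using e(2)[OF that] m[OF that(1)] m[OF that(2)] by (simp add: dist_commute)
    qed
    have "inj_on m (roots y0)" using far e(1) by (intro inj_onI) fastforce
    then have "card (m ` roots y0) = card X" using eq(2) by (simp add: card_image X_def)
    then have mX: "m ` roots y0 = X" using m X(1) by (intro card_subset_eq) auto
    have sepX: "6 * e \<le> dist t t'" if "t \<in> X" "t' \<in> X" "t \<noteq> t'" for t t'
      using that far unfolding mX[symmetric] by blast
    have away: "t \<notin> roots y" if y: "y \<in> ball y0 \<delta>" and t: "\<And>x. x \<in> X \<Longrightarrow> 2 * e \<le> dist t x" for t y
    proof
      assume "t \<in> roots y"
      then obtain x where x: "x \<in> roots y0" "dist t x < e" using \<delta>(2) y by blast
      then show False using m[OF x(1)] t[of "m x"] dist_triangle2[of t "m x" x] by linarith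
    qed
    \<comment> \<open>Radial retraction of the complement of \<open>X\<close> onto the complement of
      the open discs of radius \<open>2 * e\<close>. Within one disc the factor changes
      \<open>norm (t - x)\<close> to \<open>2 * e\<close>, and all other summands vanish. The sum
      with \<open>max\<close> is visibly continuous off \<open>X\<close>.\<close>
    define \<rho> where "\<rho> = (\<lambda>t. t + (\<Sum>x\<in>X. of_real (max 0 (2 * e / norm (t - x) - 1)) * (t - x)))"
    have term0: "max 0 (2 * e / norm (t - x) - 1) = 0" if "2 * e \<le> dist t x" for t x :: complex
    proof -
      have "dist t x > 0" using that e(1) by linarith
      then have "2 * e / norm (t - x) \<le> 1" using that by (simp add: dist_norm)
      then show ?thesis by simp
    qed
    have \<rho>_far: "\<rho> t = t" if "\<And>x. x \<in> X \<Longrightarrow> 2 * e \<le> dist t x" for t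
      unfolding \<rho>_def using that term0 by simp
    have \<rho>_near: "\<rho> t = x + of_real (2 * e / norm (t - x)) * (t - x)"
      if "x \<in> X" "dist t x < 2 * e" "t \<noteq> x" for t x
    proof -
      have other: "2 * e \<le> dist t x'" if "x' \<in> X - {x}" for x'
        using sepX[of x x'] that \<open>x \<in> X\<close> \<open>dist t x < 2 * e\<close> dist_triangle3[of x x' t] e(1) by auto
      have "(\<Sum>x\<in>X. of_real (max 0 (2 * e / norm (t - x) - 1)) * (t - x)) =
          of_real (max 0 (2 * e / norm (t - x) - 1)) * (t - x)"
        using X(1) that(1) term0[OF other] by (subst sum.remove[of _ x]) (auto intro!: sum.neutral)
      then have "\<rho> t = t + of_real (max 0 (2 * e / norm (t - x) - 1)) * (t - x)"
        by (simp only: \<rho>_def)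
      also have "max 0 (2 * e / norm (t - x) - 1) = 2 * e / norm (t - x) - 1"
        using that(2,3) by (simp add: dist_norm field_simps)
      also have "t + of_real (q - 1) * (t - x) = x + of_real q * (t - x)" for q :: real
        by (simp add: algebra_simps)
      finally show ?thesis .
    qed
    have \<rho>_dist: "2 * e \<le> dist (\<rho> t) x'" and \<rho>_segment: "t + of_real r * (\<rho> t - t) \<notin> X"
      if t: "t \<notin> X" and r: "0 \<le> r" "r \<le> 1" and x': "x' \<in> X" for t r x'
    proof -
      have "2 * e \<le> dist (\<rho> t) x' \<and> t + of_real r * (\<rho> t - t) \<notin> X"
      proof (cases "\<exists>x\<in>X. dist t x < 2 * e")
        case False
        then have "2 * e \<le> dist t x" if "x \<in> X" for x using that by (meson not_le)
        with \<rho>_far[of t] show ?thesis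
          using t x' by simp
      next
        case True
        then obtain x where x: "x \<in> X" "dist t x < 2 * e" by blast
        then have "t \<noteq> x" using t by blast
        note \<rho>t = \<rho>_near[OF x this]
        have nt: "norm (t - x) > 0" using \<open>t \<noteq> x\<close> by simp
        have d: "dist (\<rho> t) x = 2 * e"
          using nt e(1) by (simp add: \<rho>t dist_norm norm_mult norm_divide)
        have "2 * e \<le> dist (\<rho> t) x'"
          using d sepX[of x x'] x(1) x' e(1) dist_triangle3[of x x' "\<rho> t"] by (cases "x = x'") auto
        moreover have "t + of_real r * (\<rho> t - t) \<notin> X"
        proof
          \<comment> \<open>The radial stretching factor at time \<open>r\<close>. It lies between 1
            and \<open>2 * e / norm (t - x)\<close>, so the point neither reaches the centre
            \<open>x\<close> nor leaves the closed disc.\<close>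
          define q where "q = 1 + r * (2 * e / norm (t - x) - 1)"
          define u where "u = t + of_real r * (\<rho> t - t)"
          assume "t + of_real r * (\<rho> t - t) \<in> X"
          then have uX: "u \<in> X" by (simp add: u_def)
          have ux: "u - x = of_real q * (t - x)" by (simp add: u_def q_def \<rho>t algebra_simps)
          have ge: "2 * e / norm (t - x) - 1 \<ge> 0" using x(2) nt by (simp add: dist_norm field_simps)
          then have "q \<ge> 1" using r(1) by (simp add: q_def)
          then have "u \<noteq> x" using ux \<open>t \<noteq> x\<close> by auto
          then have "6 * e \<le> dist u x" using sepX uX x(1) by blast
          moreover have "q \<le> 2 * e / norm (t - x)"
            using mult_right_mono[OF r(2) ge] by (simp add: q_def)
          then have "q * norm (t - x) \<le> 2 * e" using nt by (simp add: field_simps)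
          then have "dist u x \<le> 2 * e"
            using \<open>q \<ge> 1\<close> by (simp add: dist_norm ux norm_mult)
          ultimately show False using e(1) by linarith
        qed
        ultimately show ?thesis by blast
      qed
      then show "2 * e \<le> dist (\<rho> t) x'" "t + of_real r * (\<rho> t - t) \<notin> X" by auto
    qed
    \<comment> \<open>The interval is divided in thirds: \<open>\<alpha>'\<close> rises to 1, stays
      there and falls back, while \<open>\<beta>\<close> moves from 0 to 1 on the middle third
      only.\<close>
    define \<alpha>' where "\<alpha>' = (\<lambda>s::real. max 0 (min 1 (min (3 * s) (3 - 3 * s))))"
    define \<beta> where "\<beta> = (\<lambda>s::real. max 0 (min 1 (3 * s - 1)))"
    have \<alpha>': "0 \<le> \<alpha>' s" "\<alpha>' s \<le> 1" for s by (auto simp: \<alpha>'_def)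
    have \<beta>: "0 \<le> \<beta> s" "\<beta> s \<le> 1" for s by (auto simp: \<beta>_def)
    have phases: "\<beta> s = 0 \<or> \<beta> s = 1 \<or> \<alpha>' s = 1" for s
      by (auto simp: \<alpha>'_def \<beta>_def max_def min_def)
    define \<Gamma> where "\<Gamma> = (\<lambda>(t, s). (1 - \<beta> s) *\<^sub>R y1 + \<beta> s *\<^sub>R y2 +
        axis top_idx (t + of_real (\<alpha>' s) * (\<rho> t - t)) :: complex^'n)"
    obtain R where R: "\<And>x. x \<in> X \<Longrightarrow> norm x < R"
      using finite_imp_bounded[OF X(1)] unfolding bounded_pos_less by blast
    show "y1 = y2"
    \<comment> \<open>Beyond \<open>R + 2 * e\<close> the retraction is the identity, so only the
      base point moves there.\<close>
    proof (rule eq_if_transport[OF y1(1) y2(1) X(1), of \<Gamma> "R + 2 * e" \<beta>])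
      have cont\<rho>: "continuous_on (- X) \<rho>"
        unfolding \<rho>_def by (intro continuous_intros) auto
      have "continuous_on ((- X) \<times> {0..1}) (\<lambda>z. \<rho> (fst z))"
        by (rule continuous_on_compose2[OF cont\<rho>]) (auto intro!: continuous_intros)
      then have "continuous_on ((- X) \<times> {0..1}) (\<lambda>z. fst z + of_real (\<alpha>' (snd z)) * (\<rho> (fst z) - fst z))"
        unfolding \<alpha>'_def by (intro continuous_intros)
      then have "continuous_on ((- X) \<times> {0..1})
          (\<lambda>z. axis top_idx (fst z + of_real (\<alpha>' (snd z)) * (\<rho> (fst z) - fst z)) :: complex^'n)"
        by (intro continuous_on_vec_componentwise, rename_tac k, case_tac "k = top_idx") (simp_all add: axis_def)
      then show "continuous_on ((- X) \<times> {0..1}) \<Gamma>"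
        unfolding \<Gamma>_def case_prod_beta \<beta>_def by (intro continuous_intros)
      show "\<Gamma> (t, s) \<in> Q_reg" if t: "t \<notin> X" and s: "s \<in> {0..1}" for t s
      proof -
        define y where "y = (1 - \<beta> s) *\<^sub>R y1 + \<beta> s *\<^sub>R y2"
        define u where "u = t + of_real (\<alpha>' s) * (\<rho> t - t)"
        have yY: "y \<in> Y0" unfolding y_def using y1(1) y2(1) by (rule Y0_convex_combination)
        have "y \<in> ball y0 \<delta>"
          using convex_ball[of y0 \<delta>] y1(2) y2(2) \<beta>[of s] unfolding y_def convex_alt by blast
        have seg: "u \<notin> X" unfolding u_def using \<rho>_segment[OF t \<alpha>'[of s]] t by blast
        have "u \<notin> roots y" using phases[of s]
        proof (elim disjE)
          assume "\<beta> s = 0"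
          then show ?thesis using seg X(2) by (simp add: y_def)
        next
          assume "\<beta> s = 1"
          then show ?thesis using seg X(3) by (simp add: y_def)
        next
          assume "\<alpha>' s = 1"
          then have "u = \<rho> t" by (simp add: u_def)
          then show ?thesis
            using away[OF \<open>y \<in> ball y0 \<delta>\<close>] \<rho>_dist[OF t, of 0] by simp
        qed
        then show ?thesis
          unfolding add_axis_in_Q_reg[OF yY, symmetric] by (simp add: \<Gamma>_def y_def u_def)
      qed
      show "\<Gamma> (t, 0) = y1 + axis top_idx t" "\<Gamma> (t, 1) = y2 + axis top_idx t" for t
        by (simp_all add: \<Gamma>_def \<alpha>'_def \<beta>_def)
      show "continuous_on {0..1} \<beta>" unfolding \<beta>_def by (intro continuous_intros)
      show "\<beta> s \<in> {0..1}" for s using \<beta> by simp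
      show "norm x < R + 2 * e" if "x \<in> X" for x using R[OF that] e(1) by linarith
      show "\<Gamma> (t, s) = (1 - \<beta> s) *\<^sub>R y1 + \<beta> s *\<^sub>R y2 + axis top_idx t"
        if "R + 2 * e \<le> norm t" for t s
      proof -
        have "2 * e \<le> dist t x" if "x \<in> X" for x
          using R[OF that] \<open>R + 2 * e \<le> norm t\<close> norm_triangle_ineq2[of t x] by (simp add: dist_norm)
        then show ?thesis using \<rho>_far[of t] by (simp add: \<Gamma>_def)
      qed
    qed
  qed
  then show ?thesis using \<delta>(1) by blast
qed

section \<open>Finiteness of the Lyashko--Looijenga morphism\<close>

lemma roots_nonempty: "roots y \<noteq> {}"
proof -
  have "\<not> constant (poly (dp y))"
    using degree_dp[of y] constant_degree by (metis zero_less_card_finite less_irrefl)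
  then show ?thesis
    using Fundamental_Theorem_Algebra.fundamental_theorem_of_algebra by (auto simp: roots_def)
qed

lemma scale_in_Y0: "y \<in> Y0 \<Longrightarrow> scale s y \<in> Y0"
  by (simp add: Y0_def scale_def)

lemma roots_scale:
  assumes "y \<in> Y0" "s \<noteq> 0"
  shows "s ^ d (idx top_idx) * t \<in> roots (scale s y) \<longleftrightarrow> t \<in> roots y"
proof -
  have "scale s y + axis top_idx (s ^ d (idx top_idx) * t) = scale s (y + axis top_idx t)"
    by (simp add: scale_add scale_axis)
  then have "poly (dp (scale s y)) (s ^ d (idx top_idx) * t) = s ^ disc_degree * poly (dp y) t"
    using P_axis_eq[OF scale_in_Y0[OF assms(1)]] P_axis_eq[OF assms(1)] P_scale by metis
  then show ?thesis using assms(2) by (simp add: roots_def)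
qed

lemma roots_scale_eq:
  assumes "y \<in> Y0" "s \<noteq> 0"
  shows "roots (scale s y) = (\<lambda>t. s ^ d (idx top_idx) * t) ` roots y"
proof (intro subset_antisym subsetI)
  fix t assume "t \<in> roots (scale s y)"
  moreover have "t = s ^ d (idx top_idx) * (t / s ^ d (idx top_idx))" using assms(2) by simp
  ultimately show "t \<in> (\<lambda>t. s ^ d (idx top_idx) * t) ` roots y"
    using roots_scale[OF assms] by (metis imageI)
qed (use roots_scale[OF assms] in auto)

lemma roots_zero: "roots 0 = {0}"
proof -
  have "t = 0" if "t \<in> roots 0" for t
  proof (rule ccontr)
    assume "t \<noteq> 0"
    obtain s where s: "s ^ d (idx top_idx) = t" using exists_complex_root[OF degree_pos] .
    then have "s \<noteq> 0" using \<open>t \<noteq> 0\<close> degree_pos[of top_idx] by auto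
    have "0 \<in> Y0" by (simp add: Y0_def)
    have "P (scale s (axis top_idx 1)) = 0"
      using that P_axis_eq[OF \<open>0 \<in> Y0\<close>, of t] by (simp add: scale_axis s roots_def)
    then show False using P_scale \<open>s \<noteq> 0\<close> axis_top_in_Q_reg by (simp add: Q_reg_def)
  qed
  then show ?thesis using roots_nonempty by blast
qed

text \<open>Scaling shrinks \<open>y\<close> into the neighbourhood of 0 on which equal roots force
  equality, and it keeps the root set \<open>{0}\<close>.\<close>

lemma eq_zero_if_roots_zero:
  assumes "y \<in> Y0" "roots y = {0}"
  shows "y = 0"
proof -
  have zero: "0 \<in> Y0" by (simp add: Y0_def)
  obtain \<delta> where \<delta>: "\<delta> > 0"
    "\<And>y1 y2. y1 \<in> Y0 \<inter> ball 0 \<delta> \<Longrightarrow> y2 \<in> Y0 \<inter> ball 0 \<delta> \<Longrightarrow> roots y1 = roots y2 \<Longrightarrow>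
      card (roots y1) = card (roots 0) \<Longrightarrow> y1 = y2"
    using eq_if_same_roots_locally[OF zero] by blast
  define r where "r = min 1 (\<delta> / (2 * (norm y + 1)))"
  define s where "s = complex_of_real r"
  have r: "r > 0" "r \<le> 1" "r * (norm y + 1) < \<delta>"
  proof -
    show "r > 0" "r \<le> 1" using \<delta>(1) by (auto simp: r_def add_nonneg_pos)
    have "r * (norm y + 1) \<le> \<delta> / (2 * (norm y + 1)) * (norm y + 1)"
      by (intro mult_right_mono) (auto simp: r_def)
    also have "\<dots> = \<delta> / 2" by (simp add: field_simps add_nonneg_eq_0_iff)
    finally show "r * (norm y + 1) < \<delta>" using \<delta>(1) by linarith
  qed
  have "norm (scale s y) \<le> r ^ 2 * norm y"
    using norm_scale_le[OF assms(1), of s] r by (simp add: s_def)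
  also have "\<dots> \<le> r * (norm y + 1)"
    using r(1,2) by (intro mult_mono) (auto simp: power2_eq_square mult_left_le_one_le)
  finally have "scale s y \<in> ball 0 \<delta>" using r(3) by simp
  moreover have "s \<noteq> 0" using r(1) by (simp add: s_def)
  then have "roots (scale s y) = roots 0"
    using roots_scale_eq[OF assms(1)] assms(2) by (simp add: roots_zero)
  ultimately have "scale s y = 0" using \<delta> zero scale_in_Y0[OF assms(1)] by auto
  then show ?thesis using \<open>s \<noteq> 0\<close> by (simp add: scale_def vec_eq_iff)
qed

lemma closed_Y0: "closed Y0"
proof -
  have "Y0 = (\<lambda>y. y $ top_idx) -` {0}" by (auto simp: Y0_def)
  then show ?thesis by (simp add: continuous_closed_vimage continuous_intros)
qed

text \<open>Otherwise unit vectors whose roots all tend to 0 accumulate at a unit vector with 0 as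
  its only root.\<close>

lemma large_root_on_sphere: "\<exists>\<epsilon>>0. \<forall>u\<in>Y0 \<inter> sphere 0 1. \<exists>t\<in>roots u. \<epsilon> \<le> norm t"
proof (rule ccontr)
  assume "\<not> ?thesis"
  then have "\<forall>\<epsilon>>0. \<exists>u. u \<in> Y0 \<inter> sphere 0 1 \<and> (\<forall>t\<in>roots u. norm t < \<epsilon>)"
    by (meson not_le)
  then have "\<forall>j::nat. \<exists>u. u \<in> Y0 \<inter> sphere 0 1 \<and> (\<forall>t\<in>roots u. norm t < inverse (real (Suc j)))"
    by (metis inverse_positive_iff_positive of_nat_0_less_iff zero_less_Suc)
  then obtain u where u: "\<And>j. u j \<in> Y0 \<inter> sphere 0 1" "\<And>j t. t \<in> roots (u j) \<Longrightarrow> norm t < inverse (real (Suc j))"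
    by metis
  have "compact (Y0 \<inter> sphere 0 1)" using closed_Y0 by (simp add: closed_Int_compact)
  then obtain l r where l: "l \<in> Y0 \<inter> sphere 0 1" "strict_mono r" "(u \<circ> r) \<longlonglongrightarrow> l"
    using u(1) unfolding compact_def by metis
  have "x = 0" if "x \<in> roots l" for x
  proof (rule ccontr)
    assume "x \<noteq> 0"
    then have pos: "norm x / 2 > 0" by simp
    have "\<forall>\<^sub>F j in sequentially. \<exists>t\<in>roots ((u \<circ> r) j). dist t x < norm x / 2"
      using eventually_compose_filterlim[OF roots_continuity[OF pos, of l] l(3)[unfolded filterlim_def[symmetric]]] that
      by (auto elim: eventually_mono)
    moreover have "(\<lambda>j. inverse (real (Suc (r j)))) \<longlonglongrightarrow> 0"
      using LIMSEQ_subseq_LIMSEQ[OF LIMSEQ_inverse_real_of_nat l(2)] by (simp add: comp_def)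
    then have "\<forall>\<^sub>F j in sequentially. inverse (real (Suc (r j))) < norm x / 2"
      using pos by (rule order_tendstoD)
    ultimately have "\<forall>\<^sub>F j in sequentially. False"
    proof eventually_elim
      case (elim j)
      then obtain t where t: "t \<in> roots (u (r j))" "dist t x < norm x / 2" by auto
      have "norm x \<le> norm t + dist t x"
        using norm_triangle_ineq2[of x t] by (simp add: dist_norm norm_minus_commute)
      then show ?case using u(2)[OF t(1)] t(2) elim by linarith
    qed
    then show False by simp
  qed
  then have "roots l = {0}" using roots_nonempty[of l] by blast
  then have "l = 0" using eq_zero_if_roots_zero l(1) by blast
  then show False using l(1) by simp
qed

text \<open>Properness of LL: scaling by a factor \<open>r\<close> brings a large \<open>y\<close>
  to the unit sphere, where some root has norm at least \<open>\<epsilon>\<close>. The bound on the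
  roots of \<open>y\<close> then keeps \<open>r\<close> away from 0.\<close>

lemma bounded_if_bounded_roots: "\<exists>C. \<forall>y\<in>Y0. (\<forall>t\<in>roots y. norm t \<le> B) \<longrightarrow> norm y \<le> C"
proof -
  obtain \<epsilon> where \<epsilon>: "\<epsilon> > 0" "\<And>u. u \<in> Y0 \<Longrightarrow> norm u = 1 \<Longrightarrow> \<exists>t\<in>roots u. \<epsilon> \<le> norm t"
    using large_root_on_sphere by auto
  define M where "M = (\<Sum>k\<in>UNIV. d (idx k))"
  define B' where "B' = max B 1"
  \<comment> \<open>\<open>M\<close> dominates every weight, and the base at least 1 makes the
    powers monotone. The factor \<open>CARD('n)\<close> comes from summing over the
    coordinates.\<close>
  define C where "C = max 1 (real CARD('n) * (max 1 (B' / \<epsilon>)) ^ M)"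
  have "norm y \<le> C" if y: "y \<in> Y0" "\<forall>t\<in>roots y. norm t \<le> B" for y
  proof (cases "norm y \<le> 1")
    case True
    then show ?thesis by (simp add: C_def)
  next
    case False
    \<comment> \<open>The weights differ, so the factor leading to the unit sphere has no closed
      formula; it is found by the intermediate value theorem.\<close>
    define \<phi> where "\<phi> = (\<lambda>r::real. norm (scale (of_real r) y))"
    have "continuous_on {0..1} (\<lambda>r::real. scale (of_real r) y)"
      unfolding scale_def by (rule continuous_on_vec_componentwise) (auto intro!: continuous_intros)
    then have "continuous_on {0..1} \<phi>" unfolding \<phi>_def by (rule continuous_on_norm)
    moreover have "\<phi> 0 \<le> 1" "1 \<le> \<phi> 1"
      using norm_scale_le[OF y(1), of 0] False by (auto simp: \<phi>_def) (simp add: scale_def)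
    ultimately obtain r where r: "0 \<le> r" "r \<le> 1" "\<phi> r = 1"
      using IVT'[of \<phi> 0 1 1] by auto
    have "r \<noteq> 0" using r(3) norm_scale_le[OF y(1), of 0] by (auto simp: \<phi>_def)
    then have r0: "r > 0" using r(1) by simp
    define s where "s = complex_of_real r"
    have s: "s \<noteq> 0" "norm (scale s y) = 1" using r0 r(3) by (simp_all add: s_def \<phi>_def)
    obtain t where "t \<in> roots (scale s y)" "\<epsilon> \<le> norm t"
      using \<epsilon>(2)[OF scale_in_Y0[OF y(1)] s(2)] by blast
    then obtain t' where t': "t' \<in> roots y" "\<epsilon> \<le> norm (s ^ d (idx top_idx) * t')"
      using roots_scale_eq[OF y(1) s(1)] by auto
    have "norm (s ^ d (idx top_idx) * t') \<le> r * B'" unfolding norm_mult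
    proof (rule mult_mono)
      have "r ^ d (idx top_idx) \<le> r ^ 1"
        using r degree_pos[of top_idx] by (intro power_decreasing) auto
      then show "norm (s ^ d (idx top_idx)) \<le> r" using r by (simp add: s_def norm_power)
      show "norm t' \<le> B'" using y(2) t'(1) by (auto simp: B'_def)
    qed (use r in auto)
    then have "\<epsilon> \<le> r * B'" using t'(2) by linarith
    then have inv: "inverse r \<le> max 1 (B' / \<epsilon>)"
      using r0 \<epsilon>(1) by (simp add: field_simps le_max_iff_disj)
    have "norm (y $ k) \<le> max 1 (B' / \<epsilon>) ^ M" for k
    proof -
      have "norm (scale s y $ k) \<le> 1"
        using Finite_Cartesian_Product.norm_nth_le[of "scale s y" k] s(2) by simp
      then have "r ^ d (idx k) * norm (y $ k) \<le> 1"
        using r by (simp add: scale_def s_def norm_mult norm_power)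
      then have "norm (y $ k) \<le> inverse r ^ d (idx k)"
        using r0 by (simp add: field_simps power_inverse)
      also have "\<dots> \<le> max 1 (B' / \<epsilon>) ^ d (idx k)"
        using inv r0 by (intro power_mono) auto
      also have "\<dots> \<le> max 1 (B' / \<epsilon>) ^ M"
        unfolding M_def by (intro power_increasing member_le_sum) auto
      finally show ?thesis .
    qed
    then have "(\<Sum>k\<in>UNIV. norm (y $ k)) \<le> (\<Sum>k::'n\<in>UNIV. max 1 (B' / \<epsilon>) ^ M)"
      by (intro sum_mono)
    moreover have "norm y \<le> (\<Sum>k\<in>UNIV. norm (y $ k))"
      unfolding norm_vec_def by (rule L2_set_le_sum) auto
    ultimately show ?thesis by (simp add: C_def)
  qed
  then show ?thesis by blast
qed

end

section \<open>Configurations and their strata\<close>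

lemma centered_subspace: "vec.subspace centered"
  unfolding vec.subspace_def centered_def by (auto simp: sum.distrib simp flip: sum_distrib_left)

lemma closed_centered: "closed (centered :: (complex^'n) set)"
proof -
  have eq: "centered = (\<lambda>x::complex^'n. \<Sum>i\<in>UNIV. x $ i) -` {0}"
    by (auto simp: centered_def)
  show ?thesis unfolding eq by (intro closed_vimage closed_singleton continuous_intros)
qed

lemma set_points_config_of: "x \<in> centered \<Longrightarrow> set_mset (points (config_of x)) = range (($) x)"
  by (simp add: points_config_of)

lemma count_points_config_of:
  "x \<in> centered \<Longrightarrow> count (points (config_of x)) t = card {i. x $ i = t}"
  by (simp add: points_config_of count_image_mset' Int_def vimage_def eq_commute conj_commute)

lemma config_of_eq_imp_permuted:
  fixes x y :: "complex^'n"
  assumes "x \<in> centered" "y \<in> centered" "config_of x = config_of y"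
  obtains p where "p permutes UNIV" "x = (\<chi> i. y $ p i)"
proof -
  have "image_mset (\<lambda>i. x $ i) (mset_set UNIV) = image_mset (\<lambda>i. y $ i) (mset_set UNIV)"
    using assms points_config_of by metis
  then obtain p where "p permutes (UNIV :: 'n set)" "\<forall>i\<in>UNIV. x $ i = y $ p i"
    using image_mset_eq_implies_permutes[of "UNIV :: 'n set" "($) x" "($) y"] by auto
  then show thesis using that by (simp add: vec_eq_iff)
qed

lemma config_of_permute:
  fixes x :: "complex^'n"
  assumes "p permutes UNIV" "x \<in> centered"
  shows "(\<chi> i. x $ p i) \<in> centered" "config_of (\<chi> i. x $ p i) = config_of x"
proof -
  have "(\<Sum>i\<in>UNIV. x $ p i) = (\<Sum>i\<in>UNIV. x $ i)"
    using sum.permute[OF assms(1), of "($) x"] by (simp add: comp_def)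
  then show "(\<chi> i. x $ p i) \<in> centered" using assms(2) by (simp add: centered_def)
  have "image_mset (\<lambda>i. x $ p i) (mset_set UNIV) = image_mset (($) x) (image_mset p (mset_set UNIV))"
    by (simp add: multiset.map_comp comp_def)
  also have "image_mset p (mset_set UNIV) = mset_set UNIV"
    using permutes_inj[OF assms(1)] permutes_image[OF assms(1)] by (simp add: image_mset_mset_set)
  finally show "config_of (\<chi> i. x $ p i) = config_of x" by (simp add: config_of_def)
qed

lemma continuous_on_config_of: "continuous_on centered config_of"
  unfolding continuous_on_open_gen[of config_of centered UNIV, simplified] continuous_openin_preimage_eq
  by (auto simp: open_config_def Int_def vimage_def)

text \<open>The preimage of the image of \<open>Q\<close> is the union of the finitely many permuted
  copies of \<open>Q\<close>, all relatively open.\<close>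

lemma open_config_of_image:
  fixes Q :: "(complex^'n) set"
  assumes "openin (top_of_set centered) Q"
  shows "open (config_of ` Q)"
proof -
  define S where "S = (\<lambda>p. centered \<inter> (\<lambda>x::complex^'n. \<chi> i. x $ p i) -` Q) ` {p. p permutes UNIV}"
  have "Q \<subseteq> centered" using assms openin_imp_subset by blast
  have "{x \<in> centered. config_of x \<in> config_of ` Q} = \<Union>S"
  proof (intro subset_antisym subsetI)
    fix x assume "x \<in> {x \<in> centered. config_of x \<in> config_of ` Q}"
    then obtain y where y: "x \<in> centered" "y \<in> Q" "config_of y = config_of x" by auto
    then obtain p where "p permutes UNIV" "y = (\<chi> i. x $ p i)"
      using config_of_eq_imp_permuted \<open>Q \<subseteq> centered\<close> by blast
    then show "x \<in> \<Union>S" using y by (auto simp: S_def)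
  next
    fix x assume "x \<in> \<Union>S"
    then obtain p where p: "p permutes UNIV" "x \<in> centered" "(\<chi> i. x $ p i) \<in> Q"
      by (auto simp: S_def)
    then have "config_of x \<in> config_of ` Q" using config_of_permute(2)[OF p(1,2)] by (metis imageI)
    then show "x \<in> {x \<in> centered. config_of x \<in> config_of ` Q}" using p(2) by blast
  qed
  moreover have "openin (top_of_set centered) (\<Union>S)"
  proof (rule openin_Union)
    fix A assume "A \<in> S"
    then obtain p where p: "p permutes UNIV" "A = centered \<inter> (\<lambda>x::complex^'n. \<chi> i. x $ p i) -` Q"
      by (auto simp: S_def)
    have "continuous_on centered (\<lambda>x::complex^'n. \<chi> i. x $ p i)"
      by (intro continuous_intros)
    then show "openin (top_of_set centered) A" unfolding p(2) using assms config_of_permute(1)[OF p(1)]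
      by (intro continuous_openin_preimage) auto
  qed
  ultimately show ?thesis by (simp add: open_config_def)
qed

lemma closed_config_iff: "closed K \<longleftrightarrow> closed {x \<in> centered. config_of x \<in> K}" for K :: "'n::finite config set"
proof -
  have "closed K \<longleftrightarrow> openin (top_of_set centered) {x \<in> centered. config_of x \<in> - K}"
    by (simp add: closed_def open_config_def)
  also have "{x \<in> centered. config_of x \<in> - K} = centered - {x \<in> centered. config_of x \<in> K}"
    by auto
  also have "openin (top_of_set centered) \<dots> \<longleftrightarrow> closedin (top_of_set centered) {x \<in> centered. config_of x \<in> K}"
    by (auto simp: closedin_def)
  also have "\<dots> \<longleftrightarrow> closed {x \<in> centered. config_of x \<in> K}"
    using closed_centered closedin_closed_eq[of centered] by auto
  finally show ?thesis .
qed

lemma size_multiplicities: "x \<in> centered \<Longrightarrow> size (multiplicities (config_of x)) = card (range (($) x))"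
  by (simp add: multiplicities_def set_points_config_of)

lemma ex_coarsening:
  assumes "\<And>i j. x $ i = x $ j \<Longrightarrow> y $ i = y $ j"
  obtains h where "\<And>i. h (x $ i) = y $ i"
proof
  show "y $ (SOME j. x $ j = x $ i) = y $ i" for i using assms by (metis (mono_tags, lifting) someI)
qed

lemma multiplicities_eq_if_same_partition:
  fixes x y :: "complex^'n"
  assumes "x \<in> centered" "y \<in> centered" and same: "\<And>i j. x $ i = x $ j \<longleftrightarrow> y $ i = y $ j"
  shows "multiplicities (config_of x) = multiplicities (config_of y)"
proof -
  obtain h where h: "\<And>i. h (x $ i) = y $ i" using ex_coarsening[of x y] same by blast
  have "inj_on h (range (($) x))" using h same by (auto simp: inj_on_def)
  moreover have "h ` range (($) x) = range (($) y)" using h by (auto simp: image_image)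
  ultimately have "mset_set (range (($) y)) = image_mset h (mset_set (range (($) x)))"
    by (metis image_mset_mset_set)
  moreover have "count (points (config_of y)) (h t) = count (points (config_of x)) t" if "t \<in> range (($) x)" for t
    using that assms h by (auto simp: count_points_config_of)
  ultimately have "image_mset (count (points (config_of y))) (mset_set (range (($) y))) =
      image_mset (count (points (config_of x))) (mset_set (range (($) x)))"
    by (simp add: multiset.map_comp comp_def) (intro image_mset_cong, simp)
  then show ?thesis using assms(1,2) by (simp add: multiplicities_def set_points_config_of)
qed

text \<open>The coarsening map is onto between finite sets of values of equal size, hence
  injective.\<close>

lemma same_partition_if_card_eq:
  fixes x y :: "complex^'n"
  assumes coarser: "\<And>i j. x $ i = x $ j \<Longrightarrow> y $ i = y $ j" and "card (range (($) x)) = card (range (($) y))"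
    and "y $ i = y $ j"
  shows "x $ i = x $ j"
proof -
  obtain h where h: "\<And>i. h (x $ i) = y $ i" using ex_coarsening[of x y] coarser by blast
  then have "h ` range (($) x) = range (($) y)" by (auto simp: image_image)
  then have "inj_on h (range (($) x))" using assms(2) by (intro eq_card_imp_inj_on) auto
  then show ?thesis using h assms(3) by (metis inj_on_eq_iff rangeI)
qed

lemma bij_betw_if_image_mset_eq:
  assumes "finite A" "finite B" and eq: "image_mset f (mset_set A) = image_mset g (mset_set B)"
  obtains b where "bij_betw b A B" "\<And>x. x \<in> A \<Longrightarrow> g (b x) = f x"
proof -
  have "card A = card B" using arg_cong[OF eq, of size] by simp
  then obtain h where h: "bij_betw h A B" using assms(1,2) finite_same_card_bij by blast
  then have "image_mset g (mset_set B) = image_mset (\<lambda>x. g (h x)) (mset_set A)"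
    by (metis (no_types, lifting) bij_betw_def image_mset_mset_set multiset.map_comp comp_def multiset.map_cong0)
  with eq obtain p where p: "p permutes A" "\<forall>x\<in>A. f x = g (h (p x))"
    using image_mset_eq_implies_permutes[OF assms(1), of f "\<lambda>x. g (h x)"] by auto
  then have "bij_betw (h \<circ> p) A B" using h permutes_imp_bij bij_betw_trans by blast
  then show thesis using that[of "h \<circ> p"] p(2) by simp
qed

section \<open>Flats of the braid arrangement and the strata near a configuration\<close>

definition flat :: "complex^'n \<Rightarrow> (complex^'n) set" where
  "flat x0 = {x \<in> centered. \<forall>i j. x0 $ i = x0 $ j \<longrightarrow> x $ i = x $ j}"

lemma flat_subset: "flat x0 \<subseteq> centered"
  unfolding flat_def by blast

lemma flat_subspace: "vec.subspace (flat x0)"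
proof (rule vec.subspaceI)
  fix x y assume "x \<in> flat x0" "y \<in> flat x0"
  then have "x + y \<in> centered" "\<And>i j. x0 $ i = x0 $ j \<Longrightarrow> x $ i = x $ j \<and> y $ i = y $ j"
    using vec.subspace_add[OF centered_subspace] unfolding flat_def by blast+
  then show "x + y \<in> flat x0" unfolding flat_def mem_Collect_eq vector_add_component by metis
next
  fix s x assume "x \<in> flat x0"
  then have "s *s x \<in> centered" "\<And>i j. x0 $ i = x0 $ j \<Longrightarrow> x $ i = x $ j"
    using vec.subspace_scale[OF centered_subspace] unfolding flat_def by blast+
  then show "s *s x \<in> flat x0" unfolding flat_def mem_Collect_eq vector_smult_component by metis
qed (simp add: flat_def vec.subspace_0[OF centered_subspace])

text \<open>The factor 2 ensures that moving two distinct coordinates of \<open>x0\<close> by less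
  than \<open>e\<close> each cannot make them equal.\<close>

definition config_radius :: "complex^'n \<Rightarrow> real \<Rightarrow> bool" where
  "config_radius x0 e \<longleftrightarrow> e > 0 \<and> (\<forall>i j. x0 $ i \<noteq> x0 $ j \<longrightarrow> 2 * e \<le> dist (x0 $ i) (x0 $ j))"

lemma ex_config_radius: "\<exists>e. config_radius x0 e"
proof -
  obtain e where "e > 0" "\<And>s t. s \<in> range (($) x0) \<Longrightarrow> t \<in> range (($) x0) \<Longrightarrow> s \<noteq> t \<Longrightarrow> e \<le> dist s t"
    using finite_separated[of "range (($) x0)"] by (metis finite_class.finite_UNIV finite_imageI)
  then show ?thesis by (intro exI[of _ "e / 2"]) (auto simp: config_radius_def)
qed

lemma config_radius_mono: "config_radius x0 e \<Longrightarrow> 0 < e' \<Longrightarrow> e' \<le> e \<Longrightarrow> config_radius x0 e'"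
  unfolding config_radius_def by (meson mult_left_mono order_trans zero_le_numeral)

lemma config_radius_coarser:
  assumes "config_radius x0 e" "x \<in> ball x0 e" "y \<in> ball x0 e" "x $ i = y $ j"
  shows "x0 $ i = x0 $ j"
proof (rule ccontr)
  assume "x0 $ i \<noteq> x0 $ j"
  then have "2 * e \<le> dist (x0 $ i) (x0 $ j)" using assms(1) by (simp add: config_radius_def)
  moreover have "dist (x0 $ i) (x $ i) < e" "dist (x0 $ j) (y $ j) < e"
    using assms(2,3) dist_vec_nth_le order_le_less_trans unfolding mem_ball by blast+
  ultimately show False using assms(4) dist_triangle2[of "x0 $ i" "x0 $ j" "x $ i"] by simp
qed

lemma in_flat_if_card_eq:
  assumes "config_radius x0 e" "x \<in> ball x0 e" "x \<in> centered" "card (range (($) x)) = card (range (($) x0))"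
  shows "x \<in> flat x0"
  unfolding flat_def using assms(3) same_partition_if_card_eq[OF config_radius_coarser[OF assms(1,2,2)] assms(4)]
  by blast

text \<open>Close to \<open>x0\<close> coincidences of coordinates can be lost but not gained, so
  the number of distinct values already reveals whether one was lost.\<close>

lemma stratum_near:
  assumes "config_radius x0 e" "x0 \<in> centered" "x \<in> centered" "x \<in> ball x0 e"
  shows "multiplicities (config_of x) = multiplicities (config_of x0) \<longleftrightarrow> x \<in> flat x0"
proof
  assume "multiplicities (config_of x) = multiplicities (config_of x0)"
  then show "x \<in> flat x0"
    using in_flat_if_card_eq[OF assms(1,4,3)] size_multiplicities[OF assms(2)] size_multiplicities[OF assms(3)] by simp
next
  assume "x \<in> flat x0"
  then show "multiplicities (config_of x) = multiplicities (config_of x0)"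
    using config_radius_coarser[OF assms(1,4,4)] multiplicities_eq_if_same_partition[OF assms(3,2)]
    unfolding flat_def by blast
qed

text \<open>A permutation relating two such points preserves the blocks of equal coordinates of
  \<open>x0\<close>, and \<open>x\<close> is constant on these blocks.\<close>

lemma config_of_inj_near:
  assumes "config_radius x0 e" "x \<in> flat x0" "y \<in> centered" "x \<in> ball x0 e" "y \<in> ball x0 e"
    and "config_of x = config_of y"
  shows "x = y"
proof -
  obtain p where p: "y = (\<chi> i. x $ p i)"
    using config_of_eq_imp_permuted[of y x] assms(2,3,6) flat_subset by (metis subsetD)
  have "y $ i = x $ i" for i
  proof -
    have "y $ i = x $ p i" by (simp add: p)
    then have "x0 $ i = x0 $ p i" using config_radius_coarser[OF assms(1,5,4)] by blast
    then show ?thesis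
      using assms(2) \<open>y $ i = x $ p i\<close> unfolding flat_def by (metis (mono_tags, lifting) mem_Collect_eq)
  qed
  then show ?thesis by (simp add: vec_eq_iff)
qed

text \<open>By \<open>stratum_near\<close> a neighbourhood in the stratum is the image of a flat
  intersected with a ball, which is convex.\<close>

lemma E_stratum_locally_path_connected:
  fixes T :: "'n::finite config set"
  assumes T: "openin (top_of_set (E_stratum l)) T" and "s \<in> T"
  shows "\<exists>U. openin (top_of_set (E_stratum l)) U \<and> s \<in> U \<and> U \<subseteq> T \<and> path_connected U"
proof -
  obtain x0 where x0: "x0 \<in> centered" "s = config_of x0"
    using config_of_surj by (metis UNIV_I imageE)
  obtain T' where T': "open T'" "T = E_stratum l \<inter> T'" using T by (auto simp: openin_open)
  have l: "multiplicities (config_of x0) = l"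
    using \<open>s \<in> T\<close> T' x0 by (auto simp: E_stratum_def)
  obtain e1 where e1: "config_radius x0 e1" using ex_config_radius by blast
  obtain O1 where O1: "open O1" "{x \<in> centered. config_of x \<in> T'} = centered \<inter> O1"
    using T'(1) unfolding open_config_def openin_open by blast
  then have "x0 \<in> O1" using x0 \<open>s \<in> T\<close> T' by auto
  then obtain e2 where e2: "e2 > 0" "ball x0 e2 \<subseteq> O1" using O1(1) openE by blast
  define e where "e = min e1 e2"
  have e: "config_radius x0 e" "e > 0"
    using e1 e2(1) config_radius_mono[OF e1, of e] by (auto simp: e_def config_radius_def)
  define U where "U = config_of ` (flat x0 \<inter> ball x0 e)"
  note flat = flat_subset[of x0]
  have U_eq: "U = E_stratum l \<inter> config_of ` (centered \<inter> ball x0 e)"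
  proof (intro subset_antisym subsetI)
    fix C assume "C \<in> U"
    then obtain x where "x \<in> flat x0" "x \<in> ball x0 e" "C = config_of x" by (auto simp: U_def)
    then show "C \<in> E_stratum l \<inter> config_of ` (centered \<inter> ball x0 e)"
      using stratum_near[OF e(1) x0(1), of x] flat l by (auto simp: E_stratum_def)
  next
    fix C assume "C \<in> E_stratum l \<inter> config_of ` (centered \<inter> ball x0 e)"
    then obtain x where "x \<in> centered" "x \<in> ball x0 e" "C = config_of x" "multiplicities C = l"
      by (auto simp: E_stratum_def)
    then show "C \<in> U" using stratum_near[OF e(1) x0(1), of x] l by (auto simp: U_def)
  qed
  have "open (config_of ` (centered \<inter> ball x0 e))"
    by (intro open_config_of_image) (simp add: openin_open_Int)
  then have "openin (top_of_set (E_stratum l)) U" unfolding U_eq by (rule openin_open_Int)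
  moreover have "x0 \<in> flat x0 \<inter> ball x0 e" using x0(1) e(2) by (simp add: flat_def)
  then have "s \<in> U" by (simp add: U_def x0(2))
  moreover have "U \<subseteq> T"
  proof -
    have "centered \<inter> ball x0 e \<subseteq> {x \<in> centered. config_of x \<in> T'}"
      unfolding O1(2) using e2(2) by (auto simp: e_def)
    then show ?thesis using U_eq T'(2) by auto
  qed
  moreover have "path_connected U" unfolding U_def
  proof (rule path_connected_continuous_image)
    show "continuous_on (flat x0 \<inter> ball x0 e) config_of"
      using continuous_on_config_of by (rule continuous_on_subset) (use flat in auto)
    have "convex (flat x0)"
      by (intro subspace_imp_convex real_subspace_of_complex_subspace flat_subspace)
    then show "path_connected (flat x0 \<inter> ball x0 e)"
      by (intro convex_imp_path_connected convex_Int) auto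
  qed
  ultimately show ?thesis by blast
qed

definition difference_product :: "('n \<times> 'n) set \<Rightarrow> complex^'n \<Rightarrow> complex" where
  "difference_product I z = (\<Prod>(i, j)\<in>I. z $ i - z $ j)"

lemma difference_product_polynomial: "difference_product I \<in> polynomial_functions"
proof -
  have "(\<lambda>z. \<Prod>e\<in>I. z $ fst e - z $ snd e) \<in> polynomial_functions"
    using coordinate_in_polynomial_functions unfolding polynomial_functions_def
    by (intro algebra_generated_closure) auto
  then show ?thesis by (simp add: difference_product_def[abs_def] case_prod_beta)
qed

lemma difference_product_nonzero_iff:
  "difference_product I z \<noteq> 0 \<longleftrightarrow> (\<forall>(i, j)\<in>I. z $ i \<noteq> z $ j)" for I :: "('n::finite \<times> 'n) set"
  unfolding difference_product_def by (subst prod_zero_iff) (auto simp: finite_subset[OF subset_UNIV])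

text \<open>The stratum is the image of the complement of finitely many hyperplanes in the complex
  flat of one representative, so \<open>connected_hypersurface_complement\<close> applies.\<close>

lemma connected_E_stratum: "connected (E_stratum l :: 'n::finite config set)"
proof (cases "E_stratum l = ({} :: 'n config set)")
  case False
  then obtain C0 :: "'n config" where "multiplicities C0 = l" by (auto simp: E_stratum_def)
  moreover obtain x0 where "x0 \<in> centered" "C0 = config_of x0"
    using config_of_surj by (metis UNIV_I imageE)
  ultimately have x0: "x0 \<in> centered" "multiplicities (config_of x0) = l" by simp_all
  define I where "I = {(i, j). x0 $ i \<noteq> x0 $ j}"
  define S where "S = {z \<in> UNIV \<inter> flat x0. difference_product I z \<noteq> 0}"
  have S: "S = {z \<in> centered. \<forall>i j. z $ i = z $ j \<longleftrightarrow> x0 $ i = x0 $ j}"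
    unfolding S_def difference_product_nonzero_iff I_def flat_def by blast
  have "connected S" unfolding S_def
    by (rule connected_hypersurface_complement[OF difference_product_polynomial _ _ flat_subspace]) auto
  moreover have "continuous_on S config_of"
    using continuous_on_config_of by (rule continuous_on_subset) (auto simp: S)
  ultimately have "connected (config_of ` S)" by (rule connected_continuous_image[rotated])
  moreover have "config_of ` S = E_stratum l"
  proof (intro subset_antisym subsetI)
    fix C assume "C \<in> config_of ` S"
    then show "C \<in> E_stratum l"
      using multiplicities_eq_if_same_partition x0 unfolding S E_stratum_def by blast
  next
    fix C :: "'n config" assume C: "C \<in> E_stratum l"
    obtain x where x: "x \<in> centered" "C = config_of x" using config_of_surj by (metis UNIV_I imageE)
    have "image_mset (count (points C)) (mset_set (set_mset (points C))) =
        image_mset (count (points (config_of x0))) (mset_set (range (($) x0)))"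
      using C x0 unfolding E_stratum_def multiplicities_def by (simp add: set_points_config_of)
    from bij_betw_if_image_mset_eq[OF _ _ this[symmetric]]
    \<comment> \<open>Pairing values of equal multiplicity distributes the points of
      \<open>C\<close> over the blocks of \<open>x0\<close>; this gives a representative of
      \<open>C\<close> in \<open>S\<close>.\<close>
    obtain b where b: "bij_betw b (range (($) x0)) (set_mset (points C))"
      "\<And>t. t \<in> range (($) x0) \<Longrightarrow> count (points C) (b t) = count (points (config_of x0)) t"
      by auto
    define y where "y = (\<chi> i. b (x0 $ i))"
    have yi: "y $ i = y $ j \<longleftrightarrow> x0 $ i = x0 $ j" for i j
      using b(1) unfolding y_def bij_betw_def inj_on_def by auto
    have "image_mset (\<lambda>i. y $ i) (mset_set UNIV) = points C"
    proof (rule multiset_eqI)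
      fix t
      have cnt: "count (image_mset (\<lambda>i. y $ i) (mset_set UNIV)) t = card {i. y $ i = t}"
        by (simp add: count_image_mset' Int_def vimage_def eq_commute conj_commute)
      show "count (image_mset (\<lambda>i. y $ i) (mset_set UNIV)) t = count (points C) t"
      proof (cases "\<exists>i. y $ i = t")
        case True
        then obtain i where i: "y $ i = t" by blast
        have "{j. y $ j = t} = {j. x0 $ j = x0 $ i}" using i yi by metis
        then have "card {j. y $ j = t} = count (points C) (b (x0 $ i))"
          using b(2)[of "x0 $ i"] x0(1) by (simp add: count_points_config_of)
        then show ?thesis using i cnt by (simp add: y_def)
      next
        case False
        then have "{i. y $ i = t} = {}" by blast
        moreover have "t \<notin># points C"
        proof
          assume "t \<in># points C"
          then obtain i where "t = b (x0 $ i)" using b(1) by (auto simp: bij_betw_def)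
          with False show False
            by (metis vec_lambda_beta y_def)
        qed
        ultimately show ?thesis using cnt by (simp add: not_in_iff)
      qed
    qed
    then have y: "image_mset (\<lambda>i. y $ i) (mset_set UNIV) = image_mset (\<lambda>i. x $ i) (mset_set UNIV)"
      using x by (simp add: points_config_of)
    then have "y \<in> centered" using x(1) by (simp add: centered_def sum_unfold_sum_mset)
    then have "y \<in> S" using yi by (simp add: S)
    moreover have "config_of y = C" using y x(2) by (simp add: config_of_def)
    ultimately show "C \<in> config_of ` S" by blast
  qed
  ultimately show ?thesis by simp
qed simp

section \<open>The Lyashko--Looijenga morphism is open, closed and surjective\<close>

lemma proots_linear_factors: "proots (\<Prod>x\<in>#A. [:-x, 1:]) = (A :: complex multiset)"
proof (induction A)
  case (add x A)
  have "(\<Prod>x\<in>#A. [:-x, 1:]) \<noteq> 0" by auto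
  then have "proots ([:-x, 1:] * (\<Prod>x\<in>#A. [:-x, 1:])) = proots [:-x, 1:] + proots (\<Prod>x\<in>#A. [:-x, 1:])"
    by (intro proots_mult) auto
  then show ?case by (simp add: add.IH del: mult_pCons_left)
qed auto

context lyashko_looijenga
begin

definition LLc :: "complex^'n \<Rightarrow> 'n config" where
  "LLc y = LL a (base y)"

lemma points_LLc: "points (LLc y) = proots (dp y)"
  by (simp add: LLc_def points_LL dp_def)

lemma set_points_LLc: "set_mset (points (LLc y)) = roots y"
  using dp_nonzero[of y] by (auto simp: points_LLc roots_def)

lemma size_multiplicities_LLc: "size (multiplicities (LLc y)) = card (roots y)"
  by (simp add: multiplicities_def set_points_LLc)

lemma roots_eq_range: "x \<in> centered \<Longrightarrow> LLc y = config_of x \<Longrightarrow> roots y = range (($) x)"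
  by (metis set_points_LLc set_points_config_of)

lemma ex_LLc_eq: "\<exists>x\<in>centered. LLc y = config_of x"
  using config_of_surj by (metis UNIV_I imageE)

text \<open>Equality of configurations becomes a family of polynomial identities at fixed
  \<open>t\<close>, which pass to limits.\<close>

lemma LLc_eq_iff:
  assumes "x \<in> centered"
  shows "LLc y = config_of x \<longleftrightarrow> (\<forall>t. poly (dp y) t = (\<Prod>i\<in>UNIV. t - x $ i))"
proof -
  define q where "q = (\<Prod>t\<in>#points (config_of x). [:-t, 1:])"
  have "q = (\<Prod>i\<in>UNIV. [:- (x $ i), 1:])"
    unfolding q_def points_config_of[OF assms] by (simp add: multiset.map_comp comp_def prod_unfold_prod_mset)
  then have q: "poly q t = (\<Prod>i\<in>UNIV. t - x $ i)" for t by (simp add: poly_prod)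
  have "dp y = (\<Prod>t\<in>#points (LLc y). [:-t, 1:])"
    unfolding points_LLc using complex_poly_decompose_multiset[of "dp y"] lead_coeff_dp[of y] by simp
  then have "LLc y = config_of x \<longleftrightarrow> dp y = q"
    unfolding q_def using proots_linear_factors by (metis points_inject)
  also have "\<dots> \<longleftrightarrow> (\<forall>t. poly (dp y) t = poly q t)"
    by (metis poly_eq_poly_eq_iff ext)
  finally show ?thesis by (simp add: q)
qed

lemma tendsto_poly_dp: "((\<lambda>y. poly (dp y) t) \<longlongrightarrow> poly (dp y0) t) (nhds y0)"
  unfolding dp_def poly_disc_poly
  by (intro tendsto_intros) (use continuous_coefficients[of _ y0] in \<open>simp add: continuous_at tendsto_nhds_iff\<close>)

lemma LLc_limit:
  assumes "ys \<longlonglongrightarrow> y" "xs \<longlonglongrightarrow> x" "\<And>k. xs k \<in> centered" "\<And>k. LLc (ys k) = config_of (xs k)"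
  shows "x \<in> centered" "LLc y = config_of x"
proof -
  show x: "x \<in> centered" using closed_sequentially[OF closed_centered] assms(2,3) by blast
  have "poly (dp y) t = (\<Prod>i\<in>UNIV. t - x $ i)" for t
  proof (rule LIMSEQ_unique)
    show "(\<lambda>k. poly (dp (ys k)) t) \<longlonglongrightarrow> poly (dp y) t"
      using filterlim_compose[OF tendsto_poly_dp assms(1)] .
    have "(\<lambda>k. \<Prod>i\<in>UNIV. t - xs k $ i) \<longlonglongrightarrow> (\<Prod>i\<in>UNIV. t - x $ i)"
      by (intro tendsto_intros assms(2))
    moreover have "(\<Prod>i\<in>UNIV. t - xs k $ i) = poly (dp (ys k)) t" for k
      using LLc_eq_iff[OF assms(3)] assms(4) by metis
    ultimately show "(\<lambda>k. poly (dp (ys k)) t) \<longlonglongrightarrow> (\<Prod>i\<in>UNIV. t - x $ i)"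
      by simp
  qed
  then show "LLc y = config_of x" using LLc_eq_iff[OF x] by blast
qed

lemma norm_le_if_roots_le:
  assumes "x \<in> centered" "LLc y = config_of x" "\<And>t. t \<in> roots y \<Longrightarrow> norm t \<le> B"
  shows "norm x \<le> real CARD('n) * B"
proof -
  have "norm x \<le> (\<Sum>i\<in>UNIV. norm (x $ i))"
    unfolding norm_vec_def by (rule L2_set_le_sum) auto
  also have "\<dots> \<le> (\<Sum>i::'n\<in>UNIV. B)"
    using assms(3) roots_eq_range[OF assms(1,2)] by (intro sum_mono) auto
  finally show ?thesis by simp
qed

text \<open>Continuity of the roots with multiplicities. Labellings over points tending to
  \<open>y0\<close> are bounded, so a subsequence converges to a labelling over \<open>y0\<close>; a
  permutation turns this limit into \<open>x0\<close>.\<close>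

lemma LLc_lift_near:
  assumes x0: "x0 \<in> centered" "LLc y0 = config_of x0" and "e > 0"
  shows "\<forall>\<^sub>F y in nhds y0. \<exists>x\<in>centered. x \<in> ball x0 e \<and> LLc y = config_of x"
proof (rule ccontr)
  assume contra: "\<not> ?thesis"
  obtain B where B: "\<And>t. t \<in> roots y0 \<Longrightarrow> norm t \<le> B"
    using finite_imp_bounded[OF finite_roots] unfolding bounded_iff by blast
  obtain \<delta> where \<delta>: "\<delta> > 0" "\<And>y t. dist y y0 < \<delta> \<Longrightarrow> t \<in> roots y \<Longrightarrow> \<exists>x\<in>roots y0. dist t x < 1"
    using roots_continuity[of 1 y0] unfolding eventually_nhds_metric by auto
  have "\<forall>k. \<exists>y. dist y y0 < min \<delta> (inverse (real (Suc k))) \<and> \<not> (\<exists>x\<in>centered. x \<in> ball x0 e \<and> LLc y = config_of x)"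
  proof
    fix k
    have "min \<delta> (inverse (real (Suc k))) > 0" using \<delta>(1) by simp
    then show "\<exists>y. dist y y0 < min \<delta> (inverse (real (Suc k))) \<and> \<not> (\<exists>x\<in>centered. x \<in> ball x0 e \<and> LLc y = config_of x)"
      using contra unfolding eventually_nhds_metric by blast
  qed
  then obtain ys where ys: "\<And>k. dist (ys k) y0 < min \<delta> (inverse (real (Suc k)))"
    "\<And>k x. x \<in> centered \<Longrightarrow> x \<in> ball x0 e \<Longrightarrow> LLc (ys k) \<noteq> config_of x"
    by metis
  have "(\<lambda>k. dist (ys k) y0) \<longlonglongrightarrow> 0"
    using ys(1) by (intro Lim_null_comparison[OF _ LIMSEQ_inverse_real_of_nat] always_eventually allI)
      (metis less_imp_le min_less_iff_conj norm_of_real real_norm_def abs_of_nonneg zero_le_dist)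
  then have ylim: "ys \<longlonglongrightarrow> y0" using tendsto_dist_iff by blast
  have "\<forall>k. \<exists>x. x \<in> centered \<and> LLc (ys k) = config_of x"
    using ex_LLc_eq by blast
  then obtain xs where xs: "\<And>k. xs k \<in> centered" "\<And>k. LLc (ys k) = config_of (xs k)"
    by metis
  have "norm (xs k) \<le> real CARD('n) * (B + 1)" for k
  proof (rule norm_le_if_roots_le[OF xs])
    fix t assume "t \<in> roots (ys k)"
    then obtain x where "x \<in> roots y0" "dist t x < 1"
      using \<delta>(2) ys(1)[of k] by (meson min_less_iff_conj)
    then show "norm t \<le> B + 1" using B[of x] norm_triangle_ineq2[of t x] by (simp add: dist_norm)
  qed
  then have "xs k \<in> cball 0 (real CARD('n) * (B + 1))" for k by simp
  then obtain x r where x: "strict_mono r" "(xs \<circ> r) \<longlonglongrightarrow> x"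
    using compact_cball[of "0 :: complex^'n"] unfolding compact_def by metis
  have "(ys \<circ> r) \<longlonglongrightarrow> y0" using LIMSEQ_subseq_LIMSEQ[OF ylim x(1)] .
  from LLc_limit[OF this x(2)] xs have xc: "x \<in> centered" "LLc y0 = config_of x"
    by simp_all
  then obtain p where p: "p permutes UNIV" "x0 = (\<chi> i. x $ p i)"
    using config_of_eq_imp_permuted[OF x0(1) xc(1)] x0(2) by metis
  have "(\<lambda>k. \<chi> i. (xs \<circ> r) k $ p i) \<longlonglongrightarrow> x0"
    unfolding p(2) by (intro tendsto_intros x(2))
  then have "\<forall>\<^sub>F k in sequentially. (\<chi> i. (xs \<circ> r) k $ p i) \<in> ball x0 e"
    using \<open>e > 0\<close> by (intro topological_tendstoD[of _ x0]) auto
  then obtain k where "(\<chi> i. xs (r k) $ p i) \<in> ball x0 e"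
    by (auto simp: eventually_sequentially)
  then show False using ys(2) config_of_permute[OF p(1) xs(1)] xs(2) by metis
qed

lemma continuous_on_LLc: "continuous_on S LLc"
proof -
  have "continuous_on UNIV LLc" unfolding continuous_on_open_vimage[OF open_UNIV]
  proof (intro allI impI)
    fix U :: "'n config set" assume U: "open U"
    show "open (LLc -` U \<inter> UNIV)"
    proof (subst open_subopen, clarsimp)
      fix y0 assume "LLc y0 \<in> U"
      obtain x0 where x0: "x0 \<in> centered" "LLc y0 = config_of x0" using ex_LLc_eq by blast
      obtain A where A: "open A" "{x \<in> centered. config_of x \<in> U} = centered \<inter> A"
        using U unfolding open_config_def openin_open by blast
      then have "x0 \<in> A" using x0 \<open>LLc y0 \<in> U\<close> by auto
      then obtain e where e: "e > 0" "ball x0 e \<subseteq> A" using A(1) openE by blast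
      have "\<forall>\<^sub>F y in nhds y0. LLc y \<in> U" using LLc_lift_near[OF x0 e(1)]
      proof (rule eventually_mono)
        fix y assume "\<exists>x\<in>centered. x \<in> ball x0 e \<and> LLc y = config_of x"
        then obtain x where x: "x \<in> centered" "x \<in> ball x0 e" "LLc y = config_of x" by blast
        then have "x \<in> {x \<in> centered. config_of x \<in> U}" unfolding A(2) using e(2) by blast
        with x(3) show "LLc y \<in> U"
          by simp
      qed
      then show "\<exists>T. open T \<and> y0 \<in> T \<and> T \<subseteq> LLc -` U"
        unfolding eventually_nhds by blast
    qed
  qed
  then show ?thesis using continuous_on_subset by blast
qed

text \<open>Convergence is tested upstairs, on labelled configurations. Convergent labellings bound
  the roots, hence the points of \<open>K\<close> over them, and compactness supplies a limit
  point.\<close>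

lemma closed_LLc_preimage:
  assumes "closed K" "K \<subseteq> Y0"
  shows "closed {x \<in> centered. config_of x \<in> LLc ` K}"
  unfolding closed_sequential_limits
proof (intro allI impI, elim conjE)
  fix xs x assume xs: "\<forall>k. xs k \<in> {x \<in> centered. config_of x \<in> LLc ` K}" and lim: "xs \<longlonglongrightarrow> x"
  then have "\<forall>k. \<exists>y\<in>K. LLc y = config_of (xs k)" by (auto simp: image_iff) metis
  then obtain ys where ys: "\<And>k. ys k \<in> K" "\<And>k. LLc (ys k) = config_of (xs k)" by metis
  have xc: "xs k \<in> centered" for k using xs by blast
  obtain B where B: "\<And>k. norm (xs k) \<le> B"
    using convergent_imp_Bseq[OF convergentI[OF lim]] by (auto simp: Bseq_def)
  obtain C where C: "\<And>y. y \<in> Y0 \<Longrightarrow> (\<forall>t\<in>roots y. norm t \<le> B) \<Longrightarrow> norm y \<le> C"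
    using bounded_if_bounded_roots by blast
  have "norm (ys k) \<le> C" for k
  proof (rule C)
    show "ys k \<in> Y0" using ys(1) assms(2) by blast
    show "\<forall>t\<in>roots (ys k). norm t \<le> B" unfolding roots_eq_range[OF xc ys(2)]
      using B order_trans[OF Finite_Cartesian_Product.norm_nth_le] by blast
  qed
  then have "ys k \<in> K \<inter> cball 0 C" for k using ys(1) by simp
  moreover have "compact (K \<inter> cball 0 C)" using assms(1) by (simp add: closed_Int_compact)
  ultimately obtain y r where y: "y \<in> K \<inter> cball 0 C" "strict_mono r" "(ys \<circ> r) \<longlonglongrightarrow> y"
    unfolding compact_def by metis
  have "x \<in> centered" "LLc y = config_of x"
    using LLc_limit[OF y(3) LIMSEQ_subseq_LIMSEQ[OF lim y(2)]] xc ys(2) by auto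
  then show "x \<in> {x \<in> centered. config_of x \<in> LLc ` K}"
    using y(1) by (metis (mono_tags, lifting) IntD1 imageI mem_Collect_eq)
qed

lemma closed_LLc_image: "closed K \<Longrightarrow> K \<subseteq> Y0 \<Longrightarrow> closed (LLc ` K)"
  using closed_LLc_preimage closed_config_iff by blast

lemma LLc_locally_injective:
  assumes "y0 \<in> Y0"
  obtains \<delta> where "\<delta> > 0" "\<And>y1 y2. y1 \<in> Y0 \<inter> ball y0 \<delta> \<Longrightarrow> y2 \<in> Y0 \<inter> ball y0 \<delta> \<Longrightarrow>
    LLc y1 = LLc y2 \<Longrightarrow> card (roots y1) = card (roots y0) \<Longrightarrow> y1 = y2"
  using eq_if_same_roots_locally[OF assms] set_points_LLc by metis

text \<open>Properness makes a fibre compact, so an infinite one accumulates at one of its own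
  points. The number of roots is constant on the fibre, and local injectivity rules this
  out.\<close>

lemma finite_fibre: "finite {y \<in> Y0. LLc y = C}"
proof (rule ccontr)
  obtain x where x: "x \<in> centered" "C = config_of x" using config_of_surj by (metis UNIV_I imageE)
  define S where "S = {y \<in> Y0. LLc y = C}"
  assume "\<not> finite {y \<in> Y0. LLc y = C}"
  then have "infinite S" by (simp add: S_def)
  obtain B where B: "\<And>y. y \<in> Y0 \<Longrightarrow> (\<forall>t\<in>roots y. norm t \<le> norm x) \<Longrightarrow> norm y \<le> B"
    using bounded_if_bounded_roots by blast
  have "norm y \<le> B" if "y \<in> S" for y
    using that B[of y] roots_eq_range[OF x(1), of y] x(2) Finite_Cartesian_Product.norm_nth_le[of x]
    by (auto simp: S_def)
  then have "bounded S" by (auto simp: bounded_iff)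
  have "S = Y0 \<inter> (\<Inter>t. (\<lambda>y. poly (dp y) t) -` {\<Prod>i\<in>UNIV. t - x $ i})"
    using LLc_eq_iff[OF x(1)] by (auto simp: S_def x(2))
  moreover have "isCont (\<lambda>y. poly (dp y) t) y" for t y
    using tendsto_poly_dp[of t y] by (simp add: continuous_at tendsto_nhds_iff)
  ultimately have "closed S"
    using closed_Y0 by (auto intro!: closed_Int closed_INT continuous_closed_vimage)
  with \<open>bounded S\<close> have "compact S"
    by (simp add: compact_eq_bounded_closed)
  then obtain y0 where y0: "y0 \<in> S" "y0 islimpt S"
    using \<open>infinite S\<close> compact_eq_Bolzano_Weierstrass[of S] by blast
  from y0(1) have "y0 \<in> Y0" "LLc y0 = C"
    by (simp_all add: S_def)
  obtain \<delta> where \<delta>: "\<delta> > 0" "\<And>y1 y2. y1 \<in> Y0 \<inter> ball y0 \<delta> \<Longrightarrow> y2 \<in> Y0 \<inter> ball y0 \<delta> \<Longrightarrow>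
    LLc y1 = LLc y2 \<Longrightarrow> card (roots y1) = card (roots y0) \<Longrightarrow> y1 = y2"
    by (rule LLc_locally_injective[OF \<open>y0 \<in> Y0\<close>]) (rule that)
  obtain y where y: "y \<in> S" "y \<noteq> y0" "dist y y0 < \<delta>"
    using y0(2) \<delta>(1) unfolding islimpt_approachable by blast
  have "y = y0"
  proof (rule \<delta>(2))
    show "y \<in> Y0 \<inter> ball y0 \<delta>" "y0 \<in> Y0 \<inter> ball y0 \<delta>" "LLc y = LLc y0"
      using y y0(1) \<delta>(1) by (auto simp: S_def dist_commute)
    then show "card (roots y) = card (roots y0)" using size_multiplicities_LLc by metis
  qed
  then show False using y(2) by blast
qed

text \<open>
  The vector \<open>\<xi> y\<close> lists the roots over \<open>y\<close> in the order in which \<open>x0\<close> lists those over \<open>y0\<close>.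
\<close>

lemma root_labelling:
  assumes "y0 \<in> Y0" "x0 \<in> centered" "LLc y0 = config_of x0"
  obtains \<delta> \<xi> where "\<delta> > 0"
    "\<And>y. y \<in> ball y0 \<delta> \<Longrightarrow> card (roots y0) \<le> card (roots y)"
    "\<And>y. y \<in> Y0 \<inter> ball y0 \<delta> \<Longrightarrow> card (roots y) = card (roots y0) \<Longrightarrow> \<xi> y \<in> flat x0 \<and> LLc y = config_of (\<xi> y)"
    "inj_on \<xi> {y \<in> Y0 \<inter> ball y0 \<delta>. card (roots y) = card (roots y0)}"
    "continuous_on {y \<in> Y0 \<inter> ball y0 \<delta>. card (roots y) = card (roots y0)} \<xi>" "\<xi> y0 = x0"
proof -
  obtain e where e: "config_radius x0 e" using ex_config_radius by blast
  then have "e > 0" by (simp add: config_radius_def)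
  obtain \<delta>1 where \<delta>1: "\<delta>1 > 0" "\<And>y. dist y y0 < \<delta>1 \<Longrightarrow> \<exists>x\<in>centered. x \<in> ball x0 e \<and> LLc y = config_of x"
    using LLc_lift_near[OF assms(2,3) \<open>e > 0\<close>] unfolding eventually_nhds_metric by blast
  obtain \<delta>2 where \<delta>2: "\<delta>2 > 0" "\<And>y1 y2. y1 \<in> Y0 \<inter> ball y0 \<delta>2 \<Longrightarrow> y2 \<in> Y0 \<inter> ball y0 \<delta>2 \<Longrightarrow>
    LLc y1 = LLc y2 \<Longrightarrow> card (roots y1) = card (roots y0) \<Longrightarrow> y1 = y2"
    by (rule LLc_locally_injective[OF assms(1)]) (rule that)
  define \<delta> where "\<delta> = min \<delta>1 \<delta>2"
  define N where "N = {y \<in> Y0 \<inter> ball y0 \<delta>. card (roots y) = card (roots y0)}"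
  have "\<forall>y\<in>ball y0 \<delta>. \<exists>x. x \<in> centered \<and> x \<in> ball x0 e \<and> LLc y = config_of x"
  proof
    fix y assume "y \<in> ball y0 \<delta>"
    then have "dist y y0 < \<delta>1" by (simp add: \<delta>_def dist_commute)
    then show "\<exists>x. x \<in> centered \<and> x \<in> ball x0 e \<and> LLc y = config_of x"
      using \<delta>1(2) by blast
  qed
  then obtain \<xi> where \<xi>: "\<And>y. y \<in> ball y0 \<delta> \<Longrightarrow> \<xi> y \<in> centered \<and> \<xi> y \<in> ball x0 e \<and> LLc y = config_of (\<xi> y)"
    by metis
  have card: "card (roots y0) = card (range (($) x0))" "y \<in> ball y0 \<delta> \<Longrightarrow> card (roots y) = card (range (($) (\<xi> y)))" for y
    using roots_eq_range[OF assms(2,3)] roots_eq_range[of "\<xi> y" y] \<xi>[of y] by simp_all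
  have flat: "x \<in> flat x0" if "x \<in> centered" "x \<in> ball x0 e" "LLc y = config_of x" "y \<in> N" for x y
    using in_flat_if_card_eq[OF e that(2,1)] roots_eq_range[OF that(1,3)] that(4) card(1) by (auto simp: N_def)
  \<comment> \<open>Uniqueness of the label in the ball is what makes the pointwise choice of
    \<open>\<xi>\<close> continuous on \<open>N\<close>.\<close>
  have uniq: "\<xi> y = x" if "x \<in> centered" "x \<in> ball x0 e" "LLc y = config_of x" "y \<in> N" for x y
  proof -
    have "y \<in> ball y0 \<delta>" using that(4) by (simp add: N_def)
    then show ?thesis
      using \<xi>[of y] flat[of "\<xi> y" y] that config_of_inj_near[OF e, of "\<xi> y" x] by auto
  qed
  show thesis
  proof
    show "\<delta> > 0" using \<delta>1(1) \<delta>2(1) by (simp add: \<delta>_def)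
    show "card (roots y0) \<le> card (roots y)" if "y \<in> ball y0 \<delta>" for y
    proof -
      have coarser: "x0 $ i = x0 $ j" if "\<xi> y $ i = \<xi> y $ j" for i j
        using config_radius_coarser[OF e _ _ that] \<xi> \<open>y \<in> ball y0 \<delta>\<close> by blast
      obtain g where "\<And>i. g (\<xi> y $ i) = x0 $ i"
        using ex_coarsening[of "\<xi> y" x0] coarser by blast
      then have "range (($) x0) = g ` range (($) (\<xi> y))" by (auto simp: image_image)
      then have "card (range (($) x0)) \<le> card (range (($) (\<xi> y)))"
        using card_image_le[of "range (($) (\<xi> y))" g] by simp
      then show ?thesis using card that by simp
    qed
    show "\<xi> y \<in> flat x0 \<and> LLc y = config_of (\<xi> y)"
      if "y \<in> Y0 \<inter> ball y0 \<delta>" "card (roots y) = card (roots y0)" for y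
      using that \<xi>[of y] flat[of "\<xi> y" y] by (simp add: N_def)
    show "inj_on \<xi> {y \<in> Y0 \<inter> ball y0 \<delta>. card (roots y) = card (roots y0)}"
    proof (rule inj_onI)
      fix y1 y2 assume y: "y1 \<in> {y \<in> Y0 \<inter> ball y0 \<delta>. card (roots y) = card (roots y0)}"
        "y2 \<in> {y \<in> Y0 \<inter> ball y0 \<delta>. card (roots y) = card (roots y0)}" "\<xi> y1 = \<xi> y2"
      then have "LLc y1 = LLc y2" using \<xi> by auto
      then show "y1 = y2" using y \<delta>2(2)[of y1 y2] by (simp add: \<delta>_def)
    qed
    show "\<xi> y0 = x0"
      using assms \<open>e > 0\<close> \<open>\<delta> > 0\<close> by (intro uniq) (auto simp: N_def)
    show "continuous_on {y \<in> Y0 \<inter> ball y0 \<delta>. card (roots y) = card (roots y0)} \<xi>"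
      unfolding N_def[symmetric] continuous_on_iff
    proof (intro ballI allI impI)
      fix y and \<epsilon> :: real assume y: "y \<in> N" and "\<epsilon> > 0"
      then have \<xi>y: "\<xi> y \<in> centered" "\<xi> y \<in> ball x0 e" "LLc y = config_of (\<xi> y)"
        using \<xi> by (auto simp: N_def)
      obtain r where r: "r > 0" "ball (\<xi> y) r \<subseteq> ball x0 e"
        using \<xi>y(2) open_ball openE by blast
      have "min r \<epsilon> > 0" using r(1) \<open>\<epsilon> > 0\<close> by simp
      then obtain \<eta> where \<eta>: "\<eta> > 0"
        "\<And>y'. dist y' y < \<eta> \<Longrightarrow> \<exists>x\<in>centered. x \<in> ball (\<xi> y) (min r \<epsilon>) \<and> LLc y' = config_of x"
        using LLc_lift_near[OF \<xi>y(1,3)] unfolding eventually_nhds_metric by blast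
      have "dist (\<xi> y') (\<xi> y) < \<epsilon>" if "y' \<in> N" "dist y' y < \<eta>" for y'
      proof -
        obtain x where x: "x \<in> centered" "x \<in> ball (\<xi> y) (min r \<epsilon>)" "LLc y' = config_of x"
          using \<eta>(2)[OF \<open>dist y' y < \<eta>\<close>] by blast
        then have "x \<in> ball x0 e" using r(2) by auto
        then have "\<xi> y' = x" using uniq x that(1) by blast
        then show ?thesis using x(2) by (simp add: dist_commute)
      qed
      then show "\<exists>\<eta>>0. \<forall>y'\<in>N. dist y' y < \<eta> \<longrightarrow> dist (\<xi> y') (\<xi> y) < \<epsilon>"
        using \<eta>(1) by blast
    qed
  qed
qed

section \<open>Dimension counts and regular points\<close>

lemma subspace_Y0: "subspace Y0"
  by (auto simp: subspace_def Y0_def)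

lemma subspace_centered: "subspace (centered :: (complex^'n) set)"
  by (rule real_subspace_of_complex_subspace[OF centered_subspace])

lemma dim_centered_le: "dim (centered :: (complex^'n) set) \<le> dim Y0"
proof (rule continuous_injective_image_subspace_dim_le)
  define g where "g = (\<lambda>x::complex^'n. \<chi> k. if k = top_idx then 0 else x $ k)"
  have "continuous_on UNIV g"
    unfolding g_def by (rule continuous_on_vec_componentwise, rename_tac k, case_tac "k = top_idx")
      (auto intro!: continuous_intros)
  then show "continuous_on centered g" using continuous_on_subset by blast
  show "g \<in> centered \<rightarrow> Y0" by (auto simp: g_def Y0_def)
  show "inj_on g centered"
  proof (rule inj_onI)
    fix x y assume xy: "x \<in> centered" "y \<in> centered" "g x = g y"
    have off: "x $ k = y $ k" if "k \<noteq> top_idx" for k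
      using arg_cong[OF xy(3), of "\<lambda>v. v $ k"] that by (simp add: g_def)
    have "(\<Sum>k\<in>UNIV. x $ k) = (\<Sum>k\<in>UNIV. y $ k)" using xy by (simp add: centered_def)
    moreover have "(\<Sum>k\<in>UNIV - {top_idx}. x $ k) = (\<Sum>k\<in>UNIV - {top_idx}. y $ k)"
      using off by (intro sum.cong) auto
    ultimately have "x $ top_idx = y $ top_idx"
      using sum.remove[of UNIV top_idx "($) x"] sum.remove[of UNIV top_idx "($) y"] by simp
    then show "x = y" using off by (metis vec_eq_iff)
  qed
qed (use subspace_centered subspace_Y0 in auto)

lemma card_roots_le: "card (roots y) \<le> CARD('n)"
  using card_poly_roots_bound[OF dp_nonzero[of y]] by (simp add: roots_def degree_dp)

text \<open>At a point of \<open>U\<close> with the most roots the number of roots is locally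
  constant, so the labelling embeds an open piece of \<open>Y0\<close> in a flat. By invariance of
  dimension this flat is all of \<open>centered\<close>, so no coordinates of its base point
  coincide.\<close>

lemma regular_points_dense:
  assumes "open U" "y \<in> U" "y \<in> Y0"
  shows "\<exists>y\<in>U \<inter> Y0. card (roots y) = CARD('n)"
proof -
  have "\<exists>y. y \<in> U \<inter> Y0 \<and> (\<forall>z. z \<in> U \<inter> Y0 \<longrightarrow> card (roots z) \<le> card (roots y))"
    using assms card_roots_le by (intro ex_has_greatest_nat[of _ y _ "CARD('n) + 1"]) (auto simp: less_Suc_eq_le)
  then obtain y0 where y0: "y0 \<in> U" "y0 \<in> Y0" "\<And>z. z \<in> U \<inter> Y0 \<Longrightarrow> card (roots z) \<le> card (roots y0)"
    by blast
  obtain x0 where x0: "x0 \<in> centered" "LLc y0 = config_of x0" using ex_LLc_eq by blast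
  obtain \<delta> \<xi> where \<xi>: "\<delta> > 0"
    "\<And>y. y \<in> ball y0 \<delta> \<Longrightarrow> card (roots y0) \<le> card (roots y)"
    "\<And>y. y \<in> Y0 \<inter> ball y0 \<delta> \<Longrightarrow> card (roots y) = card (roots y0) \<Longrightarrow> \<xi> y \<in> flat x0 \<and> LLc y = config_of (\<xi> y)"
    "inj_on \<xi> {y \<in> Y0 \<inter> ball y0 \<delta>. card (roots y) = card (roots y0)}"
    "continuous_on {y \<in> Y0 \<inter> ball y0 \<delta>. card (roots y) = card (roots y0)} \<xi>" "\<xi> y0 = x0"
    by (rule root_labelling[OF y0(2) x0]) (rule that)
  define N where "N = Y0 \<inter> (ball y0 \<delta> \<inter> U)"
  have same: "card (roots y) = card (roots y0)" if "y \<in> N" for y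
    using that \<xi>(2)[of y] y0(3)[of y] by (auto simp: N_def)
  then have N: "N \<subseteq> {y \<in> Y0 \<inter> ball y0 \<delta>. card (roots y) = card (roots y0)}"
    by (auto simp: N_def)
  have "dim Y0 \<le> dim (flat x0)"
  proof (rule invariance_of_dimension_subspaces)
    show "openin (top_of_set Y0) N"
      unfolding N_def using assms(1) by (intro openin_open_Int open_Int) auto
    show "subspace (flat x0)" by (rule real_subspace_of_complex_subspace[OF flat_subspace])
    show "continuous_on N \<xi>" "inj_on \<xi> N"
      using \<xi>(4,5) N by (auto intro: continuous_on_subset inj_on_subset)
    show "\<xi> \<in> N \<rightarrow> flat x0" using \<xi>(3) N by auto
    show "N \<noteq> {}" using y0 \<xi>(1) by (auto simp: N_def)
  qed (rule subspace_Y0)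
  then have "dim (centered :: (complex^'n) set) \<le> dim (flat x0)" using dim_centered_le by linarith
  then have flat: "flat x0 = centered"
    using subspace_dim_equal[OF real_subspace_of_complex_subspace[OF flat_subspace] subspace_centered flat_subset] by blast
  have "inj (($) x0)"
  proof (rule injI, rule ccontr)
    fix i j assume ij: "x0 $ i = x0 $ j" "i \<noteq> j"
    \<comment> \<open>This centered vector separates \<open>i\<close> and \<open>j\<close>, so it
      cannot lie in a flat that identifies them.\<close>
    have "axis i 1 - axis j 1 \<in> centered" by (simp add: centered_def sum_subtractf axis_def)
    then have "(axis i 1 - axis j 1 :: complex^'n) \<in> flat x0" using flat by simp
    then have "(axis i 1 - axis j 1 :: complex^'n) $ i = (axis i 1 - axis j 1) $ j"
      using ij(1) unfolding flat_def by blast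
    then show False using ij(2) by (simp add: axis_def)
  qed
  then have "card (roots y0) = CARD('n)" using roots_eq_range[OF x0] by (simp add: card_image)
  then show ?thesis using y0 by blast
qed

text \<open>The number of roots is already maximal, so it is constant nearby; invariance of domain
  applies to the labelling.\<close>

lemma LLc_open_at_regular_point:
  assumes "y0 \<in> Y0" "x0 \<in> centered" "LLc y0 = config_of x0" "inj (($) x0)" "open U" "y0 \<in> U"
  shows "\<exists>A. openin (top_of_set centered) A \<and> x0 \<in> A \<and> config_of ` A \<subseteq> LLc ` (Y0 \<inter> U)"
proof -
  have card: "card (roots y0) = CARD('n)"
    using roots_eq_range[OF assms(2,3)] assms(4) by (simp add: card_image)
  obtain \<delta> \<xi> where \<xi>: "\<delta> > 0"
    "\<And>y. y \<in> ball y0 \<delta> \<Longrightarrow> card (roots y0) \<le> card (roots y)"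
    "\<And>y. y \<in> Y0 \<inter> ball y0 \<delta> \<Longrightarrow> card (roots y) = card (roots y0) \<Longrightarrow> \<xi> y \<in> flat x0 \<and> LLc y = config_of (\<xi> y)"
    "inj_on \<xi> {y \<in> Y0 \<inter> ball y0 \<delta>. card (roots y) = card (roots y0)}"
    "continuous_on {y \<in> Y0 \<inter> ball y0 \<delta>. card (roots y) = card (roots y0)} \<xi>" "\<xi> y0 = x0"
    by (rule root_labelling[OF assms(1-3)]) (rule that)
  define N where "N = Y0 \<inter> (ball y0 \<delta> \<inter> U)"
  have "card (roots y) = card (roots y0)" if "y \<in> N" for y
    using that \<xi>(2)[of y] card_roots_le[of y] card by (auto simp: N_def)
  then have N: "N \<subseteq> {y \<in> Y0 \<inter> ball y0 \<delta>. card (roots y) = card (roots y0)}"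
    by (auto simp: N_def)
  have \<xi>N: "\<xi> y \<in> centered" "LLc y = config_of (\<xi> y)" if "y \<in> N" for y
    using \<xi>(3) N that flat_subset by blast+
  have "openin (top_of_set centered) (\<xi> ` N)"
  proof (rule invariance_of_domain_subspaces)
    show "openin (top_of_set Y0) N"
      unfolding N_def using assms(5) by (intro openin_open_Int open_Int) auto
    show "continuous_on N \<xi>" "inj_on \<xi> N"
      using \<xi>(4,5) N by (auto intro: continuous_on_subset inj_on_subset)
    show "\<xi> \<in> N \<rightarrow> centered" using \<xi>N by auto
  qed (rule subspace_Y0 subspace_centered dim_centered_le)+
  moreover have "x0 \<in> \<xi> ` N"
    using \<xi>(1,6) assms by (auto simp: N_def image_iff intro!: exI[of _ y0])
  moreover have "config_of ` \<xi> ` N \<subseteq> LLc ` (Y0 \<inter> U)"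
  proof
    fix C assume "C \<in> config_of ` \<xi> ` N"
    then obtain y where "y \<in> N" "C = config_of (\<xi> y)" by blast
    then have "C = LLc y" "y \<in> Y0 \<inter> U" using \<xi>N(2) by (auto simp: N_def)
    then show "C \<in> LLc ` (Y0 \<inter> U)" by blast
  qed
  ultimately show ?thesis by blast
qed

text \<open>
  The configurations without multiple points form a connected dense subset, on which the image is
  open and closed.
\<close>

lemma image_LLc_contains:
  assumes N: "open N" "convex N" and K: "closed K" "K \<subseteq> Y0"
    and interior: "\<And>y x. y \<in> K \<Longrightarrow> x \<in> N \<Longrightarrow> x \<in> centered \<Longrightarrow> LLc y = config_of x \<Longrightarrow>
      \<exists>U. open U \<and> y \<in> U \<and> Y0 \<inter> U \<subseteq> K"
    and start: "y1 \<in> K" "x1 \<in> N" "x1 \<in> centered" "LLc y1 = config_of x1" "inj (($) x1)"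
    and x: "x \<in> N" "x \<in> centered"
  shows "config_of x \<in> LLc ` K"
proof -
  define I where "I = {(i :: 'n, j :: 'n). i \<noteq> j}"
  define S where "S = {z \<in> N \<inter> centered. difference_product I z \<noteq> 0}"
  have S: "z \<in> S \<longleftrightarrow> z \<in> N \<and> z \<in> centered \<and> inj (($) z)" for z
    unfolding S_def difference_product_nonzero_iff by (auto simp: I_def inj_def)
  have "connected S"
    unfolding S_def by (rule connected_hypersurface_complement[OF difference_product_polynomial N centered_subspace])
  define Z where "Z = {x \<in> centered. config_of x \<in> LLc ` K}"
  have "closed Z" unfolding Z_def by (rule closed_LLc_preimage[OF K])
  then have "closedin (top_of_set S) (S \<inter> Z)" by (rule closedin_closed_Int)
  moreover have "openin (top_of_set S) (S \<inter> Z)"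
  proof (subst openin_subopen, clarify)
    fix z assume z: "z \<in> S" "z \<in> Z"
    then obtain y where y: "y \<in> K" "LLc y = config_of z" by (auto simp: Z_def)
    \<comment> \<open>\<open>interior\<close> keeps the open set provided by local openness inside
      \<open>K\<close>, so the image of \<open>K\<close> itself is open at \<open>z\<close>.\<close>
    then obtain U where U: "open U" "y \<in> U" "Y0 \<inter> U \<subseteq> K" using interior z S by blast
    obtain A where A: "openin (top_of_set centered) A" "z \<in> A" "config_of ` A \<subseteq> LLc ` (Y0 \<inter> U)"
      using LLc_open_at_regular_point[OF _ _ y(2) _ U(1,2)] y(1) K(2) z(1) S by blast
    have "openin (top_of_set S) (S \<inter> A)"
    proof -
      obtain A' where "open A'" "A = centered \<inter> A'" using A(1) by (auto simp: openin_open)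
      then have "S \<inter> A = S \<inter> A'" using S by auto
      then show ?thesis using \<open>open A'\<close> by (simp add: openin_open_Int)
    qed
    moreover have "config_of z \<in> LLc ` K" if "z \<in> A" for z using that A(3) U(3) by blast
    then have "S \<inter> A \<subseteq> S \<inter> Z" using S by (auto simp: Z_def)
    ultimately show "\<exists>T. openin (top_of_set S) T \<and> z \<in> T \<and> T \<subseteq> S \<inter> Z"
      using A(2) z(1) by blast
  qed
  moreover have "x1 \<in> S \<inter> Z" using start imageI[OF start(1), of LLc] by (simp add: S Z_def)
  ultimately have "S \<subseteq> Z" using \<open>connected S\<close> unfolding connected_clopen by blast
  moreover have "x \<in> closure S" unfolding closure_approachable
  proof (intro allI impI)
    fix e :: real assume "e > 0"
    \<comment> \<open>The line towards \<open>x1\<close> leaves the zeros of the difference product,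
      so it meets them in finitely many points only and points of \<open>S\<close> occur arbitrarily
      close to \<open>x\<close>.\<close>
    define l where "l = (\<lambda>t::complex. x + t *s (x1 - x))"
    have "l 0 = x" "l 1 = x1" by (simp_all add: l_def)
    have "isCont l 0"
      using continuous_on_line[of UNIV x "x1 - x"] by (simp add: l_def continuous_on_eq_continuous_at)
    moreover have "open (N \<inter> ball x e)" "l 0 \<in> N \<inter> ball x e"
      using N(1) x(1) \<open>e > 0\<close> \<open>l 0 = x\<close> by auto
    ultimately have "\<forall>\<^sub>F t in at 0. l t \<in> N \<inter> ball x e"
      unfolding continuous_at by (rule topological_tendstoD)
    moreover have fin: "finite {t. difference_product I (l t) = 0}"
      unfolding l_def using start \<open>l 1 = x1\<close> S[of x1]
      by (intro polynomial_zeros_on_line_finite[OF difference_product_polynomial, of I x 1]) (simp add: S_def)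
    have "\<forall>\<^sub>F t in at 0. t \<in> - ({t. difference_product I (l t) = 0} - {0}) - {0}"
      by (intro eventually_at_in_open open_Compl finite_imp_closed) (use fin in auto)
    ultimately have "\<forall>\<^sub>F t in at 0. l t \<in> N \<inter> ball x e \<and> difference_product I (l t) \<noteq> 0"
      by eventually_elim auto
    then obtain t where t: "l t \<in> N \<inter> ball x e" "difference_product I (l t) \<noteq> 0"
      using eventually_happens[of _ "at (0::complex)"] by (auto simp: trivial_limit_at)
    have "l t \<in> centered" unfolding l_def using x(2) start(3)
      by (intro vec.subspace_add vec.subspace_scale vec.subspace_diff centered_subspace)
    then have "l t \<in> S" using t by (simp add: S_def)
    then show "\<exists>z\<in>S. dist z x < e" using t(1) by (auto simp: dist_commute)
  qed
  ultimately have "x \<in> Z" using \<open>closed Z\<close> closure_minimal by blast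
  then show ?thesis by (simp add: Z_def)
qed

lemma LLc_surjective: "LLc ` Y0 = UNIV"
proof -
  have "0 \<in> Y0" by (simp add: Y0_def)
  then obtain y1 where y1: "y1 \<in> Y0" "card (roots y1) = CARD('n)"
    using regular_points_dense[of UNIV 0] by auto
  obtain x1 where x1: "x1 \<in> centered" "LLc y1 = config_of x1" using ex_LLc_eq by blast
  have "inj (($) x1)" using y1(2) roots_eq_range[OF x1] by (intro eq_card_imp_inj_on) auto
  have "C \<in> LLc ` Y0" for C
  proof -
    obtain x where x: "x \<in> centered" "C = config_of x" using config_of_surj by (metis UNIV_I imageE)
    then show ?thesis
      using image_LLc_contains[of UNIV Y0 y1 x1 x] closed_Y0 y1(1) x1 \<open>inj (($) x1)\<close> by blast
  qed
  then show ?thesis by blast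
qed

text \<open>On a small closed ball about \<open>y0\<close> the fibre through \<open>y0\<close> is
  that point alone. The image of the boundary sphere therefore misses a ball about
  \<open>x0\<close>, and over this ball \<open>image_LLc_contains\<close> fills in every
  configuration.\<close>

lemma LLc_open:
  assumes "y0 \<in> Y0" "open U" "y0 \<in> U"
  shows "\<exists>A. open A \<and> LLc y0 \<in> A \<and> A \<subseteq> LLc ` (Y0 \<inter> U)"
proof -
  obtain x0 where x0: "x0 \<in> centered" "LLc y0 = config_of x0" using ex_LLc_eq by blast
  obtain \<delta>1 where \<delta>1: "\<delta>1 > 0" "cball y0 \<delta>1 \<subseteq> U"
    using assms(2,3) open_contains_cball by blast
  obtain \<delta>2 where \<delta>2: "\<delta>2 > 0" "\<And>y1 y2. y1 \<in> Y0 \<inter> ball y0 \<delta>2 \<Longrightarrow> y2 \<in> Y0 \<inter> ball y0 \<delta>2 \<Longrightarrow>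
    LLc y1 = LLc y2 \<Longrightarrow> card (roots y1) = card (roots y0) \<Longrightarrow> y1 = y2"
    by (rule LLc_locally_injective[OF assms(1)]) (rule that)
  define r where "r = min \<delta>1 (\<delta>2 / 2)"
  have r: "r > 0" "cball y0 r \<subseteq> U" "cball y0 r \<subseteq> ball y0 \<delta>2"
    using \<delta>1 \<delta>2(1) by (auto simp: r_def)
  define Z where "Z = {x \<in> centered. config_of x \<in> LLc ` (Y0 \<inter> sphere y0 r)}"
  have "closed Z" unfolding Z_def using closed_Y0 by (intro closed_LLc_preimage) auto
  moreover have "x0 \<notin> Z"
  proof
    assume "x0 \<in> Z"
    then obtain y where y: "y \<in> Y0" "dist y0 y = r" "LLc y = LLc y0"
      using x0(2) by (auto simp: Z_def)
    then have "y \<in> ball y0 \<delta>2" using r(3) by auto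
    moreover have "card (roots y) = card (roots y0)" using y(3) set_points_LLc by metis
    ultimately have "y = y0" using \<delta>2 y assms(1) by auto
    then show False using y(2) r(1) by simp
  qed
  ultimately have "open (- Z)" "x0 \<in> - Z" by auto
  then obtain e where "e > 0" "ball x0 e \<subseteq> - Z" using openE by blast
  then have e: "e > 0" "ball x0 e \<inter> Z = {}" by auto
  define K where "K = Y0 \<inter> cball y0 r"
  obtain \<eta> where \<eta>: "\<eta> > 0" "\<And>y. dist y y0 < \<eta> \<Longrightarrow> \<exists>x\<in>centered. x \<in> ball x0 e \<and> LLc y = config_of x"
    using LLc_lift_near[OF x0 e(1)] unfolding eventually_nhds_metric by blast
  \<comment> \<open>Density provides the regular starting point inside the ball and over the
    neighbourhood of \<open>x0\<close>.\<close>
  obtain y1 where y1: "y1 \<in> ball y0 (min \<eta> r) \<inter> Y0" "card (roots y1) = CARD('n)"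
    using regular_points_dense[of "ball y0 (min \<eta> r)" y0] assms(1) \<eta>(1) r(1) by auto
  obtain x1 where x1: "x1 \<in> centered" "x1 \<in> ball x0 e" "LLc y1 = config_of x1"
    using \<eta>(2)[of y1] y1(1) by (auto simp: dist_commute)
  have "inj (($) x1)" using y1(2) roots_eq_range[OF x1(1,3)] by (intro eq_card_imp_inj_on) auto
  have "config_of x \<in> LLc ` K" if x: "x \<in> ball x0 e" "x \<in> centered" for x
  proof (rule image_LLc_contains[of "ball x0 e" K y1 x1 x])
    show "\<exists>U. open U \<and> y \<in> U \<and> Y0 \<inter> U \<subseteq> K"
      if "y \<in> K" "x \<in> ball x0 e" "x \<in> centered" "LLc y = config_of x" for y x
    proof -
      have "y \<notin> sphere y0 r"
      proof
        assume "y \<in> sphere y0 r"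
        then have "config_of x \<in> LLc ` (Y0 \<inter> sphere y0 r)"
          using that(1,4) unfolding K_def by (metis IntD1 IntI imageI)
        then have "x \<in> Z" using that(3) by (simp add: Z_def)
        then show False using e(2) that(2) by blast
      qed
      then show ?thesis using that(1) by (intro exI[of _ "ball y0 r"]) (auto simp: K_def)
    qed
  qed (use closed_Y0 y1 x1 x \<open>inj (($) x1)\<close> in \<open>auto simp: K_def\<close>)
  then have "config_of ` (centered \<inter> ball x0 e) \<subseteq> LLc ` (Y0 \<inter> U)"
    using r(2) unfolding K_def by blast
  moreover have "open (config_of ` (centered \<inter> ball x0 e))"
    by (intro open_config_of_image) (simp add: openin_open_Int)
  moreover have "LLc y0 \<in> config_of ` (centered \<inter> ball x0 e)" using x0 e(1) by auto
  ultimately show ?thesis by blast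
qed

section \<open>The covering on strata\<close>

definition Y0_stratum :: "nat multiset \<Rightarrow> (complex^'n) set" where
  "Y0_stratum l = {y \<in> Y0. LLc y \<in> E_stratum l}"

lemma covering_LLc: "covering_space (Y0_stratum l) LLc (E_stratum l)"
proof (rule covering_space_closed_open_map)
  show "LLc ` Y0_stratum l = E_stratum l"
  proof (intro subset_antisym subsetI)
    fix C :: "'n config" assume "C \<in> E_stratum l"
    moreover obtain y where "y \<in> Y0" "C = LLc y" using LLc_surjective by (metis UNIV_I imageE)
    ultimately show "C \<in> LLc ` Y0_stratum l" by (simp add: Y0_stratum_def)
  qed (auto simp: Y0_stratum_def)
  show "openin (top_of_set (E_stratum l)) (LLc ` U)" if "openin (top_of_set (Y0_stratum l)) U" for U
  proof (subst openin_subopen, clarify)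
    fix y assume y: "y \<in> U"
    obtain U' where U': "open U'" "U = Y0_stratum l \<inter> U'"
      using \<open>openin (top_of_set (Y0_stratum l)) U\<close> by (auto simp: openin_open)
    then obtain A where A: "open A" "LLc y \<in> A" "A \<subseteq> LLc ` (Y0 \<inter> U')"
      using LLc_open[of y U'] y by (auto simp: Y0_stratum_def)
    have "E_stratum l \<inter> A \<subseteq> LLc ` U"
    proof
      fix C assume C: "C \<in> E_stratum l \<inter> A"
      then obtain y' where "y' \<in> Y0" "y' \<in> U'" "C = LLc y'" using A(3) by blast
      with C show "C \<in> LLc ` U"
        unfolding U'(2) Y0_stratum_def by blast
    qed
    moreover have "LLc y \<in> E_stratum l" using y U' by (simp add: Y0_stratum_def)
    ultimately show "\<exists>T. openin (top_of_set (E_stratum l)) T \<and> LLc y \<in> T \<and> T \<subseteq> LLc ` U"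
      using A(1,2) by (intro exI[of _ "E_stratum l \<inter> A"]) (auto simp: openin_open_Int)
  qed
  show "closedin (top_of_set (E_stratum l)) (LLc ` K)" if "closedin (top_of_set (Y0_stratum l)) K" for K
  proof -
    obtain K' where K': "closed K'" "K = Y0_stratum l \<inter> K'"
      using \<open>closedin (top_of_set (Y0_stratum l)) K\<close> by (auto simp: closedin_closed)
    then have "LLc ` K = E_stratum l \<inter> LLc ` (Y0 \<inter> K')" unfolding Y0_stratum_def by blast
    moreover have "closed (LLc ` (Y0 \<inter> K'))"
      using closed_Y0 K'(1) by (intro closed_LLc_image) auto
    ultimately show ?thesis by (simp add: closedin_closed_Int)
  qed
  show "finite (Y0_stratum l \<inter> LLc -` {C})" for C
    by (rule finite_subset[OF _ finite_fibre[of C]]) (auto simp: Y0_stratum_def)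
  show "\<exists>U. openin (top_of_set (Y0_stratum l)) U \<and> y \<in> U \<and> inj_on LLc U" if y: "y \<in> Y0_stratum l" for y
  proof -
    have "y \<in> Y0" using y by (simp add: Y0_stratum_def)
    obtain \<delta> where \<delta>: "\<delta> > 0" "\<And>y1 y2. y1 \<in> Y0 \<inter> ball y \<delta> \<Longrightarrow> y2 \<in> Y0 \<inter> ball y \<delta> \<Longrightarrow>
        LLc y1 = LLc y2 \<Longrightarrow> card (roots y1) = card (roots y) \<Longrightarrow> y1 = y2"
      by (rule LLc_locally_injective[OF \<open>y \<in> Y0\<close>]) (rule that)
    \<comment> \<open>On a stratum the number of distinct roots is the number of parts of
      \<open>l\<close>.\<close>
    have "card (roots y') = card (roots y)" if "y' \<in> Y0_stratum l" for y'
      using that y size_multiplicities_LLc unfolding Y0_stratum_def E_stratum_def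
      by (metis (mono_tags, lifting) mem_Collect_eq)
    then have "inj_on LLc (Y0_stratum l \<inter> ball y \<delta>)"
      using \<delta>(2) by (intro inj_onI) (auto simp: Y0_stratum_def)
    then show ?thesis
      using y \<delta>(1) by (intro exI[of _ "Y0_stratum l \<inter> ball y \<delta>"]) (auto simp: openin_open_Int)
  qed
qed (rule continuous_on_LLc)

definition to_Y0 :: "(nat \<Rightarrow> complex) \<Rightarrow> complex^'n" where
  "to_Y0 y = (\<chi> k. if k = top_idx then 0 else y (idx k))"

lemma homeomorphism_Y_stratum:
  "homeomorphism (Y_stratum a TYPE('n) l) (Y0_stratum l) to_Y0 base"
proof -
  have base_to_Y0: "base (to_Y0 y) = y" if "y \<in> Y_space CARD('n)" for y
  proof
    fix i
    show "base (to_Y0 y) i = y i"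
    proof (cases "i \<in> {1..<CARD('n)}")
      case True
      then have "idx (inv_into UNIV idx i) = i" "inv_into UNIV idx i \<noteq> top_idx"
        using idx_inv[of i] idx_top by auto
      then show ?thesis using True by (simp add: base_def to_Y0_def)
    next
      case False
      then show ?thesis using that by (auto simp: base_def Y_space_def PiE_def extensional_def)
    qed
  qed
  have to_Y0_base: "to_Y0 (base y) = y" if "y \<in> Y0" for y
    using that idx_less inv_idx by (auto simp: to_Y0_def base_def Y0_def vec_eq_iff)
  have Y_space: "base y \<in> Y_space CARD('n)" for y by (auto simp: base_def Y_space_def)
  have Y0: "to_Y0 y \<in> Y0" for y by (simp add: to_Y0_def Y0_def)
  show ?thesis unfolding homeomorphism_def
  proof (intro conjI ballI)
    show "continuous_on (Y_stratum a TYPE('n) l) to_Y0" unfolding to_Y0_def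
      by (rule continuous_on_vec_componentwise, rename_tac k, case_tac "k = top_idx")
        (auto intro: continuous_on_subset[OF continuous_on_product_coordinates])
    show "continuous_on (Y0_stratum l) base"
    proof (rule continuous_on_coordinatewise_then_product)
      fix i
      show "continuous_on (Y0_stratum l) (\<lambda>y. base y i)"
        by (cases "i \<in> {1..<CARD('n)}") (auto simp: base_def intro!: continuous_intros)
    qed
    show "base (to_Y0 y) = y" if "y \<in> Y_stratum a TYPE('n) l" for y
      using that base_to_Y0 by (simp add: Y_stratum_def)
    show "to_Y0 (base y) = y" if "y \<in> Y0_stratum l" for y
      using that to_Y0_base by (simp add: Y0_stratum_def)
    show "to_Y0 ` Y_stratum a TYPE('n) l = Y0_stratum l"
    proof (intro subset_antisym subsetI)
      fix y assume "y \<in> Y0_stratum l"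
      then have "base y \<in> Y_stratum a TYPE('n) l" "to_Y0 (base y) = y"
        using Y_space to_Y0_base by (auto simp: Y_stratum_def Y0_stratum_def LLc_def)
      then show "y \<in> to_Y0 ` Y_stratum a TYPE('n) l" by (metis imageI)
    qed (use base_to_Y0 Y0 in \<open>auto simp: Y_stratum_def Y0_stratum_def LLc_def\<close>)
    show "base ` Y0_stratum l = Y_stratum a TYPE('n) l"
    proof (intro subset_antisym subsetI)
      fix y assume y: "y \<in> Y_stratum a TYPE('n) l"
      then have "to_Y0 y \<in> Y0_stratum l" "base (to_Y0 y) = y"
        using Y0 base_to_Y0 by (auto simp: Y_stratum_def Y0_stratum_def LLc_def)
      then show "y \<in> base ` Y0_stratum l" by (metis imageI)
    qed (use Y_space in \<open>auto simp: Y_stratum_def Y0_stratum_def LLc_def\<close>)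
  qed
qed

lemma covering_LL: "covering_space (Y_stratum a TYPE('n) l) (LL a :: _ \<Rightarrow> 'n config) (E_stratum l)"
proof (rule covering_space_compose_homeomorphism[OF covering_LLc homeomorphism_Y_stratum])
  show "(LL a y :: 'n config) = LLc (to_Y0 y)" if "y \<in> Y_stratum a TYPE('n) l" for y
    using homeomorphism_apply1[OF homeomorphism_Y_stratum that] by (simp add: LLc_def)
qed

end

theorem mainTheorem6:
  fixes W :: "(complex^'n^'n) set"
    and f :: "nat \<Rightarrow> complex^'n \<Rightarrow> complex"
    and d :: "nat \<Rightarrow> nat"
    and \<alpha> :: "(complex^'n) set \<Rightarrow> complex^'n \<Rightarrow> complex"
    and a :: "nat \<Rightarrow> (nat \<Rightarrow> complex) \<Rightarrow> complex"
    and c :: complex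
    and n :: nat
    and l :: "nat multiset"
  assumes "n = CARD('n)"
    and "finite W" "reflection_group W" "irreducible_group W" "well_generated W"
    and "\<And>i. i \<in> {1..n} \<Longrightarrow> homogeneous (d i) (f i)"
    and "algebra_generated (f ` {1..n}) = invariants W"
    and "mono_on {1..n} d"
    and "\<And>H. H \<in> reflecting_hyperplanes W \<Longrightarrow> linear_form (\<alpha> H) \<and> {v. \<alpha> H v = 0} = H"
    and "\<And>i. i \<in> {2..n} \<Longrightarrow> a i \<in> Y_polynomials n"
    and "c \<noteq> 0"
    and "\<And>v. c * discriminant W \<alpha> v =
           poly (disc_poly n a (restrict (\<lambda>i. f i v) {1..<n})) (f n v)"
    and "is_partition l n"
  shows "(LL a :: _ \<Rightarrow> 'n config) ` Y_stratum a TYPE('n) l = E_stratum l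
       \<and> (\<forall>y \<in> Y_stratum a TYPE('n) l.
            covering_space (path_component_set (Y_stratum a TYPE('n) l) y)
              (LL a :: _ \<Rightarrow> 'n config) (E_stratum l))"
proof -
  \<comment> \<open>Any bijection between the index type and the numbers from 1 to \<open>n\<close>
    serves as \<open>idx\<close>.\<close>
  obtain g where g: "bij_betw g (UNIV :: 'n set) {1..CARD('n)}"
    using finite_same_card_bij[of "UNIV :: 'n set" "{1..CARD('n)}"] by auto
  have "W \<noteq> {mat 1}"
  proof -
    obtain R where R: "R \<subseteq> W" "\<forall>r\<in>R. reflection r" "card R = CARD('n)"
      using assms(5) by (auto simp: well_generated_def)
    then have "R \<noteq> {}" by auto
    then show ?thesis using R(1,2) by (auto simp: reflection_def)
  qed
  note W = this
  have subgroup: "subgroup W GL" using assms(3) by (simp add: reflection_group_def)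
  note A = assms(2,4,6,7,9-12)[unfolded assms(1)]
  interpret lyashko_looijenga W f d g \<alpha> a c
    by (intro lyashko_looijenga.intro invariant_coordinates.intro lyashko_looijenga_axioms.intro)
      (erule A | rule A subgroup g W)+
  have cover: "covering_space (Y_stratum a TYPE('n) l) (LL a :: _ \<Rightarrow> 'n config) (E_stratum l)"
    by (rule covering_LL)
  then show ?thesis using covering_space_imp_surjective[OF cover]
      covering_space_path_component[OF cover connected_E_stratum E_stratum_locally_path_connected]
    by blast
qed

end
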